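(* Let $p>1$ and let $q:[0,1]\to\mathbb{R}$ be continuous, single-barrier, and satisfy $q(x)\le 0$ on $[0,1]$. Let $\lambda_1<\lambda_2<\cdots<\lambda_n<\cdots$ be the eigenvalues of the Dirichlet problem $$-\big((y')^{(p-1)}\big)'=(p-1)(\lambda-q(x))y^{(p-1)},\quad x\in[0,1],\qquad y(0)=y(1)=0,$$ and let $q^{*}=\inf\{q(0),q(1)\}$. Then the $n$th and $m$th eigenvalues with $\lambda_n>\lambda_m\ge -2q^{*}$ satisfy $$\frac{\lambda_n}{\lambda_m}\ge\frac{n^p}{m^p}.$$ Moreover, if equality holds for two different such $m$ and $n$, then $q\equiv 0$ in $(0,1)$.
   Context: For real $f$, write $f^{(p-1)}=|f|^{p-1}\operatorname{sgn}(f)=|f|^{p-2}f$ (with value $0$ at $f=0$). An eigenvalue is a real $\lambda$ for which the boundary value problem has a nontrivial solution; it is known that the eigenvalues form an infinite increasing sequence $\lambda_1<\lambda_2<\cdots$, indexed starting from $n=1$. The function $q$ is called single-barrier on $[0,1]$ if there is $x_0\in[0,1]$ such that $q$ is increasing in $[0,x_0]$ and decreasing in $[x_0,1]$ (monotonicity in the non-strict sense). *)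

theory Defs
  imports Complex_Main
begin

text \<open>For \<open>r = p - 1\<close> this is the signed power \<open>|f|^(p-2) f\<close>, with value \<open>0\<close> at \<open>f = 0\<close>.\<close>

definition signed_powr :: "real \<Rightarrow> real \<Rightarrow> real" where
  "signed_powr f r = \<bar>f\<bar> powr r * sgn f"

text \<open>
  Classical solutions, with one-sided derivatives at the endpoints; \<open>dy\<close> is \<open>y'\<close> and \<open>dw\<close> is the
  derivative of \<open>signed_powr y' (p - 1)\<close>. Continuity of \<open>y'\<close> is not demanded separately:
  \<open>signed_powr y' (p - 1)\<close> is differentiable, hence continuous, and for \<open>p > 1\<close> the map
  \<open>\<lambda>f. signed_powr f (p - 1)\<close> is a homeomorphism of the real line.
\<close>

definition dirichlet_solution ::
    "real \<Rightarrow> (real \<Rightarrow> real) \<Rightarrow> real \<Rightarrow> (real \<Rightarrow> real) \<Rightarrow> bool" where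
  "dirichlet_solution p q \<mu> y \<longleftrightarrow>
     (\<exists>dy dw.
        (\<forall>x\<in>{0..1}. (y has_real_derivative dy x) (at x within {0..1})) \<and>
        (\<forall>x\<in>{0..1}. ((\<lambda>t. signed_powr (dy t) (p - 1)) has_real_derivative dw x)
                        (at x within {0..1})) \<and>
        (\<forall>x\<in>{0..1}. - dw x = (p - 1) * (\<mu> - q x) * signed_powr (y x) (p - 1))) \<and>
     y 0 = 0 \<and> y 1 = 0"

definition dirichlet_eigenvalue :: "real \<Rightarrow> (real \<Rightarrow> real) \<Rightarrow> real \<Rightarrow> bool" where
  "dirichlet_eigenvalue p q \<mu> \<longleftrightarrow>
     (\<exists>y. dirichlet_solution p q \<mu> y \<and> (\<exists>x\<in>{0..1}. y x \<noteq> 0))"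

definition single_barrier :: "(real \<Rightarrow> real) \<Rightarrow> bool" where
  "single_barrier q \<longleftrightarrow>
     (\<exists>x0\<in>{0..1}. mono_on {0..x0} q \<and> antimono_on {x0..1} q)"

end

(*
  Write z = lambda^(1/p) and let phi be the Pruefer phase with respect to the generalized sine S_p,
  so that phi' = z + z^(1-p) (-q) |S_p(phi)|^p. If lambda is the k-th eigenvalue, then phi runs from
  0 to k pi_p. Measured from both endpoints up to the top x0 of the barrier, the two phases add up
  to k pi_p, so it suffices that phi(x0)/z is decreasing in z when Q = -q >= 0 is decreasing.

  The sign of d/dz (phi/z) is opposite to that of the integral of R Q G(phi) over [0, x0], where
  G(u) = p |S_p(u)|^p - u (|S_p|^p)'(u) and R > 0 is an integrating factor. In the variable
  u = phi(x), concavity of S_p gives G > 0 on (0, pi_p) and G(k pi_p - t) + G(k pi_p + t) >= 0 for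
  0 <= t <= pi_p/2, with G(k pi_p - t) >= 0. As Q decreases and Q <= z^p, the weight at k pi_p - t
  is at least the weight at k pi_p + t, so the integral is nonnegative, and positive unless Q(0) = 0.
*)
theory Submission
  imports Defs "HOL-Analysis.Analysis"
begin

section \<open>Signed powers and scalar differential inequalities\<close>

text \<open>The system for \<open>y\<close> and \<open>y'\<close> fails to be Lipschitz, at zeros of
  \<open>y\<close> when p < 2 and at zeros of \<open>y'\<close> when p > 2. The phase equation is
  Lipschitz, because |S_p|^p has a bounded derivative. Hence solutions are compared only through
  their phases, and the generalized sine is built from an inverse integral rather than from an
  initial value problem.

  The sequence \<open>lam\<close> is known only as an increasing enumeration, so that its k-th
  member has phase k pi_p is itself proved. This is done with scale 1 in place of z, where the
  parameter enters one coefficient only and the phase is monotone in it; the scale is afterwards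
  moved to z.

  The weights are understood from constant Q. With e = Q / z^p the integrating factor is 1 / (1 + e
  |S_p|^p), the change of variable to the phase contributes the same factor, and e / (1 + e
  |S_p|^p)^2 increases with e as long as e |S_p|^p <= 1. That is where Q <= z^p comes from. For
  variable Q the integrating factor is compared with the two constant cases given by the paired
  points.\<close>

lemma signed_powr_0 [simp]: "signed_powr 0 r = 0"
  by (simp add: signed_powr_def)

lemma signed_powr_minus: "signed_powr (- x) r = - signed_powr x r"
  by (simp add: signed_powr_def sgn_minus)

lemma signed_powr_pos: "x > 0 \<Longrightarrow> signed_powr x r = x powr r"
  by (simp add: signed_powr_def)

lemma signed_powr_nonneg: "x \<ge> 0 \<Longrightarrow> signed_powr x r \<ge> 0"
  by (simp add: signed_powr_def)

lemma signed_powr_one [simp]: "signed_powr x 1 = x"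
  by (simp add: signed_powr_def abs_mult_sgn)

lemma signed_powr_eq_0_iff [simp]: "signed_powr x r = 0 \<longleftrightarrow> x = 0"
  by (auto simp: signed_powr_def sgn_eq_0_iff)

lemma sgn_signed_powr [simp]: "sgn (signed_powr x r) = sgn x"
  by (cases "x = 0") (auto simp: signed_powr_def sgn_mult)

lemma abs_signed_powr: "\<bar>signed_powr x r\<bar> = \<bar>x\<bar> powr r"
  by (cases "x = 0") (auto simp: signed_powr_def abs_mult)

lemma signed_powr_mult: "signed_powr (x * y) r = signed_powr x r * signed_powr y r"
  by (simp add: signed_powr_def abs_mult sgn_mult powr_mult)

lemma signed_powr_signed_powr: "signed_powr (signed_powr x a) b = signed_powr x (a * b)"
  using abs_signed_powr[of x a] sgn_signed_powr[of x a]
  by (simp add: signed_powr_def[of "signed_powr x a"] signed_powr_def[of x "a * b"] powr_powr)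

lemma signed_powr_mult_self: "signed_powr x r * x = \<bar>x\<bar> powr (r + 1)"
proof (cases "x = 0")
  case False
  have "sgn x * x = \<bar>x\<bar>"
    by (simp add: sgn_if)
  then show ?thesis
    using False by (simp add: signed_powr_def mult.assoc powr_add)
qed auto

lemma signed_powr_inverse: "r > 0 \<Longrightarrow> signed_powr (signed_powr x r) (1 / r) = x"
  by (simp add: signed_powr_signed_powr)

lemma signed_powr_inject: "r > 0 \<Longrightarrow> signed_powr x r = signed_powr y r \<longleftrightarrow> x = y"
  by (metis signed_powr_inverse)

section \<open>Differentiability and continuity of signed powers\<close>

lemma DERIV_abs_powr:
  fixes p x :: real
  assumes "p > 1"
  shows "((\<lambda>t. \<bar>t\<bar> powr p) has_real_derivative p * signed_powr x (p - 1)) (at x)"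
proof -
  consider "x > 0" | "x < 0" | "x = 0" by linarith
  then show ?thesis
  proof cases
    case 1
    have "((\<lambda>t. t powr p) has_real_derivative p * signed_powr x (p - 1)) (at x)"
      using 1 by (auto intro!: derivative_eq_intros simp: signed_powr_pos powr_diff)
    then show ?thesis
      by (rule DERIV_cong_ev[THEN iffD1, rotated -1])
        (use 1 in \<open>auto intro!: eventually_mono[OF eventually_nhds_in_open[of "{0<..}" x]]\<close>)
  next
    case 2
    have "((\<lambda>t. (- t) powr p) has_real_derivative p * signed_powr x (p - 1)) (at x)"
      using 2 by (auto intro!: derivative_eq_intros simp: signed_powr_def powr_diff)
    then show ?thesis
      by (rule DERIV_cong_ev[THEN iffD1, rotated -1])
        (use 2 in \<open>auto intro!: eventually_mono[OF eventually_nhds_in_open[of "{..<0}" x]]\<close>)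
  next
    case 3
    have lim: "((\<lambda>h. \<bar>h\<bar> powr (p - 1)) \<longlongrightarrow> 0) (at (0::real))"
      using assms by (auto intro!: tendsto_zero_powrI tendsto_rabs_zero)
    have "((\<lambda>h. \<bar>h\<bar> powr p / h) \<longlongrightarrow> 0) (at (0::real))"
    proof (rule Lim_null_comparison[OF _ lim])
      show "\<forall>\<^sub>F h::real in at 0. norm (\<bar>h\<bar> powr p / h) \<le> \<bar>h\<bar> powr (p - 1)"
        unfolding eventually_at_filter
        by (rule always_eventually) (auto simp: abs_divide powr_diff)
    qed
    then show ?thesis
      using 3 assms by (simp add: has_field_derivative_iff)
  qed
qed

lemma DERIV_signed_powr:
  fixes r x :: real
  assumes "x \<noteq> 0"
  shows "((\<lambda>t. signed_powr t r) has_real_derivative r * \<bar>x\<bar> powr (r - 1)) (at x)"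
proof (cases "x > 0")
  case True
  have "((\<lambda>t. t powr r) has_real_derivative r * \<bar>x\<bar> powr (r - 1)) (at x)"
    using True by (auto intro!: derivative_eq_intros simp: powr_diff)
  then show ?thesis
    by (rule DERIV_cong_ev[THEN iffD1, rotated -1])
      (use True in \<open>auto intro!: eventually_mono[OF eventually_nhds_in_open[of "{0<..}" x]]
        simp: signed_powr_def\<close>)
next
  case False
  with assms have x: "x < 0" by simp
  have "((\<lambda>t. - ((- t) powr r)) has_real_derivative r * \<bar>x\<bar> powr (r - 1)) (at x)"
    using x by (auto intro!: derivative_eq_intros simp: powr_diff)
  then show ?thesis
    by (rule DERIV_cong_ev[THEN iffD1, rotated -1])
      (use x in \<open>auto intro!: eventually_mono[OF eventually_nhds_in_open[of "{..<0}" x]]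
        simp: signed_powr_def\<close>)
qed

lemma isCont_signed_powr:
  fixes r x :: real
  assumes "r > 0"
  shows "isCont (\<lambda>t. signed_powr t r) x"
proof (cases "x = 0")
  case True
  have "((\<lambda>t. \<bar>t\<bar> powr r) \<longlongrightarrow> 0) (at (0::real))"
    using assms by (auto intro!: tendsto_zero_powrI tendsto_rabs_zero)
  then have "((\<lambda>t. signed_powr t r) \<longlongrightarrow> 0) (at 0)"
    by (subst tendsto_rabs_zero_iff[symmetric]) (simp add: abs_signed_powr)
  then show ?thesis
    using True by (simp add: isCont_def)
qed (use DERIV_signed_powr DERIV_isCont in blast)

lemma continuous_on_signed_powr [continuous_intros]:
  fixes f :: "'a::topological_space \<Rightarrow> real"
  assumes "continuous_on A f" "r > 0"
  shows "continuous_on A (\<lambda>x. signed_powr (f x) r)"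
proof -
  have "continuous_on UNIV (\<lambda>t. signed_powr t r)"
    using isCont_signed_powr[OF assms(2)] by (simp add: continuous_on_eq_continuous_at)
  from continuous_on_compose2[OF this assms(1)] show ?thesis by simp
qed

text \<open>Unlike \<open>antiderivative_continuous\<close>, this works on the whole line.\<close>

lemma real_antiderivative:
  fixes f :: "real \<Rightarrow> real"
  assumes "continuous_on UNIV f"
  shows "\<exists>A. A 0 = 0 \<and> (\<forall>x. (A has_real_derivative f x) (at x))"
proof -
  define A where "A t = integral {0..t} f - integral {t..0} f" for t
  have "(A has_real_derivative f x) (at x)" for x
  proof -
    define N where "N = \<bar>x\<bar> + 1"
    obtain G where G: "\<And>y. y \<in> {-N..N} \<Longrightarrow> (G has_real_derivative f y) (at y within {-N..N})"
      using antiderivative_continuous[of "-N" N f] continuous_on_subset[OF assms]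
      by (auto simp: has_real_derivative_iff_has_vector_derivative)
    have AG: "A t = G t - G 0" if "t \<in> {-N..N}" for t
    proof (cases "t \<ge> 0")
      case True
      have "(f has_integral (G t - G 0)) {0..t}"
        using True that
        by (intro fundamental_theorem_of_calculus)
          (auto simp: has_real_derivative_iff_has_vector_derivative[symmetric]
            intro: DERIV_subset[OF G])
      moreover have "integral {t..0} f = 0"
        using True by (cases "t = 0") auto
      ultimately show ?thesis by (simp add: A_def integral_unique)
    next
      case False
      then have "(f has_integral (G 0 - G t)) {t..0}"
        using that
        by (intro fundamental_theorem_of_calculus)
          (auto simp: has_real_derivative_iff_has_vector_derivative[symmetric]
            intro: DERIV_subset[OF G])
      then show ?thesis using False by (simp add: A_def integral_unique)
    qed
    have "((\<lambda>t. G t - G 0) has_real_derivative f x) (at x)"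
    proof -
      have "at x within {-N..N} = at x"
        by (rule at_within_interior) (auto simp: N_def)
      moreover have "x \<in> {-N..N}" by (auto simp: N_def)
      ultimately have "(G has_real_derivative f x) (at x)"
        using G[of x] by simp
      then show ?thesis by (auto intro!: derivative_eq_intros)
    qed
    moreover have "\<forall>\<^sub>F t in nhds x. A t = G t - G 0"
      by (rule eventually_mono[OF eventually_nhds_in_open[of "{-N<..<N}" x]])
        (auto simp: N_def intro!: AG)
    ultimately show ?thesis
      using DERIV_cong_ev[of x x A "\<lambda>t. G t - G 0" "f x" "f x"] by simp
  qed
  moreover have "A 0 = 0" by (simp add: A_def)
  ultimately show ?thesis by blast
qed

text \<open>L'Hopital's rule carries a derivative formula across a point at which only continuity is
  known. It serves where the branches of the generalized sine and cosine meet.\<close>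

lemma DERIV_by_continuity:
  fixes f g :: "real \<Rightarrow> real"
  assumes "isCont f a" "isCont g a"
    and "\<forall>\<^sub>F x in at a. (f has_real_derivative g x) (at x)"
  shows "(f has_real_derivative g a) (at a)"
proof -
  have "((\<lambda>x. (f x - f a) / (x - a)) \<longlongrightarrow> g a) (at a)"
  proof (rule lhopital)
    show "((\<lambda>x. f x - f a) \<longlongrightarrow> 0) (at a)"
      using assms(1) by (simp add: isCont_def LIM_zero)
    show "((\<lambda>x. x - a) \<longlongrightarrow> 0) (at a)"
      by (auto intro!: tendsto_eq_intros)
    show "\<forall>\<^sub>F x in at a. x - a \<noteq> 0"
      by (auto simp: eventually_at_filter)
    show "\<forall>\<^sub>F x in at a. (1::real) \<noteq> 0" by simp
    show "\<forall>\<^sub>F x in at a. ((\<lambda>x. f x - f a) has_real_derivative g x) (at x)"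
      using assms(3) by eventually_elim (auto intro!: derivative_eq_intros)
    show "\<forall>\<^sub>F x in at a. ((\<lambda>x. x - a) has_real_derivative 1) (at x)"
      by (auto intro!: always_eventually derivative_eq_intros)
    show "((\<lambda>x. g x / 1) \<longlongrightarrow> g a) (at a)"
      using assms(2) by (simp add: isCont_def)
  qed
  then show ?thesis by (simp add: has_field_derivative_iff)
qed

text \<open>The square of the negative part of \<open>f\<close> is differentiable even where
  \<open>f\<close> changes sign, and multiplied by \<open>exp (- 2 * L * x)\<close> it cannot grow.
  It vanishes at 0, hence also at \<open>c\<close>.\<close>

lemma gronwall_nonneg:
  fixes f f' :: "real \<Rightarrow> real"
  assumes "0 \<le> f 0" "0 \<le> c"
    and der: "\<And>x. 0 \<le> x \<Longrightarrow> x \<le> c \<Longrightarrow> (f has_real_derivative f' x) (at x)"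
    and ge: "\<And>x. 0 \<le> x \<Longrightarrow> x \<le> c \<Longrightarrow> f' x \<ge> - L * \<bar>f x\<bar>"
  shows "0 \<le> f c"
proof -
  define m where "m u = (min u 0)\<^sup>2" for u :: real
  have m: "(m has_real_derivative 2 * min u 0) (at u)" for u
  proof -
    consider "u > 0" | "u < 0" | "u = 0" by linarith
    then show ?thesis
    proof cases
      case 1
      have "((\<lambda>t. 0) has_real_derivative 2 * min u 0) (at u)" using 1 by simp
      then show ?thesis
        by (rule DERIV_cong_ev[THEN iffD1, rotated -1])
          (use 1 in \<open>auto intro!: eventually_mono[OF eventually_nhds_in_open[of "{0<..}" u]]
            simp: m_def\<close>)
    next
      case 2
      have "((\<lambda>t. t\<^sup>2) has_real_derivative 2 * min u 0) (at u)"
        using 2 by (auto intro!: derivative_eq_intros)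
      then show ?thesis
        by (rule DERIV_cong_ev[THEN iffD1, rotated -1])
          (use 2 in \<open>auto intro!: eventually_mono[OF eventually_nhds_in_open[of "{..<0}" u]]
            simp: m_def\<close>)
    next
      case 3
      have "((\<lambda>h. m h / h) \<longlongrightarrow> 0) (at 0)"
      proof (rule Lim_null_comparison)
        show "\<forall>\<^sub>F h in at 0. norm (m h / h) \<le> \<bar>h\<bar>"
          by (rule always_eventually)
            (auto simp: m_def min_def power2_eq_square abs_mult)
        show "((\<lambda>h::real. \<bar>h\<bar>) \<longlongrightarrow> 0) (at 0)"
          by (auto intro!: tendsto_eq_intros)
      qed
      then show ?thesis using 3 by (simp add: has_field_derivative_iff m_def)
    qed
  qed
  define E where "E x = m (f x) * exp (- 2 * L * x)" for x
  have "E c \<le> E 0"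
  proof (rule DERIV_nonpos_imp_nonincreasing[OF \<open>0 \<le> c\<close>])
    fix x assume x: "0 \<le> x" "x \<le> c"
    have "(E has_real_derivative
        2 * min (f x) 0 * f' x * exp (- 2 * L * x) + m (f x) * (exp (- 2 * L * x) * (- 2 * L))) (at x)"
      unfolding E_def
      by (rule derivative_eq_intros DERIV_chain2[OF m] der x refl)+ simp
    \<comment> \<open>Only points with \<open>f x < 0\<close> matter, and there the bound
      \<open>- L * \<bar>f x\<bar>\<close> is the linear term \<open>L * f x\<close>, whatever the
      sign of \<open>L\<close>.\<close>
    moreover have "2 * min (f x) 0 * f' x \<le> 2 * L * m (f x)"
    proof (cases "f x < 0")
      case True
      have "f' x \<ge> L * f x" using ge[OF x] True by simp
      then have "f x * f' x \<le> f x * (L * f x)"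
        using True by (intro mult_left_mono_neg) auto
      then show ?thesis using True by (simp add: m_def power2_eq_square algebra_simps)
    qed (auto simp: m_def)
    then have "(2 * min (f x) 0 * f' x - 2 * L * m (f x)) * exp (- 2 * L * x) \<le> 0"
      by (intro mult_nonpos_nonneg) auto
    ultimately show "\<exists>y. DERIV E x :> y \<and> y \<le> 0"
      by (auto simp: algebra_simps intro!: exI)
  qed
  also have "E 0 = 0" using assms(1) by (simp add: E_def m_def)
  finally have "m (f c) \<le> 0" by (simp add: E_def mult_le_0_iff)
  then show ?thesis by (simp add: m_def min_def split: if_splits)
qed

text \<open>The function \<open>d * x * exp (L * x)\<close> grows at least as fast as the bound
  allows, so its differences with \<open>f\<close> and with \<open>- f\<close> fall under
  \<open>gronwall_nonneg\<close>.\<close>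

lemma gronwall_abs_le:
  fixes f f' :: "real \<Rightarrow> real"
  assumes f0: "f 0 = 0" and c: "0 \<le> c" and d: "0 \<le> d" and L: "0 \<le> L"
    and der: "\<And>x. 0 \<le> x \<Longrightarrow> x \<le> c \<Longrightarrow> (f has_real_derivative f' x) (at x)"
    and le: "\<And>x. 0 \<le> x \<Longrightarrow> x \<le> c \<Longrightarrow> \<bar>f' x\<bar> \<le> L * \<bar>f x\<bar> + d"
  shows "\<bar>f c\<bar> \<le> d * c * exp (L * c)"
proof -
  have *: "s * f c \<le> d * c * exp (L * c)" if s: "s = 1 \<or> s = -1" for s
  proof -
    define v where "v x = d * x * exp (L * x) - s * f x" for x
    have "0 \<le> v c"
    proof (rule gronwall_nonneg[where L = L, OF _ c])
      show "0 \<le> v 0" by (simp add: v_def f0)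
      fix x assume x: "0 \<le> x" "x \<le> c"
      show "(v has_real_derivative
          d * exp (L * x) + d * x * (exp (L * x) * L) - s * f' x) (at x)"
        unfolding v_def by (rule derivative_eq_intros der x refl)+ (simp add: algebra_simps)
      have "d * 1 \<le> d * exp (L * x)"
        using d L x by (intro mult_left_mono) auto
      moreover have "s * f' x \<le> L * \<bar>f x\<bar> + d"
        using le[OF x] s by auto
      moreover have "\<bar>f x\<bar> - d * x * exp (L * x) \<le> \<bar>v x\<bar>"
      proof -
        have "0 \<le> d * x * exp (L * x)" using d x by simp
        then show ?thesis using s unfolding v_def by auto
      qed
      then have "L * (\<bar>f x\<bar> - d * x * exp (L * x)) \<le> L * \<bar>v x\<bar>"
        using L by (rule mult_left_mono)
      ultimately show "- L * \<bar>v x\<bar> \<le> d * exp (L * x) + d * x * (exp (L * x) * L) - s * f' x"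
        by (simp add: algebra_simps)
    qed
    then show ?thesis by (simp add: v_def)
  qed
  from *[of 1] *[of "-1"] show ?thesis by (simp add: abs_if)
qed

text \<open>Integration gains the factor \<open>1 / a\<close> in the sup norm weighted by
  \<open>exp (- a * \<bar>x\<bar>)\<close>. A large \<open>a\<close> thus makes Picard iteration
  contract on the whole line at once.\<close>

lemma exp_weighted_antiderivative_bound:
  fixes U u :: "real \<Rightarrow> real"
  assumes U0: "U 0 = 0" and a: "a > 0" and c: "c \<ge> 0"
    and der: "\<And>x. (U has_real_derivative u x) (at x)"
    and le: "\<And>x. \<bar>u x\<bar> \<le> c * exp (a * \<bar>x\<bar>)"
  shows "\<bar>U x\<bar> \<le> c / a * exp (a * \<bar>x\<bar>)"
proof -
  \<comment> \<open>\<open>V\<close> ranges over \<open>U\<close>, \<open>- U\<close> and their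
    reflections at 0, so a one-sided bound on the right half-line is enough.\<close>
  have *: "V x \<le> c / a * exp (a * x)"
    if "x \<ge> 0" "V 0 = 0" "\<And>x. (V has_real_derivative v x) (at x)"
      "\<And>x. \<bar>v x\<bar> \<le> c * exp (a * \<bar>x\<bar>)"
    for V v :: "real \<Rightarrow> real" and x
  proof -
    have "V x - c / a * exp (a * x) \<le> V 0 - c / a * exp (a * 0)"
    proof (rule DERIV_nonpos_imp_nonincreasing[OF \<open>x \<ge> 0\<close>])
      fix y assume "0 \<le> y" "y \<le> x"
      have "((\<lambda>x. V x - c / a * exp (a * x)) has_real_derivative v y - c * exp (a * y)) (at y)"
        using a by (auto intro!: derivative_eq_intros that(3))
      moreover have "v y - c * exp (a * y) \<le> 0"
        using that(4)[of y] \<open>0 \<le> y\<close> by (auto simp: abs_if split: if_splits)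
      ultimately show "\<exists>D. ((\<lambda>x. V x - c / a * exp (a * x)) has_real_derivative D) (at y) \<and> D \<le> 0"
        by blast
    qed
    moreover have "0 \<le> c / a" using a c by simp
    ultimately show ?thesis using that(2) by simp
  qed
  have neg: "((\<lambda>x. - U x) has_real_derivative - u x) (at x)" for x
    using der by (auto intro!: derivative_eq_intros)
  have refl: "((\<lambda>x. U (- x)) has_real_derivative - u (- x)) (at x)" for x
    using DERIV_mirror[where f = U and x = x and y = "u (- x)"] der[of "- x"] by simp
  have refln: "((\<lambda>x. - U (- x)) has_real_derivative u (- x)) (at x)" for x
    using refl[of x] by (auto intro!: derivative_eq_intros)
  show ?thesis
  proof (cases "x \<ge> 0")
    case True
    then show ?thesis
      using *[OF True U0 der le] *[of x "\<lambda>x. - U x" "\<lambda>x. - u x", OF True _ neg] U0 le by auto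
  next
    case False
    then have "- x \<ge> 0" by simp
    from *[OF this, of "\<lambda>x. U (- x)", OF _ refl] *[OF this, of "\<lambda>x. - U (- x)", OF _ refln]
    show ?thesis using U0 le[of "- _"] False by auto
  qed
qed

text \<open>A single contraction suffices: candidates are written as the weight \<open>w\<close>
  times a bounded continuous function, and boundedness of \<open>F\<close> keeps the integrated
  candidate in that space.\<close>

lemma picard_global:
  fixes F :: "real \<Rightarrow> real \<Rightarrow> real"
  assumes cont: "\<And>f. continuous_on UNIV f \<Longrightarrow> continuous_on UNIV (\<lambda>x. F x (f x))"
    and bdd: "\<And>x u. \<bar>F x u\<bar> \<le> M"
    and lip: "\<And>x u v. \<bar>F x u - F x v\<bar> \<le> L * \<bar>u - v\<bar>"
  shows "\<exists>f. f 0 = 0 \<and> (\<forall>x. (f has_real_derivative F x (f x)) (at x))"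
proof -
  \<comment> \<open>The iteration has Lipschitz constant \<open>\<bar>L\<bar> / a\<close>, which
    this choice makes at most 1/2.\<close>
  define a where "a = 2 * (\<bar>L\<bar> + 1)"
  have a: "a > 0" by (simp add: a_def)
  define w where "w x = exp (a * \<bar>x\<bar>)" for x :: real
  have w: "w x > 0" "w x \<ge> 1" for x
    using a by (auto simp: w_def)
  have wcont: "continuous_on UNIV w"
    unfolding w_def by (intro continuous_intros)
  have M: "M \<ge> 0" using bdd[of 0 0] by linarith
  define G where "G g = (\<lambda>x. F x (w x * apply_bcontfun g x))" for g :: "real \<Rightarrow>\<^sub>C real"
  define A where "A g = (SOME B. B 0 = 0 \<and> (\<forall>x. (B has_real_derivative G g x) (at x)))"
    for g :: "real \<Rightarrow>\<^sub>C real"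
  have A0: "A g 0 = 0" and Ader: "\<And>x. (A g has_real_derivative G g x) (at x)" for g
  proof -
    have "continuous_on UNIV (G g)"
      unfolding G_def by (intro cont continuous_intros wcont) simp
    from someI_ex[OF real_antiderivative[OF this]]
    show "A g 0 = 0" "\<And>x. (A g has_real_derivative G g x) (at x)"
      by (auto simp: A_def)
  qed
  have Abd: "\<bar>A g x / w x\<bar> \<le> M / a" for g x
  proof -
    have "\<bar>G g x\<bar> \<le> M * exp (a * \<bar>x\<bar>)" for x
    proof -
      have "\<bar>G g x\<bar> \<le> M * 1" unfolding G_def using bdd by simp
      also have "\<dots> \<le> M * exp (a * \<bar>x\<bar>)"
        using M w(2)[of x] unfolding w_def by (intro mult_left_mono) auto
      finally show ?thesis .
    qed
    from exp_weighted_antiderivative_bound[OF A0 a M Ader this]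
    have "\<bar>A g x\<bar> \<le> M / a * w x" by (simp add: w_def)
    then show ?thesis using w(1)[of x] by (simp add: abs_divide pos_divide_le_eq)
  qed
  define T where "T g = Bcontfun (\<lambda>x. A g x / w x)" for g
  have Tin: "(\<lambda>x. A g x / w x) \<in> bcontfun" for g
  proof -
    have "continuous_on UNIV (A g)"
      using Ader by (meson DERIV_isCont continuous_at_imp_continuous_on)
    then have "continuous_on UNIV (\<lambda>x. A g x / w x)"
      using w(1) by (intro continuous_intros wcont) (auto simp: less_imp_neq[symmetric])
    moreover have "bounded (range (\<lambda>x. A g x / w x))"
      unfolding bounded_iff using Abd by auto
    ultimately show ?thesis by (simp add: bcontfun_def)
  qed
  have Tapp: "apply_bcontfun (T g) x = A g x / w x" for g x
    by (simp add: T_def Bcontfun_inverse[OF Tin])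
  have "dist (T g) (T h) \<le> 1 / 2 * dist g h" for g h
  proof (rule dist_bound)
    fix x
    have bd: "\<bar>G g y - G h y\<bar> \<le> \<bar>L\<bar> * dist g h * exp (a * \<bar>y\<bar>)" for y
    proof -
      have "\<bar>G g y - G h y\<bar> \<le> L * \<bar>w y * apply_bcontfun g y - w y * apply_bcontfun h y\<bar>"
        unfolding G_def by (rule lip)
      also have "\<dots> \<le> \<bar>L\<bar> * \<bar>w y * apply_bcontfun g y - w y * apply_bcontfun h y\<bar>"
        by (intro mult_right_mono) auto
      also have "\<bar>w y * apply_bcontfun g y - w y * apply_bcontfun h y\<bar>
          = w y * dist (apply_bcontfun g y) (apply_bcontfun h y)"
        using w(1)[of y] by (simp add: dist_real_def abs_mult flip: right_diff_distrib)
      also have "\<bar>L\<bar> * \<dots> \<le> \<bar>L\<bar> * (w y * dist g h)"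
        using w(1)[of y] dist_bounded[of g y h] by (intro mult_left_mono) auto
      finally show ?thesis by (simp add: w_def mult_ac)
    qed
    have "((\<lambda>x. A g x - A h x) has_real_derivative G g y - G h y) (at y)" for y
      by (intro derivative_intros Ader)
    from exp_weighted_antiderivative_bound[OF _ a _ this bd, of x]
    have "\<bar>A g x - A h x\<bar> \<le> \<bar>L\<bar> * dist g h / a * w x"
      by (simp add: A0 w_def)
    also have "\<bar>L\<bar> * dist g h / a = (\<bar>L\<bar> / a) * dist g h" by simp
    also have "\<dots> \<le> (1 / 2) * dist g h"
      by (intro mult_right_mono) (auto simp: a_def field_simps)
    finally have "\<bar>A g x - A h x\<bar> \<le> (1 / 2 * dist g h) * w x"
      using w(1)[of x] by simp
    then show "dist (apply_bcontfun (T g) x) (apply_bcontfun (T h) x) \<le> 1 / 2 * dist g h"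
      using w(1)[of x] unfolding Tapp dist_real_def
      by (simp add: diff_divide_distrib[symmetric] abs_divide pos_divide_le_eq)
  qed
  then obtain g where g: "T g = g"
    using banach_fix_type[of "1/2" T] by auto
  have fix_eq: "w x * apply_bcontfun g x = A g x" for x
    using Tapp[of g x] w(1)[of x] unfolding g by simp
  have "(A g has_real_derivative F x (A g x)) (at x)" for x
    using Ader[of g x] by (simp add: G_def fix_eq)
  with A0 show ?thesis by blast
qed

section \<open>The generalized sine\<close>

text \<open>\<open>S\<close> is the generalized sine \<open>S\<^sub>p\<close>, \<open>D\<close> its derivative and \<open>P = \<pi>\<^sub>p\<close> the half-period.
  For \<open>p > 2\<close> the function \<open>D\<close> need not be differentiable where it vanishes, but its signed
  power is.\<close>

locale p_trig =
  fixes p P :: real and S D :: "real \<Rightarrow> real"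
  assumes p_gt_1: "p > 1" and P_pos: "P > 0"
    and DERIV_S: "(S has_real_derivative D u) (at u)"
    and DERIV_C: "((\<lambda>u. signed_powr (D u) (p - 1)) has_real_derivative
                    - (p - 1) * signed_powr (S u) (p - 1)) (at u)"
    and pyth: "\<bar>S u\<bar> powr p + \<bar>D u\<bar> powr p = 1"
    and S_shift: "S (u + P) = - S u" and D_shift: "D (u + P) = - D u"
    and S_minus: "S (- u) = - S u" and D_minus: "D (- u) = D u"
    and S_pos: "0 < u \<Longrightarrow> u < P \<Longrightarrow> S u > 0"
    and D_pos: "\<bar>u\<bar> < P / 2 \<Longrightarrow> D u > 0"

text \<open>\<open>A\<close> will be the inverse of the generalized tangent \<open>S / D\<close>.\<close>

lemma arctan_p_antiderivative:
  fixes p :: real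
  assumes "p > 0"
  obtains A where "A 0 = 0" "strict_mono A"
    "\<And>t. (A has_real_derivative 1 / (1 + \<bar>t\<bar> powr p)) (at t)"
proof -
  have pos: "1 + \<bar>t\<bar> powr p > 0" for t :: real
    by (simp add: add_pos_nonneg)
  have "continuous_on UNIV (\<lambda>t::real. 1 / (1 + \<bar>t\<bar> powr p))"
    using assms less_imp_neq[OF pos]
    by (intro continuous_on_divide continuous_on_add continuous_on_powr' continuous_intros)
      (auto simp: eq_commute[of 0])
  then obtain A where A: "A 0 = 0"
      "\<And>t. (A has_real_derivative 1 / (1 + \<bar>t\<bar> powr p)) (at t)"
    using real_antiderivative by blast
  have "strict_mono A"
    unfolding strict_mono_def using DERIV_pos_imp_increasing[of _ _ A] A(2) pos
    by (meson zero_less_divide_1_iff)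
  with A show ?thesis using that by blast
qed

text \<open>\<open>T\<close> is the generalized tangent and \<open>h\<close> a quarter period. The
  range of \<open>A\<close> is bounded because \<open>p > 1\<close> makes
  \<open>t powr (- p)\<close> integrable at infinity; its supremum \<open>h\<close> is not attained,
  which yields the blow-up of \<open>T\<close> at \<open>h\<close>.\<close>

lemma arctan_p_inverse:
  fixes p :: real
  assumes p: "p > 1"
  obtains h T where "h > 0" "\<And>v. T (- v) = - T v" "T 0 = 0"
    "\<And>v. \<bar>v\<bar> < h \<Longrightarrow> (T has_real_derivative 1 + \<bar>T v\<bar> powr p) (at v)"
    "filterlim T at_top (at_left h)"
    "\<And>v. 0 < v \<Longrightarrow> v < h \<Longrightarrow> T v > 0"
proof -
  obtain A where A0: "A 0 = 0" and sm: "strict_mono A"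
    and A: "\<And>t. (A has_real_derivative 1 / (1 + \<bar>t\<bar> powr p)) (at t)"
    using arctan_p_antiderivative[of p] p by auto
  have pos: "1 + \<bar>t\<bar> powr p > 0" for t :: real
    by (simp add: add_pos_nonneg)
  have cont: "isCont A t" for t
    using A DERIV_isCont by blast
  have odd: "A (- t) = - A t" for t
  proof -
    have "((\<lambda>t. A t + A (- t)) has_real_derivative 0) (at t)" for t
    proof -
      have "((\<lambda>t. A (- t)) has_real_derivative - (1 / (1 + \<bar>t\<bar> powr p))) (at t)"
        using A[of "- t"] DERIV_mirror[where f = A and x = t] by simp
      from DERIV_add[OF A[of t] this] show ?thesis by simp
    qed
    from DERIV_isconst_all[OF allI[OF this]] have "A t + A (- t) = A 0 + A (- 0)" by blast
    then show ?thesis by (simp add: A0)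
  qed
  have bound: "A t \<le> A 1 + 1 / (p - 1)" for t
  proof (cases "t \<ge> 1")
    case True
    \<comment> \<open>The added term is the integral of \<open>s powr (- p)\<close> over
      \<open>s > t\<close>. Since that integrand dominates the derivative of \<open>A\<close>, the
      sum is nonincreasing.\<close>
    have "A t + t powr (1 - p) / (p - 1) \<le> A 1 + 1 powr (1 - p) / (p - 1)"
    proof (rule DERIV_nonpos_imp_nonincreasing[OF True])
      fix x :: real assume x: "1 \<le> x" "x \<le> t"
      have "((\<lambda>t. A t + t powr (1 - p) / (p - 1)) has_real_derivative
          1 / (1 + \<bar>x\<bar> powr p) + ((1 - p) * x powr (1 - p - 1)) / (p - 1)) (at x)"
        using x by (intro DERIV_add A DERIV_cdivide has_real_derivative_powr) auto
      moreover have "((1 - p) * x powr (1 - p - 1)) / (p - 1) = - (x powr (- p))"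
        using p by (simp add: field_simps)
      moreover have "1 / (1 + \<bar>x\<bar> powr p) \<le> x powr (- p)"
        using x by (simp add: powr_minus_divide frac_le)
      ultimately show "\<exists>y. ((\<lambda>t. A t + t powr (1 - p) / (p - 1)) has_real_derivative y) (at x) \<and> y \<le> 0"
        by (intro exI conjI) auto
    qed
    moreover have "0 \<le> t powr (1 - p) / (p - 1)" using p by simp
    ultimately show ?thesis by simp
  next
    case False
    then have "A t \<le> A 1" using strict_mono_mono[OF sm] by (simp add: monoD)
    then show ?thesis using p by (simp add: add_increasing2)
  qed
  define h where "h = Sup (range A)"
  have bdd: "bdd_above (range A)"
    using bound by (auto simp: bdd_above_def)
  have A_less: "A t < h" for t
  proof -
    have "A t < A (t + 1)" using sm by (simp add: strict_mono_less)
    also have "\<dots> \<le> h" unfolding h_def using bdd by (simp add: cSUP_upper)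
    finally show ?thesis .
  qed
  have h0: "h > 0" using A_less[of 0] A0 by simp
  have ex: "\<exists>t. A t = v" if vh: "\<bar>v\<bar> < h" for v
  proof -
    have *: "\<exists>t\<ge>0. A t = v" if v: "0 \<le> v" "v < h" for v
    proof -
      obtain t where t: "v < A t"
        using v(2) less_cSUP_iff[OF _ bdd] unfolding h_def by auto
      have "0 \<le> t"
        using t v(1) A0 strict_mono_less[OF sm, of t 0] by linarith
      then show ?thesis
        using IVT[of A 0 v t] t v A0 cont by auto
    qed
    show ?thesis
    proof (cases "v \<ge> 0")
      case True then show ?thesis using * that by auto
    next
      case False
      then obtain t where "A t = - v" using *[of "- v"] vh by (auto simp: abs_if)
      then show ?thesis using odd[of t] by (intro exI[of _ "- t"]) simp
    qed
  qed
  have inj: "inj A" using sm strict_mono_imp_inj_on by blast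
  \<comment> \<open>The default 0 keeps \<open>T\<close> odd on the whole line, also at the ends of
    the interval.\<close>
  define T where "T v = (if \<bar>v\<bar> < h then inv A v else 0)" for v
  have AT: "A (T v) = v" if "\<bar>v\<bar> < h" for v
    using ex[OF that] that by (auto simp: T_def f_inv_into_f)
  have A_abs: "\<bar>A t\<bar> < h" for t
    using A_less[of t] A_less[of "- t"] odd[of t] by auto
  have TA: "T (A t) = t" for t
    using A_abs[of t] inj by (simp add: T_def)
  show ?thesis
  proof (rule that[of h T])
    show "h > 0" by (rule h0)
    show "T (- v) = - T v" for v
    proof (cases "\<bar>v\<bar> < h")
      case True
      then have "A (- T v) = - v" by (simp add: odd AT)
      then show ?thesis using TA by metis
    qed (simp add: T_def)
    show "T 0 = 0" using TA[of 0] A0 by simp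
    show "(T has_real_derivative 1 + \<bar>T v\<bar> powr p) (at v)" if v: "\<bar>v\<bar> < h" for v
    proof -
      have "isCont T (A (T v))"
        by (rule isCont_inverse_function[where d = 1]) (use TA cont in auto)
      then have "(T has_real_derivative inverse (1 / (1 + \<bar>T v\<bar> powr p))) (at v)"
        using v pos[of "T v"] AT[OF v]
        by (intro DERIV_inverse_function[where f = A and a = "- h" and b = h] A) (auto intro!: AT)
      then show ?thesis by simp
    qed
    show "filterlim T at_top (at_left h)"
      unfolding filterlim_at_top
    proof
      fix Z
      have "max (A Z) (- h) < h" using A_less h0 by simp
      then show "\<forall>\<^sub>F v in at_left h. Z \<le> T v"
      proof (rule eventually_at_leftI[rotated])
        fix v assume v: "v \<in> {max (A Z) (- h)<..<h}"
        then have "A Z < A (T v)" using AT[of v] by auto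
        then show "Z \<le> T v" using sm by (simp add: strict_mono_less)
      qed
    qed
    show "T v > 0" if "0 < v" "v < h" for v
    proof -
      have "A 0 < A (T v)" using AT[of v] that A0 by simp
      then show ?thesis using sm by (simp add: strict_mono_less)
    qed
  qed
qed

text \<open>With S / D = T, the Pythagorean identity determines D up to sign as (1 + |T|^p)^(-1/p).
  The circular functions of \<open>\<omega> * u\<close> do the bookkeeping of period, symmetry and
  sign. The derivative formulas are verified away from the zeros of
  \<open>cos (\<omega> * u)\<close> and extended to them by continuity.\<close>

lemma p_trig_exists:
  fixes p :: real
  assumes p: "p > 1"
  shows "\<exists>P S D. p_trig p P S D"
proof -
  obtain h T where h: "h > 0" and T_minus: "\<And>v. T (- v) = - T v" and T0: "T 0 = 0"
    and T: "\<And>v. \<bar>v\<bar> < h \<Longrightarrow> (T has_real_derivative 1 + \<bar>T v\<bar> powr p) (at v)"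
    and T_lim: "filterlim T at_top (at_left h)"
    and T_pos: "\<And>v. 0 < v \<Longrightarrow> v < h \<Longrightarrow> T v > 0"
    using arctan_p_inverse[OF p] by blast
  define P where "P = 2 * h"
  define \<omega> where "\<omega> = pi / P"
  have P: "P > 0" "\<omega> > 0" and wP: "\<omega> * P = pi" using h by (auto simp: P_def \<omega>_def)
  define tri where "tri u = arcsin (sin (\<omega> * u)) / \<omega>" for u
  define c where "c t = 1 + \<bar>t\<bar> powr p" for t :: real
  have c: "c t > 0" "c t \<ge> 1" for t by (simp_all add: c_def add_pos_nonneg)
  have DERIV_c: "(c has_real_derivative p * signed_powr t (p - 1)) (at t)" for t
    unfolding c_def using DERIV_add[OF DERIV_const[of 1] DERIV_abs_powr[OF p, of t]] by simp
  text \<open>The triangular wave folds the line onto the quarter period; the sign of the derivative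
    has to be put back by hand.\<close>
  define D where "D u = (if cos (\<omega> * u) = 0 then 0
    else sgn (cos (\<omega> * u)) * c (T (tri u)) powr (- 1 / p))" for u
  define S where "S u = (if cos (\<omega> * u) = 0 then sgn (sin (\<omega> * u))
    else T (tri u) * c (T (tri u)) powr (- 1 / p))" for u
  have hw: "h * \<omega> = pi / 2" using h by (simp add: \<omega>_def P_def)
  have tri_abs: "\<bar>tri u\<bar> \<le> h" for u
  proof -
    have "\<bar>arcsin (sin (\<omega> * u))\<bar> \<le> h * \<omega>"
      unfolding hw using arcsin_bounded[of "sin (\<omega> * u)"] by (auto simp: abs_le_iff)
    then show ?thesis using P by (simp add: tri_def abs_divide pos_divide_le_eq)
  qed
  have sin_lt: "\<bar>sin (\<omega> * u)\<bar> < 1" if "cos (\<omega> * u) \<noteq> 0" for u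
  proof -
    have "(sin (\<omega> * u))\<^sup>2 < 1\<^sup>2"
      using that sin_cos_squared_add[of "\<omega> * u"] by (simp add: sin_squared_eq)
    then show ?thesis using abs_square_less_1 by auto
  qed
  have tri_less: "\<bar>tri u\<bar> < h" if "cos (\<omega> * u) \<noteq> 0" for u
  proof -
    have "\<bar>arcsin (sin (\<omega> * u))\<bar> < h * \<omega>"
      unfolding hw using arcsin_lt_bounded[of "sin (\<omega> * u)"] sin_lt[OF that]
      by (auto simp: abs_less_iff)
    then show ?thesis using P by (simp add: tri_def abs_divide pos_divide_less_eq)
  qed
  have tri_eq: "\<bar>tri u\<bar> = h" if "cos (\<omega> * u) = 0" for u
  proof -
    have "sin (\<omega> * u) = 1 \<or> sin (\<omega> * u) = -1"
      using that sin_cos_squared_add[of "\<omega> * u"] by (simp add: power2_eq_1_iff)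
    then show ?thesis using hw P
      by (auto simp: tri_def abs_divide field_simps)
  qed
  have tri_cont: "continuous_on UNIV tri"
    unfolding tri_def using P by (intro continuous_intros) auto
  have DERIV_tri: "(tri has_real_derivative sgn (cos (\<omega> * u))) (at u)"
    if "cos (\<omega> * u) \<noteq> 0" for u
  proof -
    have "((\<lambda>u. arcsin (sin (\<omega> * u)) / \<omega>) has_real_derivative
        (inverse (sqrt (1 - (sin (\<omega> * u))\<^sup>2)) * (cos (\<omega> * u) * \<omega>)) / \<omega>) (at u)"
      by (rule derivative_eq_intros DERIV_chain2[OF DERIV_arcsin] refl | use sin_lt[OF that] P in force)+
    moreover have "sqrt (1 - (sin (\<omega> * u))\<^sup>2) = \<bar>cos (\<omega> * u)\<bar>"
      by (metis cos_squared_eq real_sqrt_abs)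
    ultimately show ?thesis
      using P that by (simp add: tri_def[abs_def] sgn_if abs_if split: if_splits)
  qed
  define X where "X u = T (tri u)" for u
  have DERIV_X: "(X has_real_derivative c (X u) * sgn (cos (\<omega> * u))) (at u)"
    if "cos (\<omega> * u) \<noteq> 0" for u
    unfolding X_def c_def using DERIV_chain2[OF T[OF tri_less[OF that]] DERIV_tri[OF that]] by simp
  have open_cos: "open {u. cos (\<omega> * u) * s > 0}" for s
    by (intro open_Collect_less continuous_intros)
  have ev_cos: "\<forall>\<^sub>F v in nhds u. cos (\<omega> * v) \<noteq> 0 \<and> sgn (cos (\<omega> * v)) = sgn (cos (\<omega> * u))"
    if "cos (\<omega> * u) \<noteq> 0" for u
  proof -
    have "u \<in> {v. cos (\<omega> * v) * cos (\<omega> * u) > 0}"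
      using that by (simp add: zero_less_mult_iff) linarith
    from eventually_nhds_in_open[OF open_cos this]
    show ?thesis by eventually_elim (auto simp: zero_less_mult_iff sgn_if)
  qed
  have ss: "sgn x * sgn x = 1" if "x \<noteq> 0" for x :: real
    using that by (simp add: sgn_if)
  have powr_c: "c t powr a * c t = c t powr (a + 1)" for t a
    using c[of t] by (simp add: powr_add)
  have exponent: "(1 - p) / p = - ((p - 1) / p)"
    by (simp add: diff_divide_distrib)
  have DERIV_S_off: "(S has_real_derivative D u) (at u)" if u: "cos (\<omega> * u) \<noteq> 0" for u
  proof -
    let ?x = "X u" and ?s = "sgn (cos (\<omega> * u))"
    have "((\<lambda>v. X v * c (X v) powr (- 1 / p)) has_real_derivative
       (c ?x * ?s) * c ?x powr (- 1 / p) +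
       ((- 1 / p) * c ?x powr (- 1 / p - 1) * (p * signed_powr ?x (p - 1) * (c ?x * ?s))) * ?x) (at u)"
      by (rule derivative_eq_intros DERIV_X[OF u] DERIV_chain2[OF DERIV_c] c refl)+
    also have "(c ?x * ?s) * c ?x powr (- 1 / p) +
       ((- 1 / p) * c ?x powr (- 1 / p - 1) * (p * signed_powr ?x (p - 1) * (c ?x * ?s))) * ?x
       = ?s * (c ?x powr (- 1 / p) * (c ?x - signed_powr ?x (p - 1) * ?x))"
      using p powr_c[of ?x "- 1 / p - 1"] by (simp add: algebra_simps)
    also have "c ?x - signed_powr ?x (p - 1) * ?x = 1"
      by (simp add: signed_powr_mult_self c_def)
    finally have *: "((\<lambda>v. X v * c (X v) powr (- 1 / p)) has_real_derivative D u) (at u)"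
      using u by (simp add: D_def X_def)
    show ?thesis
      by (rule DERIV_cong_ev[THEN iffD1, OF refl _ refl *])
        (use ev_cos[OF u] in \<open>auto simp: S_def X_def elim!: eventually_mono\<close>)
  qed
  have D_powr: "signed_powr (D u) (p - 1) =
      sgn (cos (\<omega> * u)) * c (X u) powr (- (p - 1) / p)" if "cos (\<omega> * u) \<noteq> 0" for u
  proof -
    have "D u = sgn (cos (\<omega> * u)) * c (X u) powr (- 1 / p)" using that by (simp add: D_def X_def)
    then show ?thesis
      using c[of "X u"] that
      by (simp add: signed_powr_def sgn_mult abs_mult powr_powr exponent)
  qed
  have DERIV_C_off: "((\<lambda>u. signed_powr (D u) (p - 1)) has_real_derivative
      - (p - 1) * signed_powr (S u) (p - 1)) (at u)" if u: "cos (\<omega> * u) \<noteq> 0" for u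
  proof -
    let ?x = "X u" and ?s = "sgn (cos (\<omega> * u))"
    have "((\<lambda>v. ?s * c (X v) powr (- (p - 1) / p)) has_real_derivative
       ?s * ((- (p - 1) / p) * c ?x powr (- (p - 1) / p - 1) *
             (p * signed_powr ?x (p - 1) * (c ?x * ?s)))) (at u)"
      by (rule derivative_eq_intros DERIV_X[OF u] DERIV_chain2[OF DERIV_c] c refl)+ (simp only: mult_ac mult_zero_left add_0)
    also have "?s * ((- (p - 1) / p) * c ?x powr (- (p - 1) / p - 1) *
             (p * signed_powr ?x (p - 1) * (c ?x * ?s)))
       = (?s * ?s) * (- (p - 1) * (signed_powr ?x (p - 1) * c ?x powr (- (p - 1) / p)))"
    proof -
      have "s * ((- (p - 1) / p) * q * (p * x * (d * s))) = (s * s) * (- (p - 1) * (x * (q * d)))"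
        for s q x d
        using p by (simp add: field_simps)
      from this[of ?s "c ?x powr (- (p - 1) / p - 1)" "signed_powr ?x (p - 1)" "c ?x"]
      show ?thesis unfolding powr_c by (simp only: diff_add_cancel)
    qed
    also have "?s * ?s = 1" using u by (rule ss)
    also have "signed_powr ?x (p - 1) * c ?x powr (- (p - 1) / p) = signed_powr (S u) (p - 1)"
    proof -
      have S_eq: "S u = X u * c (X u) powr (- 1 / p)" using u by (simp add: S_def X_def)
      have "signed_powr (c ?x powr (- 1 / p)) (p - 1) = c ?x powr (- (p - 1) / p)"
        using c[of ?x]
        by (simp add: signed_powr_def powr_powr exponent)
      then show ?thesis by (simp add: S_eq signed_powr_mult)
    qed
    finally have *: "((\<lambda>v. ?s * c (X v) powr (- (p - 1) / p)) has_real_derivative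
        - (p - 1) * signed_powr (S u) (p - 1)) (at u)" by simp
    show ?thesis
      by (rule DERIV_cong_ev[THEN iffD1, OF refl _ refl *])
        (use ev_cos[OF u] in \<open>auto simp: D_powr elim!: eventually_mono\<close>)
  qed
  have pyth: "\<bar>S u\<bar> powr p + \<bar>D u\<bar> powr p = 1" for u
  proof (cases "cos (\<omega> * u) = 0")
    case True
    then have "sin (\<omega> * u) \<noteq> 0" using sin_cos_squared_add[of "\<omega> * u"] by auto
    then show ?thesis using True p by (simp add: S_def D_def sgn_if)
  next
    case False
    have "\<bar>S u\<bar> powr p + \<bar>D u\<bar> powr p
        = (\<bar>X u\<bar> powr p + 1) * (c (X u) powr (- 1 / p)) powr p"
      using False c[of "X u"]
      by (simp add: S_def D_def X_def abs_mult powr_mult abs_sgn_eq algebra_simps)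
    also have "\<dots> = 1"
    proof -
      have "(c (X u) powr (- 1 / p)) powr p = 1 / c (X u)"
      proof -
        have "(c (X u) powr (- 1 / p)) powr p = c (X u) powr (- 1)"
          unfolding powr_powr using p by simp
        then show ?thesis using c[of "X u"] by (simp add: powr_minus_divide)
      qed
      moreover have "\<bar>X u\<bar> powr p + 1 = c (X u)" by (simp add: c_def)
      ultimately show ?thesis using c(1)[of "X u"] by simp
    qed
    finally show ?thesis .
  qed
  have D_cont: "isCont D u" for u
  proof -
    \<comment> \<open>\<open>e\<close> is the absolute value of \<open>D\<close> as a function of
      \<open>\<bar>tri u\<bar>\<close>. It tends to 0 at \<open>h\<close> because \<open>T\<close>
      blows up there.\<close>
    define e where "e v = (if v < h then c (T v) powr (- 1 / p) else 0)" for v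
    have e_cont: "continuous_on {0..h} e"
      unfolding continuous_on_eq_continuous_within
    proof
      fix v assume v: "v \<in> {0..h}"
      show "continuous (at v within {0..h}) e"
      proof (cases "v = h")
        case True
        have "((\<lambda>v. c (T v) powr (- 1 / p)) \<longlongrightarrow> 0) (at_left h)"
        proof -
          have "LIM t at_top. c t :> at_top"
          proof (rule filterlim_at_top_mono[OF filterlim_ident])
            show "\<forall>\<^sub>F t in at_top. t \<le> c t"
              using eventually_ge_at_top[of 1]
            proof eventually_elim
              case (elim t)
              then have "t powr 1 \<le> t powr p" using p by (intro powr_mono) auto
              then show ?case using elim by (simp add: c_def)
            qed
          qed
          from tendsto_neg_powr[OF _ this, of "- 1 / p"] p
          have "((\<lambda>t. c t powr (- 1 / p)) \<longlongrightarrow> 0) at_top" by simp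
          from filterlim_compose[OF this T_lim] show ?thesis .
        qed
        then have "(e \<longlongrightarrow> 0) (at_left h)"
          by (rule Lim_transform_eventually) (auto simp: e_def eventually_at_filter)
        then show ?thesis
          using True h at_within_Icc_at_left[of 0 h] by (simp add: continuous_within e_def)
      next
        case False
        then have vh: "\<bar>v\<bar> < h" using v by auto
        have "isCont (\<lambda>v. c (T v) powr (- 1 / p)) v"
          using DERIV_isCont[OF T[OF vh]] c[of "T v"] DERIV_isCont[OF DERIV_c]
          by (intro continuous_intros) (auto intro!: isCont_o2[of _ T c])
        moreover have "\<forall>\<^sub>F x in nhds v. c (T x) powr (- 1 / p) = e x"
          by (rule eventually_mono[OF eventually_nhds_in_open[of "{..<h}" v]])
            (use vh in \<open>auto simp: e_def\<close>)
        ultimately have "isCont e v" by (rule isCont_cong[THEN iffD1, rotated])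
        then show ?thesis by (rule continuous_at_imp_continuous_at_within)
      qed
    qed
    have "continuous_on UNIV (\<lambda>u. e \<bar>tri u\<bar>)"
      using tri_abs by (intro continuous_on_compose2[OF e_cont] continuous_intros tri_cont) auto
    moreover have abs_D: "\<bar>D u\<bar> = e \<bar>tri u\<bar>" for u
    proof (cases "cos (\<omega> * u) = 0")
      case False
      have "c (T \<bar>v\<bar>) = c (T v)" for v
        by (simp add: abs_if T_minus c_def)
      then show ?thesis
        using False tri_less[OF False] by (simp add: D_def e_def abs_mult abs_sgn_eq)
    qed (simp add: D_def e_def tri_eq)
    ultimately have abs_cont: "isCont (\<lambda>u. \<bar>D u\<bar>) u" for u
      by (simp add: continuous_on_eq_continuous_at)
    show ?thesis
    proof (cases "cos (\<omega> * u) = 0")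
      case True
      then have "D u = 0" by (simp add: D_def)
      then show ?thesis
        using abs_cont[of u] by (simp add: isCont_def tendsto_rabs_zero_iff)
    next
      case False
      have "isCont (\<lambda>v. sgn (cos (\<omega> * u)) * \<bar>D v\<bar>) u"
        by (intro continuous_intros abs_cont)
      moreover have "\<forall>\<^sub>F v in nhds u. sgn (cos (\<omega> * u)) * \<bar>D v\<bar> = D v"
        using ev_cos[OF False] by eventually_elim (auto simp: D_def abs_mult abs_sgn_eq)
      ultimately show ?thesis by (rule isCont_cong[THEN iffD1, rotated])
    qed
  qed
  have sgn_T: "sgn (T v) = sgn v" if "\<bar>v\<bar> < h" for v
  proof -
    consider "v > 0" | "v < 0" | "v = 0" by linarith
    then show ?thesis
    proof cases
      case 1 then show ?thesis using T_pos[of v] that by simp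
    next
      case 2 then show ?thesis using T_pos[of "- v"] T_minus[of v] that by simp
    qed (simp add: T0)
  qed
  have sgn_S: "sgn (S u) = sgn (sin (\<omega> * u))" for u
  proof (cases "cos (\<omega> * u) = 0")
    case False
    have "sgn (tri u) = sgn (sin (\<omega> * u))"
    proof -
      have "sgn (arcsin x) = sgn x" if "\<bar>x\<bar> \<le> 1" for x :: real
      proof -
        consider "x > 0" | "x < 0" | "x = 0" by linarith
        then show ?thesis
          using that arcsin_less_arcsin[of 0 x] arcsin_less_arcsin[of x 0] by cases auto
      qed
      then show ?thesis using P by (simp add: tri_def sgn_divide)
    qed
    then show ?thesis
      using False sgn_T[OF tri_less[OF False]] c[of "T (tri u)"] by (simp add: S_def sgn_mult)
  qed (simp add: S_def)
  have S_cont: "isCont S u" for u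
  proof (cases "cos (\<omega> * u) = 0")
    case True
    then have D0: "D u = 0" by (simp add: D_def)
    have sin0: "sin (\<omega> * u) \<noteq> 0"
      using True sin_cos_squared_add[of "\<omega> * u"] by auto
    \<comment> \<open>The formula for \<open>S\<close> through \<open>T\<close> degenerates at a
      zero of the cosine. There \<open>S\<close> is recovered from \<open>D\<close> by the
      Pythagorean identity, its sign being that of the sine.\<close>
    have "isCont (\<lambda>v. sgn (sin (\<omega> * u)) * (1 - \<bar>D v\<bar> powr p) powr (1 / p)) u"
      using D0 p D_cont by (intro continuous_intros) auto
    moreover have "\<forall>\<^sub>F v in nhds u. sgn (sin (\<omega> * u)) * (1 - \<bar>D v\<bar> powr p) powr (1 / p) = S v"
    proof -
      have "open {v. sin (\<omega> * v) * sin (\<omega> * u) > 0}"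
        by (intro open_Collect_less continuous_intros)
      moreover have "u \<in> {v. sin (\<omega> * v) * sin (\<omega> * u) > 0}"
        using sin0 by (simp add: zero_less_mult_iff) linarith
      ultimately have "\<forall>\<^sub>F v in nhds u. v \<in> {v. sin (\<omega> * v) * sin (\<omega> * u) > 0}"
        by (rule eventually_nhds_in_open)
      then show ?thesis
      proof eventually_elim
        case (elim v)
        then have "sgn (S v) = sgn (sin (\<omega> * u))"
          by (auto simp: sgn_S zero_less_mult_iff)
        moreover have "(1 - \<bar>D v\<bar> powr p) powr (1 / p) = \<bar>S v\<bar>"
        proof -
          have "1 - \<bar>D v\<bar> powr p = \<bar>S v\<bar> powr p" using pyth[of v] by simp
          then show ?thesis using p by (simp add: powr_powr)
        qed
        ultimately show ?case by (metis sgn_mult_abs)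
      qed
    qed
    ultimately show ?thesis by (rule isCont_cong[THEN iffD1, rotated])
  qed (use DERIV_S_off DERIV_isCont in blast)
  have ev_off: "\<forall>\<^sub>F v in at u. cos (\<omega> * v) \<noteq> 0" if u: "cos (\<omega> * u) = 0" for u
  proof -
    \<comment> \<open>Zeros of the cosine are isolated: at such a \<open>u\<close> the addition
      formula leaves one product of sines, with no further zero within distance
      \<open>P\<close>.\<close>
    have "cos (\<omega> * v) \<noteq> 0" if v: "v \<noteq> u" "dist v u < P" for v
    proof -
      have "cos (\<omega> * v) = cos (\<omega> * u + \<omega> * (v - u))" by (simp add: algebra_simps)
      also have "\<dots> = - sin (\<omega> * u) * sin (\<omega> * (v - u))"
        by (simp add: cos_add u)
      finally have eq: "cos (\<omega> * v) = - sin (\<omega> * u) * sin (\<omega> * (v - u))" .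
      have "\<omega> * \<bar>v - u\<bar> < \<omega> * P"
        using v P by (simp add: dist_real_def)
      then have "sin (\<omega> * \<bar>v - u\<bar>) > 0"
        using v P unfolding wP by (intro sin_gt_zero) auto
      then have "sin (\<omega> * (v - u)) \<noteq> 0"
        by (cases "v \<ge> u") (auto simp: abs_if algebra_simps sin_diff split: if_splits)
      moreover have "sin (\<omega> * u) \<noteq> 0"
        using u sin_cos_squared_add[of "\<omega> * u"] by auto
      ultimately show ?thesis by (simp add: eq)
    qed
    then show ?thesis unfolding eventually_at using P by blast
  qed
  have C_cont: "isCont (\<lambda>u. signed_powr (D u) (p - 1)) u" for u
    using isCont_o2[OF D_cont isCont_signed_powr] p by simp
  have "p_trig p P S D"
  proof
    show "(S has_real_derivative D u) (at u)" for u
    proof (cases "cos (\<omega> * u) = 0")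
      case True
      show ?thesis
        by (rule DERIV_by_continuity[OF S_cont D_cont])
          (use ev_off[OF True] in \<open>auto elim!: eventually_mono intro: DERIV_S_off\<close>)
    qed (rule DERIV_S_off)
    show "((\<lambda>u. signed_powr (D u) (p - 1)) has_real_derivative
        - (p - 1) * signed_powr (S u) (p - 1)) (at u)" for u
    proof (cases "cos (\<omega> * u) = 0")
      case True
      have "isCont (\<lambda>u. - (p - 1) * signed_powr (S u) (p - 1)) u"
        using isCont_o2[OF S_cont isCont_signed_powr] p by (intro continuous_intros) simp
      then show ?thesis
        by (rule DERIV_by_continuity[OF C_cont])
          (rule eventually_mono[OF ev_off[OF True] DERIV_C_off])
    qed (rule DERIV_C_off)
    have shift: "\<omega> * (u + P) = \<omega> * u + pi" for u
      by (simp add: distrib_left wP)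
    have tri_shift: "tri (u + P) = - tri u" for u
      by (simp add: tri_def shift arcsin_minus)
    have tri_minus: "tri (- u) = - tri u" for u
      by (simp add: tri_def arcsin_minus)
    show "S (u + P) = - S u" "D (u + P) = - D u" for u
      by (simp_all add: S_def D_def shift tri_shift T_minus c_def sgn_minus)
    show "S (- u) = - S u" "D (- u) = D u" for u
      by (simp_all add: S_def D_def tri_minus T_minus c_def sgn_minus)
    show "S u > 0" if "0 < u" "u < P" for u
    proof -
      have "\<omega> * u < \<omega> * P" using that P by simp
      then have "sin (\<omega> * u) > 0" using that P unfolding wP by (intro sin_gt_zero) auto
      then show ?thesis using sgn_S[of u] by (simp add: sgn_if split: if_splits)
    qed
    show "D u > 0" if "\<bar>u\<bar> < P / 2" for u
    proof -
      have "\<omega> * \<bar>u\<bar> < \<omega> * (P / 2)" using that P by simp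
      then have "\<bar>\<omega> * u\<bar> < pi / 2" using P wP by (simp add: abs_mult)
      then have "cos (\<omega> * u) > 0" by (intro cos_gt_zero_pi) (auto simp: abs_less_iff)
      then show ?thesis using c[of "T (tri u)"] by (simp add: D_def)
    qed
  qed (use p P pyth in auto)
  then show ?thesis by blast
qed

section \<open>Polar angles of planar curves\<close>

text \<open>The angular speed of a curve \<open>(Y, V)\<close>, where only \<open>signed_powr V (p - 1)\<close> needs to be
  differentiable: that is what is known of \<open>y'\<close> for a solution \<open>y\<close>.\<close>

lemma chart_derivatives:
  fixes p :: real
  assumes p: "p > 1"
    and Y: "(Y has_real_derivative Y') (at x within X)"
    and W: "((\<lambda>t. signed_powr (V t) (p - 1)) has_real_derivative W') (at x within X)"
  defines "s \<equiv> (Y' * signed_powr (V x) (p - 1) - Y x * W' / (p - 1)) / (\<bar>Y x\<bar> powr p + \<bar>V x\<bar> powr p)"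
  shows "V x \<noteq> 0 \<Longrightarrow> (\<And>t. (A has_real_derivative 1 / (1 + \<bar>t\<bar> powr p)) (at t)) \<Longrightarrow>
      ((\<lambda>t. A (Y t / V t)) has_real_derivative s) (at x within X)"
    and "Y x \<noteq> 0 \<Longrightarrow> (\<And>t. (B has_real_derivative 1 / (1 + \<bar>t\<bar> powr (p / (p - 1)))) (at t)) \<Longrightarrow>
      ((\<lambda>t. B (signed_powr (V t / Y t) (p - 1))) has_real_derivative - (p - 1) * s) (at x within X)"
proof -
  have recip: "1 / (1 + u / v) = v / (u + v)" if "u \<ge> 0" "v > 0" for u v :: real
    using that by (simp add: add_divide_eq_iff add.commute)
  assume V0: "V x \<noteq> 0" and A: "\<And>t. (A has_real_derivative 1 / (1 + \<bar>t\<bar> powr p)) (at t)"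
  \<comment> \<open>\<open>V\<close> is recovered from its signed power by the exponent
    \<open>1 / (p - 1)\<close>, a differentiable operation because
    \<open>V x \<noteq> 0\<close>.\<close>
  define V' where "V' = 1 / (p - 1) * \<bar>V x\<bar> powr (2 - p) * W'"
  have "((\<lambda>t. signed_powr (signed_powr (V t) (p - 1)) (1 / (p - 1))) has_real_derivative
      1 / (p - 1) * \<bar>signed_powr (V x) (p - 1)\<bar> powr (1 / (p - 1) - 1) * W') (at x within X)"
    by (rule DERIV_chain2[OF DERIV_signed_powr W]) (use V0 in simp)
  moreover have "\<bar>signed_powr (V x) (p - 1)\<bar> powr (1 / (p - 1) - 1) = \<bar>V x\<bar> powr (2 - p)"
  proof -
    have "(p - 1) * (1 / (p - 1) - 1) = 2 - p" using p by (simp add: field_simps)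
    then show ?thesis by (simp add: abs_signed_powr powr_powr)
  qed
  ultimately have V: "(V has_real_derivative V') (at x within X)"
    using p by (simp add: signed_powr_inverse V'_def)
  have "((\<lambda>t. A (Y t / V t)) has_real_derivative
      1 / (1 + \<bar>Y x / V x\<bar> powr p) * ((Y' * V x - Y x * V') / (V x * V x))) (at x within X)"
    by (rule DERIV_chain2[OF A DERIV_divide[OF Y V V0]])
  also have "1 / (1 + \<bar>Y x / V x\<bar> powr p) * ((Y' * V x - Y x * V') / (V x * V x)) = s"
  proof -
    define a where "a = \<bar>V x\<bar>"
    have a: "a > 0" using V0 by (simp add: a_def)
    have VV: "V x * V x = a powr 2" using a by (simp add: a_def powr_numeral power2_eq_square)
    have ap: "a powr p = a powr (p - 2) * a powr 2"
      unfolding powr_add[symmetric] by simp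
    have "\<bar>Y x / V x\<bar> powr p = \<bar>Y x\<bar> powr p / a powr p"
      by (simp add: a_def abs_divide powr_divide)
    then have "1 / (1 + \<bar>Y x / V x\<bar> powr p) = a powr p / (\<bar>Y x\<bar> powr p + a powr p)"
      using a recip[of "\<bar>Y x\<bar> powr p" "a powr p"] by simp
    moreover have "a powr (p - 2) * V x = signed_powr (V x) (p - 1)"
    proof -
      have "a powr (p - 2) * (sgn (V x) * a) = sgn (V x) * (a powr (p - 2) * a powr 1)"
        using a by simp
      also have "\<dots> = signed_powr (V x) (p - 1)"
        unfolding powr_add[symmetric] by (simp add: signed_powr_def a_def)
      finally show ?thesis by (simp add: a_def sgn_mult_abs)
    qed
    moreover have "a powr (p - 2) * V' = W' / (p - 1)"
      using a by (simp add: V'_def a_def[symmetric] flip: powr_add)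
    moreover have frac: "q * b / N * ((y * v - w * v') / b) = (y * (q * v) - w * (q * v')) / N"
      if "b \<noteq> 0" for q b N y v w v' :: real
    proof -
      have "q * b / N * ((y * v - w * v') / b) = q * (y * v - w * v') / N" using that by simp
      then show ?thesis by (simp add: algebra_simps)
    qed
    ultimately have "1 / (1 + \<bar>Y x / V x\<bar> powr p) * ((Y' * V x - Y x * V') / (V x * V x))
      = (Y' * (a powr (p - 2) * V x) - Y x * (a powr (p - 2) * V')) / (\<bar>Y x\<bar> powr p + a powr p)"
      using frac[of "a powr 2" "a powr (p - 2)" "\<bar>Y x\<bar> powr p + a powr p" Y' "V x" "Y x" V'] a
      unfolding VV ap[symmetric] by simp
    then show ?thesis
      using \<open>a powr (p - 2) * V x = _\<close> \<open>a powr (p - 2) * V' = _\<close> by (simp add: s_def a_def)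
  qed
  finally show "((\<lambda>t. A (Y t / V t)) has_real_derivative s) (at x within X)" .
next
  have recip: "1 / (1 + u / v) = v / (u + v)" if "u \<ge> 0" "v > 0" for u v :: real
    using that by (simp add: add_divide_eq_iff add.commute)
  assume Y0: "Y x \<noteq> 0"
    and B: "\<And>t. (B has_real_derivative 1 / (1 + \<bar>t\<bar> powr (p / (p - 1)))) (at t)"
  define W where "W t = signed_powr (V t) (p - 1)" for t
  define Z where "Z t = signed_powr (Y t) (p - 1)" for t
  have Z0: "Z x \<noteq> 0" using Y0 by (simp add: Z_def)
  have WZ: "signed_powr (V t / Y t) (p - 1) = W t / Z t" for t
  proof (cases "Y t = 0")
    case False
    then have "W t = signed_powr (V t / Y t) (p - 1) * Z t"
      unfolding W_def Z_def by (simp flip: signed_powr_mult)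
    then show ?thesis using False by (simp add: Z_def)
  qed (simp add: Z_def)
  define a where "a = \<bar>Y x\<bar>"
  have a: "a > 0" using Y0 by (simp add: a_def)
  have Z: "(Z has_real_derivative (p - 1) * a powr (p - 2) * Y') (at x within X)"
    unfolding Z_def a_def using DERIV_chain2[OF DERIV_signed_powr[OF Y0] Y, of "p - 1"] by simp
  have W'': "(W has_real_derivative W') (at x within X)"
    unfolding W_def by (rule W)
  have "((\<lambda>t. B (W t / Z t)) has_real_derivative
      1 / (1 + \<bar>W x / Z x\<bar> powr (p / (p - 1))) *
      ((W' * Z x - W x * ((p - 1) * a powr (p - 2) * Y')) / (Z x * Z x))) (at x within X)"
    by (rule DERIV_chain2[OF B DERIV_divide[OF W'' Z Z0]])
  also have "1 / (1 + \<bar>W x / Z x\<bar> powr (p / (p - 1))) *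
      ((W' * Z x - W x * ((p - 1) * a powr (p - 2) * Y')) / (Z x * Z x)) = - (p - 1) * s"
  proof -
    \<comment> \<open>The conjugate exponent in \<open>B\<close> undoes the signed power, so both
      charts lead to the same denominator.\<close>
    have "\<bar>W x / Z x\<bar> powr (p / (p - 1)) = \<bar>V x\<bar> powr p / a powr p"
      using p by (simp add: WZ[symmetric] abs_signed_powr powr_powr a_def abs_divide powr_divide)
    then have 1: "1 / (1 + \<bar>W x / Z x\<bar> powr (p / (p - 1))) = a powr p / (a powr p + \<bar>V x\<bar> powr p)"
      using a recip[of "\<bar>V x\<bar> powr p" "a powr p"] by (simp add: add.commute)
    have ZZ: "Z x * Z x = a powr (2 * p - 2)"
    proof -
      have "Z x * Z x = \<bar>Z x\<bar> * \<bar>Z x\<bar>" by simp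
      then show ?thesis
        unfolding Z_def abs_signed_powr by (simp add: a_def algebra_simps flip: powr_add)
    qed
    have "a powr p * Z x = Y x * (Z x * Z x)"
    proof -
      have "Z x * Y x = a powr p" by (simp add: Z_def signed_powr_mult_self a_def)
      then show ?thesis by (simp add: mult_ac)
    qed
    then have 2: "a powr p * Z x / (Z x * Z x) = Y x" using Z0 by simp
    have "a powr p * a powr (p - 2) = Z x * Z x"
      unfolding ZZ using a by (simp flip: powr_add)
    then have 3: "a powr p * a powr (p - 2) / (Z x * Z x) = 1" using Z0 by simp
    have "1 / (1 + \<bar>W x / Z x\<bar> powr (p / (p - 1))) *
        ((W' * Z x - W x * ((p - 1) * a powr (p - 2) * Y')) / (Z x * Z x))
      = (W' * (a powr p * Z x / (Z x * Z x))
          - W x * (p - 1) * Y' * (a powr p * a powr (p - 2) / (Z x * Z x)))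
        / (a powr p + \<bar>V x\<bar> powr p)"
    proof -
      have "m / N * ((w * z - u * (r * a * y)) / k) = (w * (m * z / k) - u * r * y * (m * a / k)) / N"
        for m N w z u r a y k :: real
        by (cases "N = 0"; cases "k = 0") (simp_all add: field_simps)
      then show ?thesis unfolding 1 by blast
    qed
    also have "\<dots> = - (p - 1) * s"
    proof -
      have "w * y - v * r * z * 1 = - r * (z * v - y * w / r)" if "r \<noteq> 0" for w y v r z :: real
        using that by (simp add: field_simps)
      from this[of "p - 1" W' "Y x" "W x" Y'] have "W' * Y x - W x * (p - 1) * Y' * 1
          = - (p - 1) * (Y' * signed_powr (V x) (p - 1) - Y x * W' / (p - 1))"
        using p by (simp only: W_def)
      then show ?thesis unfolding 2 3 unfolding s_def a_def by simp
    qed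
    finally show ?thesis .
  qed
  finally show "((\<lambda>t. B (signed_powr (V t / Y t) (p - 1))) has_real_derivative - (p - 1) * s) (at x within X)"
    unfolding WZ .
qed

lemma continuous_on_via_signed_powr:
  assumes "r > 0" "continuous_on X (\<lambda>t. signed_powr (V t) r)"
  shows "continuous_on X V"
  using continuous_on_signed_powr[OF assms(2), of "1 / r"] assms(1)
  by (simp add: signed_powr_inverse)

text \<open>The polar angle is \<open>A (Y / V)\<close> where \<open>V \<noteq> 0\<close> and, up to a constant and a factor,
  \<open>B (signed_powr (V / Y) (p - 1))\<close> where \<open>Y \<noteq> 0\<close>. In either chart the difference of the two
  angles is locally constant, so connectedness replaces a uniqueness theorem for the equation,
  which is not Lipschitz.\<close>

lemma parallel_if_equal_speed:
  fixes p :: real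
  assumes p: "p > 1"
    and Y1: "\<And>x. x \<in> {0..1} \<Longrightarrow> (Y1 has_real_derivative Y1' x) (at x within {0..1})"
    and W1: "\<And>x. x \<in> {0..1} \<Longrightarrow>
      ((\<lambda>t. signed_powr (V1 t) (p - 1)) has_real_derivative W1' x) (at x within {0..1})"
    and Y2: "\<And>x. x \<in> {0..1} \<Longrightarrow> (Y2 has_real_derivative Y2' x) (at x within {0..1})"
    and W2: "\<And>x. x \<in> {0..1} \<Longrightarrow>
      ((\<lambda>t. signed_powr (V2 t) (p - 1)) has_real_derivative W2' x) (at x within {0..1})"
    and nz1: "\<And>x. x \<in> {0..1} \<Longrightarrow> Y1 x \<noteq> 0 \<or> V1 x \<noteq> 0"
    and nz2: "\<And>x. x \<in> {0..1} \<Longrightarrow> Y2 x \<noteq> 0 \<or> V2 x \<noteq> 0"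
    and speed: "\<And>x. x \<in> {0..1} \<Longrightarrow>
      (Y1' x * signed_powr (V1 x) (p - 1) - Y1 x * W1' x / (p - 1)) / (\<bar>Y1 x\<bar> powr p + \<bar>V1 x\<bar> powr p) =
      (Y2' x * signed_powr (V2 x) (p - 1) - Y2 x * W2' x / (p - 1)) / (\<bar>Y2 x\<bar> powr p + \<bar>V2 x\<bar> powr p)"
    and init: "Y1 0 * V2 0 = Y2 0 * V1 0"
    and x: "x \<in> {0..1::real}"
  shows "Y1 x * V2 x = Y2 x * V1 x"
proof -
  obtain A where A: "strict_mono A" "\<And>t. (A has_real_derivative 1 / (1 + \<bar>t\<bar> powr p)) (at t)"
    using arctan_p_antiderivative[of p] p by auto
  have "p / (p - 1) > 0" using p by simp
  then obtain B where B: "strict_mono B"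
      "\<And>t. (B has_real_derivative 1 / (1 + \<bar>t\<bar> powr (p / (p - 1)))) (at t)"
    using arctan_p_antiderivative[of "p / (p - 1)"] by auto
  have Ainj: "A u = A v \<longleftrightarrow> u = v" and Binj: "B u = B v \<longleftrightarrow> u = v" for u v
    using A(1) B(1) by (simp_all add: strict_mono_eq)
  have cY: "continuous_on {0..1} Y1" "continuous_on {0..1} Y2"
    by (rule DERIV_continuous_on[OF Y1], simp) (rule DERIV_continuous_on[OF Y2], simp)
  have cV: "continuous_on {0..1} V1" "continuous_on {0..1} V2"
    by (rule continuous_on_via_signed_powr[OF _ DERIV_continuous_on[OF W1]], use p in simp_all)
      (rule continuous_on_via_signed_powr[OF _ DERIV_continuous_on[OF W2]], use p in simp_all)
  define par where "par t \<longleftrightarrow> Y1 t * V2 t = Y2 t * V1 t" for t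
  have locally_nonzero: "\<exists>d>0. \<forall>t\<in>{0..1}. dist a t < d \<longrightarrow> f t \<noteq> 0"
    if "continuous_on {0..1} f" "a \<in> {0..1}" "f a \<noteq> 0" for f :: "real \<Rightarrow> real" and a
    using continuous_on_avoid[OF that] by blast
  have "par x"
  proof (rule connected_induction_simple[of "{0..1::real}" 0 x par])
    show "connected {0..1::real}" "0 \<in> {0..1::real}" "x \<in> {0..1}" "par 0"
      using x init by (auto simp: par_def)
    fix a :: real assume a: "a \<in> {0..1}"
    have *: "\<exists>T. openin (top_of_set {0..1}) T \<and> a \<in> T \<and> (\<forall>x\<in>T. \<forall>y\<in>T. par x \<longrightarrow> par y)"
      if d: "d > 0" and pr: "\<And>u v. u \<in> {0..1} \<inter> ball a d \<Longrightarrow> v \<in> {0..1} \<inter> ball a d \<Longrightarrow>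
        par u \<Longrightarrow> par v" for d
    proof (intro exI[of _ "{0..1} \<inter> ball a d"] conjI ballI impI)
      show "openin (top_of_set {0..1}) ({0..1} \<inter> ball a d)"
        by (rule openin_open_Int) simp
      show "a \<in> {0..1} \<inter> ball a d" using a d by simp
    qed (rule pr)
    have conv: "convex ({0..1} \<inter> ball a d)" for d
      by (intro convex_Int convex_ball) auto
    consider (V) "V1 a * V2 a \<noteq> 0" | (Y) "Y1 a * Y2 a \<noteq> 0"
      | (no) "V1 a * V2 a = 0" "Y1 a * Y2 a = 0" by blast
    then show "\<exists>T. openin (top_of_set {0..1}) T \<and> a \<in> T \<and> (\<forall>x\<in>T. \<forall>y\<in>T. par x \<longrightarrow> par y)"
    proof cases
      case V
      have "continuous_on {0..1} (\<lambda>t. V1 t * V2 t)" by (intro continuous_intros cV)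
      from locally_nonzero[OF this a] V obtain d
        where d: "d > 0" "\<forall>t\<in>{0..1}. dist a t < d \<longrightarrow> V1 t * V2 t \<noteq> 0" by auto
      let ?T = "{0..1} \<inter> ball a d"
      have nz: "V1 t \<noteq> 0" "V2 t \<noteq> 0" if "t \<in> ?T" for t
      proof -
        have "V1 t * V2 t \<noteq> 0" using d(2) that by simp
        then show "V1 t \<noteq> 0" "V2 t \<noteq> 0" by auto
      qed
      have "\<exists>c. \<forall>t\<in>?T. A (Y1 t / V1 t) - A (Y2 t / V2 t) = c"
      proof (rule has_field_derivative_zero_constant[OF conv])
        fix t assume t: "t \<in> ?T"
        have "((\<lambda>t. A (Y1 t / V1 t) - A (Y2 t / V2 t)) has_real_derivative 0) (at t within {0..1})"
          using DERIV_diff[OF chart_derivatives(1)[OF p Y1 W1 nz(1)[OF t] A(2)]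
              chart_derivatives(1)[OF p Y2 W2 nz(2)[OF t] A(2)]] t speed[of t] by simp
        then show "((\<lambda>t. A (Y1 t / V1 t) - A (Y2 t / V2 t)) has_real_derivative 0) (at t within ?T)"
          by (rule DERIV_subset) auto
      qed
      moreover have "par t \<longleftrightarrow> A (Y1 t / V1 t) - A (Y2 t / V2 t) = 0" if "t \<in> ?T" for t
        using nz[OF that] by (simp add: Ainj par_def frac_eq_eq)
      ultimately show ?thesis by (intro *[OF d(1)]) metis
    next
      case Y
      have "continuous_on {0..1} (\<lambda>t. Y1 t * Y2 t)" by (intro continuous_intros cY)
      from locally_nonzero[OF this a] Y obtain d
        where d: "d > 0" "\<forall>t\<in>{0..1}. dist a t < d \<longrightarrow> Y1 t * Y2 t \<noteq> 0" by auto
      let ?T = "{0..1} \<inter> ball a d"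
      let ?b = "\<lambda>t. B (signed_powr (V1 t / Y1 t) (p - 1)) - B (signed_powr (V2 t / Y2 t) (p - 1))"
      have nz: "Y1 t \<noteq> 0" "Y2 t \<noteq> 0" if "t \<in> ?T" for t
      proof -
        have "Y1 t * Y2 t \<noteq> 0" using d(2) that by simp
        then show "Y1 t \<noteq> 0" "Y2 t \<noteq> 0" by auto
      qed
      have "\<exists>c. \<forall>t\<in>?T. ?b t = c"
      proof (rule has_field_derivative_zero_constant[OF conv])
        fix t assume t: "t \<in> ?T"
        have "(?b has_real_derivative 0) (at t within {0..1})"
          using DERIV_diff[OF chart_derivatives(2)[OF p Y1 W1 nz(1)[OF t] B(2)]
              chart_derivatives(2)[OF p Y2 W2 nz(2)[OF t] B(2)]] t speed[of t] by simp
        then show "(?b has_real_derivative 0) (at t within ?T)"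
          by (rule DERIV_subset) auto
      qed
      moreover have "par t \<longleftrightarrow> ?b t = 0" if "t \<in> ?T" for t
      proof -
        have "V1 t / Y1 t = V2 t / Y2 t \<longleftrightarrow> V1 t * Y2 t = V2 t * Y1 t"
          using nz[OF that] by (simp add: frac_eq_eq)
        moreover have "?b t = 0 \<longleftrightarrow> V1 t / Y1 t = V2 t / Y2 t"
          using p by (simp add: Binj signed_powr_inject)
        ultimately show ?thesis unfolding par_def by (metis mult.commute)
      qed
      ultimately show ?thesis by (intro *[OF d(1)]) metis
    next
      \<comment> \<open>One curve lies on each axis here, so the directions differ, and by
        continuity no nearby point is parallel.\<close>
      case no
      have "continuous_on {0..1} (\<lambda>t. Y1 t * V2 t - Y2 t * V1 t)"
        by (intro continuous_intros cV cY)
      moreover have "Y1 a * V2 a - Y2 a * V1 a \<noteq> 0"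
        using no nz1[OF a] nz2[OF a] by auto
      ultimately obtain d
        where d: "d > 0" "\<forall>t\<in>{0..1}. dist a t < d \<longrightarrow> Y1 t * V2 t - Y2 t * V1 t \<noteq> 0"
        using locally_nonzero a by blast
      have "\<not> par t" if "t \<in> {0..1} \<inter> ball a d" for t
        using d(2) that by (simp add: par_def)
      then show ?thesis by (intro *[OF d(1)]) blast
    qed
  qed
  then show ?thesis by (simp add: par_def)
qed

text \<open>The energy \<open>\<bar>y\<bar> powr p + \<bar>dy\<bar> powr p\<close> is differentiable
  once its second term is written through the signed power of \<open>dy\<close> and the conjugate
  exponent. Its derivative is bounded by a multiple of itself, so a common zero of \<open>y\<close>
  and \<open>dy\<close> would spread to \<open>x1\<close>.\<close>

lemma nontrivial_solution_nowhere_zero: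
  fixes p :: real
  assumes p: "p > 1" and c: "continuous_on {0..1} c"
    and y: "\<And>x. x \<in> {0..1} \<Longrightarrow> (y has_real_derivative dy x) (at x within {0..1})"
    and w: "\<And>x. x \<in> {0..1} \<Longrightarrow>
      ((\<lambda>t. signed_powr (dy t) (p - 1)) has_real_derivative
        - (p - 1) * c x * signed_powr (y x) (p - 1)) (at x within {0..1})"
    and nt: "x1 \<in> {0..1}" "y x1 \<noteq> 0"
    and x0: "x0 \<in> {0..1::real}"
  shows "y x0 \<noteq> 0 \<or> dy x0 \<noteq> 0"
proof (rule ccontr)
  assume "\<not> ?thesis"
  then have zero: "y x0 = 0" "dy x0 = 0" by auto
  define p' where "p' = p / (p - 1)"
  have p': "p' > 1" using p by (simp add: p'_def field_simps)
  define W where "W t = signed_powr (dy t) (p - 1)" for t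
  define E where "E t = \<bar>y t\<bar> powr p + \<bar>W t\<bar> powr p'" for t
  have W_powr: "\<bar>W t\<bar> powr p' = \<bar>dy t\<bar> powr p" for t
    using p by (simp add: W_def abs_signed_powr powr_powr p'_def)
  define E' where "E' t = p * signed_powr (y t) (p - 1) * dy t * (1 - c t)" for t
  have DERIV_E: "(E has_real_derivative E' t) (at t within {0..1})" if t: "t \<in> {0..1}" for t
  proof -
    have "(E has_real_derivative p * signed_powr (y t) (p - 1) * dy t +
       p' * signed_powr (W t) (p' - 1) * (- (p - 1) * c t * signed_powr (y t) (p - 1)))
       (at t within {0..1})"
      unfolding E_def W_def
      by (intro DERIV_add DERIV_chain2[OF DERIV_abs_powr[OF p] y[OF t]]
        DERIV_chain2[OF DERIV_abs_powr[OF p'] w[OF t]])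
    moreover have "signed_powr (W t) (p' - 1) = dy t"
    proof -
      have "(p - 1) * (p' - 1) = 1" using p by (simp add: p'_def field_simps)
      then show ?thesis by (simp add: W_def signed_powr_signed_powr)
    qed
    moreover have "p * v * d + p' * d * (- (p - 1) * k * v) = p * v * d * (1 - k)" for v d k
    proof -
      have "p * v * d + p' * d * (- (p - 1) * k * v) = p * v * d - p' * (p - 1) * (k * v * d)"
        by (simp add: algebra_simps)
      also have "p' * (p - 1) = p" using p by (simp add: p'_def)
      finally show ?thesis by (simp add: algebra_simps)
    qed
    ultimately show ?thesis by (simp only: E'_def)
  qed
  have "compact ((\<lambda>t. \<bar>1 - c t\<bar>) ` {0..1})"
    by (intro compact_continuous_image continuous_intros c) auto
  then obtain M where M: "\<And>t. t \<in> {0..1} \<Longrightarrow> \<bar>1 - c t\<bar> \<le> M"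
    using bounded_iff compact_imp_bounded by (metis (no_types, lifting) abs_idempotent image_eqI real_norm_def)
  define L where "L = p * M"
  have bound: "\<bar>E' t\<bar> \<le> L * E t" if t: "t \<in> {0..1}" for t
  proof -
    define m where "m = max \<bar>y t\<bar> \<bar>dy t\<bar>"
    have "\<bar>y t\<bar> powr (p - 1) * \<bar>dy t\<bar> \<le> m powr (p - 1) * m"
      using p unfolding m_def by (intro mult_mono powr_mono2) auto
    also have "\<dots> = m powr p"
      using p by (cases "m = 0") (auto simp: m_def powr_diff)
    also have "\<dots> \<le> E t"
      unfolding E_def W_powr by (auto simp: m_def max_def)
    finally have "\<bar>y t\<bar> powr (p - 1) * \<bar>dy t\<bar> * \<bar>1 - c t\<bar> \<le> E t * M"
      using M[OF t] by (intro mult_mono) (auto simp: E_def)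
    then show ?thesis
      using p by (simp add: E'_def L_def abs_mult abs_signed_powr mult_ac)
  qed
  have cont: "continuous_on {a..b} (\<lambda>t. E t * exp (s * t))" if "{a..b} \<subseteq> {0..1}" for a b s
    using DERIV_continuous_on[OF DERIV_E] that
    by (intro continuous_intros) (auto intro: continuous_on_subset)
  have D: "((\<lambda>t. E t * exp (s * t)) has_real_derivative (E' t + s * E t) * exp (s * t)) (at t)"
    if "0 < t" "t < 1" for t s
  proof -
    have "at t within {0..1} = at t"
      by (rule at_within_interior) (use that in auto)
    then have "(E has_real_derivative E' t) (at t)" using DERIV_E[of t] that by simp
    then show ?thesis by (auto intro!: derivative_eq_intros simp: algebra_simps)
  qed
  have "E x0 = 0" using zero p' by (simp add: E_def W_def)
  \<comment> \<open>The growth bound is two-sided: vanishing at \<open>x0\<close> propagates forward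
    with the weight \<open>exp (- L * t)\<close> and backward with
    \<open>exp (L * t)\<close>.\<close>
  have "E x1 \<le> 0"
  proof (cases "x0 \<le> x1")
    case True
    have "E x1 * exp (- L * x1) \<le> E x0 * exp (- L * x0)"
    proof (rule DERIV_nonpos_imp_decreasing_open[OF True])
      fix t assume t: "x0 < t" "t < x1"
      have "E' t + - L * E t \<le> 0" using bound[of t] t x0 nt by auto
      then show "\<exists>D. ((\<lambda>t. E t * exp (- L * t)) has_real_derivative D) (at t) \<and> D \<le> 0"
        using D[of t "- L"] t x0 nt
        by (intro exI[of _ "(E' t + - L * E t) * exp (- L * t)"] conjI mult_nonpos_nonneg) auto
    qed (rule cont, use x0 nt in auto)
    then show ?thesis using \<open>E x0 = 0\<close> by (simp add: mult_le_0_iff)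
  next
    case False
    then have "x1 \<le> x0" by simp
    have "E x1 * exp (L * x1) \<le> E x0 * exp (L * x0)"
    proof (rule DERIV_nonneg_imp_increasing_open[OF \<open>x1 \<le> x0\<close>])
      fix t assume t: "x1 < t" "t < x0"
      have "0 \<le> E' t + L * E t" using bound[of t] t x0 nt by auto
      then show "\<exists>D. ((\<lambda>t. E t * exp (L * t)) has_real_derivative D) (at t) \<and> D \<ge> 0"
        using D[of t L] t x0 nt
        by (intro exI[of _ "(E' t + L * E t) * exp (L * t)"] conjI mult_nonneg_nonneg) auto
    qed (rule cont, use x0 nt in auto)
    then show ?thesis using \<open>E x0 = 0\<close> by (simp add: mult_le_0_iff)
  qed
  moreover have "0 < \<bar>y x1\<bar> powr p" "0 \<le> \<bar>W x1\<bar> powr p'" using nt by auto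
  ultimately show False by (simp add: E_def)
qed

section \<open>Phases and eigenfunctions\<close>

context p_trig
begin

text \<open>The phase equations depend on the angle through this function only. It is even,
  \<open>P\<close>-periodic and has a bounded derivative, whence all Lipschitz estimates.\<close>

definition K :: "real \<Rightarrow> real" where "K u = \<bar>S u\<bar> powr p"

definition K' :: "real \<Rightarrow> real" where "K' u = p * signed_powr (S u) (p - 1) * D u"

lemma DERIV_K: "(K has_real_derivative K' u) (at u)"
  unfolding K_def[abs_def] K'_def
  using DERIV_chain2[OF DERIV_abs_powr[OF p_gt_1] DERIV_S] by simp

section \<open>Bounds, symmetries and zeros of \<open>K\<close>\<close>

lemma D_powr_eq: "\<bar>D u\<bar> powr p = 1 - K u"
  using pyth[of u] by (simp add: K_def)

lemma K_nonneg: "0 \<le> K u" and K_le_1: "K u \<le> 1"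
proof -
  show "0 \<le> K u" by (simp add: K_def)
  have "0 \<le> \<bar>D u\<bar> powr p" by simp
  then show "K u \<le> 1" unfolding D_powr_eq by simp
qed

lemma abs_D_le_1: "\<bar>D u\<bar> \<le> 1" and abs_S_le_1: "\<bar>S u\<bar> \<le> 1"
proof -
  have *: "x \<le> 1" if "x powr p \<le> 1" "0 \<le> x" for x :: real
  proof (rule ccontr)
    assume "\<not> x \<le> 1"
    then have "1 powr p < x powr p" using p_gt_1 by (intro powr_less_mono2) auto
    then show False using that by simp
  qed
  have "\<bar>D u\<bar> powr p \<le> 1" using D_powr_eq[of u] K_nonneg[of u] by simp
  then show "\<bar>D u\<bar> \<le> 1" using *[of "\<bar>D u\<bar>"] by simp
  have "\<bar>S u\<bar> powr p \<le> 1" using K_le_1[of u] by (simp add: K_def)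
  then show "\<bar>S u\<bar> \<le> 1" using *[of "\<bar>S u\<bar>"] by simp
qed

lemma K'_bound: "\<bar>K' u\<bar> \<le> p"
proof -
  have "\<bar>S u\<bar> powr (p - 1) \<le> 1"
    using abs_S_le_1[of u] p_gt_1 by (simp add: powr_le1)
  then have "\<bar>S u\<bar> powr (p - 1) * \<bar>D u\<bar> \<le> 1 * 1"
    using abs_D_le_1[of u] by (intro mult_mono) auto
  then show ?thesis
    using p_gt_1 by (simp add: K'_def abs_mult abs_signed_powr mult.assoc)
qed

lemma K_lipschitz: "\<bar>K u - K v\<bar> \<le> p * \<bar>u - v\<bar>"
proof -
  have "norm (K u - K v) \<le> p * norm (u - v)"
    by (rule field_differentiable_bound[of UNIV K K'])
      (use DERIV_K K'_bound in \<open>auto intro: has_field_derivative_at_within\<close>)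
  then show ?thesis by simp
qed

lemma K_minus: "K (- u) = K u"
  by (simp add: K_def S_minus)

lemma K_shift: "K (u + real k * P) = K u"
proof (induction k)
  case (Suc k)
  have "u + real (Suc k) * P = (u + real k * P) + P" by (simp add: algebra_simps)
  then show ?case using Suc by (simp only: K_def S_shift abs_minus_cancel)
qed simp

lemma K_reflect: "K (real k * P - u) = K u"
  using K_shift[of "- u" k] by (simp add: K_minus)

lemma K_pos: "0 < u \<Longrightarrow> u < P \<Longrightarrow> 0 < K u"
  using S_pos[of u] by (simp add: K_def)

lemma S_eq_0_iff: "S u = 0 \<longleftrightarrow> K u = 0"
  by (simp add: K_def)

lemma K_zero_mult: "K (real k * P) = 0"
  using K_shift[of 0 k] S_minus[of 0] by (simp add: K_def)

lemma K_eq_0_imp_mult: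
  assumes "K u = 0" "u \<ge> 0"
  obtains k :: nat where "u = real k * P"
proof -
  define k where "k = nat \<lfloor>u / P\<rfloor>"
  have fl: "real k = of_int \<lfloor>u / P\<rfloor>" using assms(2) P_pos by (simp add: k_def)
  have "real k \<le> u / P" "u / P < real k + 1" unfolding fl by linarith+
  then have "real k * P \<le> u" "u < real k * P + P"
    using P_pos by (simp_all add: field_simps)
  moreover have "K (u - real k * P) = 0"
    using K_shift[of "u - real k * P" k] assms(1) by simp
  ultimately have "u = real k * P"
    using K_pos[of "u - real k * P"] by (cases "u - real k * P = 0") auto
  then show ?thesis using that by blast
qed

lemma C_powr_D: "signed_powr (D u) (p - 1) * D u = 1 - K u"
  using D_powr_eq[of u] by (simp add: signed_powr_mult_self)

lemma continuous_K: "continuous_on A f \<Longrightarrow> continuous_on A (\<lambda>x. K (f x))"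
proof -
  assume f: "continuous_on A f"
  have "continuous_on UNIV K"
    using DERIV_K by (meson DERIV_isCont continuous_at_imp_continuous_on)
  from continuous_on_compose2[OF this f] show ?thesis by simp
qed

text \<open>A phase of the equation whose coefficients make \<open>(S \<phi>, D \<phi>)\<close> proportional to \<open>(y, y' / a)\<close>
  when \<open>b = a powr (1 - p) * (\<mu> - q)\<close>.\<close>

definition phase_on :: "real \<Rightarrow> real \<Rightarrow> (real \<Rightarrow> real) \<Rightarrow> (real \<Rightarrow> real) \<Rightarrow> bool" where
  "phase_on c a b \<phi> \<longleftrightarrow> \<phi> 0 = 0 \<and>
     (\<forall>x\<in>{0..c}. (\<phi> has_real_derivative a * (1 - K (\<phi> x)) + b x * K (\<phi> x)) (at x))"

section \<open>Existence, uniqueness and positivity of phases\<close>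

lemma phase_exists:
  assumes "continuous_on UNIV b" "\<And>x. \<bar>b x\<bar> \<le> B"
  shows "\<exists>\<phi>. \<phi> 0 = 0 \<and>
    (\<forall>x. (\<phi> has_real_derivative a * (1 - K (\<phi> x)) + b x * K (\<phi> x)) (at x))"
proof (rule picard_global[where M = "\<bar>a\<bar> + B" and L = "(\<bar>a\<bar> + B) * p"])
  show "continuous_on UNIV (\<lambda>x. a * (1 - K (f x)) + b x * K (f x))"
    if "continuous_on UNIV f" for f
    using that assms by (intro continuous_intros continuous_K)
  show "\<bar>a * (1 - K u) + b x * K u\<bar> \<le> \<bar>a\<bar> + B" for x u
  proof -
    have "\<bar>a * (1 - K u) + b x * K u\<bar> \<le> \<bar>a\<bar> * (1 - K u) + \<bar>b x\<bar> * K u"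
      using K_nonneg[of u] K_le_1[of u] by (intro order_trans[OF abs_triangle_ineq]) (simp add: abs_mult)
    also have "\<dots> \<le> \<bar>a\<bar> * 1 + B * 1"
      using K_nonneg[of u] K_le_1[of u] assms(2)[of x] by (intro add_mono mult_mono) auto
    finally show ?thesis by simp
  qed
  show "\<bar>(a * (1 - K u) + b x * K u) - (a * (1 - K v) + b x * K v)\<bar> \<le> (\<bar>a\<bar> + B) * p * \<bar>u - v\<bar>"
    for x u v
  proof -
    have "\<bar>(a * (1 - K u) + b x * K u) - (a * (1 - K v) + b x * K v)\<bar> = \<bar>b x - a\<bar> * \<bar>K u - K v\<bar>"
      by (simp flip: abs_mult) (simp add: algebra_simps)
    also have "\<dots> \<le> (\<bar>a\<bar> + B) * (p * \<bar>u - v\<bar>)"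
      using K_lipschitz[of u v] assms(2)[of x] by (intro mult_mono) auto
    finally show ?thesis by simp
  qed
qed

text \<open>The difference of the speeds splits into \<open>(b - a)\<close> times an increment of
  \<open>K\<close> and a perturbation. The latter is at most \<open>d\<close> because
  \<open>1 - K\<close> and \<open>K\<close> are nonnegative weights with sum 1. Only the first pair
  of coefficients enters the exponential, so the second pair may vary freely in continuity
  arguments.\<close>

lemma phase_distance:
  assumes \<phi>: "phase_on c a b \<phi>" and \<psi>: "phase_on c a' b' \<psi>"
    and b: "\<And>x. x \<in> {0..c} \<Longrightarrow> \<bar>b x\<bar> \<le> B"
    and d: "\<bar>a - a'\<bar> \<le> d" "\<And>x. x \<in> {0..c} \<Longrightarrow> \<bar>b x - b' x\<bar> \<le> d"
    and x: "x \<in> {0..c}"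
  shows "\<bar>\<phi> x - \<psi> x\<bar> \<le> d * x * exp ((\<bar>a\<bar> + B) * p * x)"
proof (rule gronwall_abs_le[where f = "\<lambda>x. \<phi> x - \<psi> x"])
  show "\<phi> 0 - \<psi> 0 = 0" using \<phi> \<psi> by (simp add: phase_on_def)
  show "0 \<le> x" "0 \<le> d" using x d by auto
  have "0 \<le> B" using b[OF x] by linarith
  then show "0 \<le> (\<bar>a\<bar> + B) * p" using p_gt_1 by simp
  fix t assume "0 \<le> t" "t \<le> x"
  then have t: "t \<in> {0..c}" using x by auto
  show "((\<lambda>x. \<phi> x - \<psi> x) has_real_derivative
      (a * (1 - K (\<phi> t)) + b t * K (\<phi> t)) - (a' * (1 - K (\<psi> t)) + b' t * K (\<psi> t))) (at t)"
    using \<phi> \<psi> t by (auto simp: phase_on_def intro!: DERIV_diff)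
  have "(a * (1 - K (\<phi> t)) + b t * K (\<phi> t)) - (a' * (1 - K (\<psi> t)) + b' t * K (\<psi> t))
      = (b t - a) * (K (\<phi> t) - K (\<psi> t)) + ((a - a') * (1 - K (\<psi> t)) + (b t - b' t) * K (\<psi> t))"
    by (simp add: algebra_simps)
  moreover have "\<bar>(b t - a) * (K (\<phi> t) - K (\<psi> t))\<bar> \<le> (\<bar>a\<bar> + B) * (p * \<bar>\<phi> t - \<psi> t\<bar>)"
    unfolding abs_mult using b[OF t] K_lipschitz by (intro mult_mono) auto
  moreover have "\<bar>(a - a') * (1 - K (\<psi> t)) + (b t - b' t) * K (\<psi> t)\<bar> \<le> d"
  proof -
    have "\<bar>(a - a') * (1 - K (\<psi> t)) + (b t - b' t) * K (\<psi> t)\<bar>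
        \<le> \<bar>a - a'\<bar> * (1 - K (\<psi> t)) + \<bar>b t - b' t\<bar> * K (\<psi> t)"
      using K_nonneg[of "\<psi> t"] K_le_1[of "\<psi> t"]
      by (intro order_trans[OF abs_triangle_ineq]) (simp add: abs_mult)
    also have "\<dots> \<le> d * (1 - K (\<psi> t)) + d * K (\<psi> t)"
      using K_nonneg[of "\<psi> t"] K_le_1[of "\<psi> t"] d t by (intro add_mono mult_right_mono) auto
    finally show ?thesis by (simp add: algebra_simps)
  qed
  ultimately show "\<bar>(a * (1 - K (\<phi> t)) + b t * K (\<phi> t)) - (a' * (1 - K (\<psi> t)) + b' t * K (\<psi> t))\<bar>
      \<le> (\<bar>a\<bar> + B) * p * \<bar>\<phi> t - \<psi> t\<bar> + d"
    by (simp add: mult.assoc)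
qed

lemma phase_unique:
  assumes "phase_on c a b \<phi>" "phase_on c a b' \<psi>"
    and "\<And>x. x \<in> {0..c} \<Longrightarrow> \<bar>b x\<bar> \<le> B"
    and "\<And>x. x \<in> {0..c} \<Longrightarrow> b x = b' x" and "x \<in> {0..c}"
  shows "\<phi> x = \<psi> x"
  using phase_distance[OF assms(1,2,3), where d = 0 and x = x] assms(4,5) by simp

text \<open>The speed is \<open>a\<close> where \<open>K\<close> vanishes, and in general falls
  short of \<open>a\<close> by at most a multiple of \<open>\<bar>\<phi> x\<bar>\<close>, even when
  \<open>b\<close> is negative. Hence \<open>\<phi> x * exp (L * x)\<close> increases
  strictly.\<close>

lemma phase_pos:
  assumes \<phi>: "phase_on c a b \<phi>" and a: "a > 0" and c: "c > 0"
    and b: "\<And>x. x \<in> {0..c} \<Longrightarrow> \<bar>b x\<bar> \<le> B"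
  shows "\<phi> c > 0"
proof -
  define L where "L = (a + B) * p"
  have ge: "a * (1 - K (\<phi> t)) + b t * K (\<phi> t) \<ge> a - L * \<bar>\<phi> t\<bar>" if t: "t \<in> {0..c}" for t
  proof -
    have "\<bar>(b t - a) * (K (\<phi> t) - K 0)\<bar> \<le> (a + B) * (p * \<bar>\<phi> t - 0\<bar>)"
      unfolding abs_mult using b[OF t] a K_lipschitz[of "\<phi> t" 0] by (intro mult_mono) auto
    moreover have "K 0 = 0" using K_zero_mult[of 0] by simp
    ultimately show ?thesis by (simp add: L_def algebra_simps abs_le_iff)
  qed
  have der: "(\<phi> has_real_derivative a * (1 - K (\<phi> t)) + b t * K (\<phi> t)) (at t)"
    if "t \<in> {0..c}" for t
    using \<phi> that by (simp add: phase_on_def)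
  have nonneg: "\<phi> t \<ge> 0" if t: "t \<in> {0..c}" for t
  proof (rule gronwall_nonneg[where L = L and f = \<phi>])
    show "0 \<le> \<phi> 0" using \<phi> by (simp add: phase_on_def)
    fix s assume "0 \<le> s" "s \<le> t"
    then have s: "s \<in> {0..c}" using t by auto
    show "(\<phi> has_real_derivative a * (1 - K (\<phi> s)) + b s * K (\<phi> s)) (at s)" by (rule der[OF s])
    show "- L * \<bar>\<phi> s\<bar> \<le> a * (1 - K (\<phi> s)) + b s * K (\<phi> s)" using ge[OF s] a by simp
  qed (use t in auto)
  have "\<phi> 0 * exp (L * 0) < \<phi> c * exp (L * c)"
  proof (rule DERIV_pos_imp_increasing[OF c])
    fix t assume "0 \<le> t" "t \<le> c"
    then have t: "t \<in> {0..c}" by simp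
    have "((\<lambda>t. \<phi> t * exp (L * t)) has_real_derivative
        (a * (1 - K (\<phi> t)) + b t * K (\<phi> t) + L * \<phi> t) * exp (L * t)) (at t)"
      by (rule derivative_eq_intros der[OF t] refl)+ (simp add: algebra_simps)
    moreover have "a * (1 - K (\<phi> t)) + b t * K (\<phi> t) + L * \<phi> t > 0"
      using ge[OF t] nonneg[OF t] a by simp
    ultimately show "\<exists>y. ((\<lambda>t. \<phi> t * exp (L * t)) has_real_derivative y) (at t) \<and> y > 0"
      by (metis exp_gt_zero mult_pos_pos)
  qed
  moreover have "\<phi> 0 = 0" using \<phi> by (simp add: phase_on_def)
  ultimately show ?thesis by (simp add: zero_less_mult_iff)
qed

text \<open>Instead of choosing branches of an arctangent, the angular speed of the curve (y, v) is
  computed from the eigenfunction and integrated to a candidate phase. Parallelism with (S, D) shows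
  that the candidate satisfies the phase equation, and uniqueness identifies it with
  \<open>\<phi>\<close>.\<close>

lemma eigenvalue_phase:
  assumes ev: "dirichlet_eigenvalue p q \<mu>" and q: "continuous_on {0..1} q" and a: "a > 0"
    and \<phi>: "phase_on 1 a b \<phi>"
    and b: "\<And>x. x \<in> {0..1} \<Longrightarrow> b x = a powr (1 - p) * (\<mu> - q x)"
  shows "\<exists>k. \<phi> 1 = real k * P"
proof -
  obtain y dy dw x1 where
    y: "\<And>x. x \<in> {0..1} \<Longrightarrow> (y has_real_derivative dy x) (at x within {0..1})" and
    w: "\<And>x. x \<in> {0..1} \<Longrightarrow> ((\<lambda>t. signed_powr (dy t) (p - 1)) has_real_derivative dw x) (at x within {0..1})"
    and eq: "\<And>x. x \<in> {0..1} \<Longrightarrow> - dw x = (p - 1) * (\<mu> - q x) * signed_powr (y x) (p - 1)"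
    and bc: "y 0 = 0" "y 1 = 0" and nt: "x1 \<in> {0..1}" "y x1 \<noteq> 0"
    using ev unfolding dirichlet_eigenvalue_def dirichlet_solution_def by blast
  have dw: "dw x = - (p - 1) * (\<mu> - q x) * signed_powr (y x) (p - 1)" if "x \<in> {0..1}" for x
    using eq[OF that] by (simp add: algebra_simps)
  have w': "((\<lambda>t. signed_powr (dy t) (p - 1)) has_real_derivative
      - (p - 1) * (\<mu> - q x) * signed_powr (y x) (p - 1)) (at x within {0..1})" if "x \<in> {0..1}" for x
    using w[OF that] unfolding dw[OF that] .
  define v where "v x = dy x / a" for x
  define r where "r x = \<bar>y x\<bar> powr p + \<bar>v x\<bar> powr p" for x
  have nz: "y x \<noteq> 0 \<or> v x \<noteq> 0" if "x \<in> {0..1}" for x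
  proof -
    have "continuous_on {0..1} (\<lambda>x. \<mu> - q x)" by (intro continuous_intros q)
    from nontrivial_solution_nowhere_zero[OF p_gt_1 this y w' nt that]
    have "y x \<noteq> 0 \<or> dy x \<noteq> 0" .
    then show ?thesis using a by (simp add: v_def)
  qed
  have r: "r x > 0" if "x \<in> {0..1}" for x
    using nz[OF that] by (auto simp: r_def add_pos_nonneg add_nonneg_pos)
  have v_powr: "signed_powr (v x) (p - 1) = a powr (1 - p) * signed_powr (dy x) (p - 1)" for x
  proof -
    have "signed_powr (1 / a) (p - 1) = a powr (1 - p)"
      using a by (simp add: signed_powr_pos powr_divide powr_diff)
    then show ?thesis
      using signed_powr_mult[of "1 / a" "dy x" "p - 1"] by (simp add: v_def)
  qed
  have W1: "((\<lambda>t. signed_powr (v t) (p - 1)) has_real_derivative a powr (1 - p) * dw x) (at x within {0..1})"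
    if "x \<in> {0..1}" for x
    unfolding v_powr by (rule DERIV_cmult[OF w[OF that]])
  have cv: "continuous_on {0..1} v"
    by (rule continuous_on_via_signed_powr[OF _ DERIV_continuous_on[OF W1]]) (use p_gt_1 in auto)
  have cy: "continuous_on {0..1} y" by (rule DERIV_continuous_on[OF y])
  \<comment> \<open>\<open>k\<close> stands in for \<open>K (\<psi> x)\<close>, to which it is
    proved equal once the two curves are known to be parallel.\<close>
  define k where "k x = \<bar>y x\<bar> powr p / r x" for x
  \<comment> \<open>Clamping extends the speed continuously beyond the interval, so that the
    candidate has the two-sided derivatives at the endpoints that \<open>phase_on\<close>
    demands.\<close>
  define cl where "cl x = max 0 (min 1 x)" for x :: real
  have cl: "cl x \<in> {0..1}" "x \<in> {0..1} \<Longrightarrow> cl x = x" for x by (auto simp: cl_def)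
  define f where "f x = a * (1 - k x) + a powr (1 - p) * (\<mu> - q x) * k x" for x
  have "continuous_on {0..1} f"
  proof -
    have "continuous_on {0..1} r"
      unfolding r_def using p_gt_1
      by (intro continuous_intros continuous_on_powr' cy cv) auto
    then have "continuous_on {0..1} k"
      unfolding k_def using p_gt_1 r
      by (intro continuous_intros continuous_on_powr' cy cv) fastforce+
    then show ?thesis unfolding f_def by (intro continuous_intros q)
  qed
  moreover have "continuous_on UNIV cl" unfolding cl_def by (intro continuous_intros)
  ultimately have "continuous_on UNIV (\<lambda>x. f (cl x))"
    using cl by (intro continuous_on_compose2[of "{0..1}" f UNIV cl]) auto
  then obtain \<psi> where \<psi>: "\<psi> 0 = 0" "\<And>x. (\<psi> has_real_derivative f (cl x)) (at x)"
    using real_antiderivative by blast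
  have \<psi>': "(\<psi> has_real_derivative f x) (at x)" if "x \<in> {0..1}" for x
    using \<psi>(2)[of x] cl that by simp
  have par: "y x * D (\<psi> x) = S (\<psi> x) * v x" if x: "x \<in> {0..1}" for x
  proof (rule parallel_if_equal_speed[OF p_gt_1 y W1 _ _ nz _ _ _ x,
        where Y2' = "\<lambda>x. D (\<psi> x) * f x"
          and W2' = "\<lambda>x. - (p - 1) * signed_powr (S (\<psi> x)) (p - 1) * f x"])
    show "y 0 * D (\<psi> 0) = S (\<psi> 0) * v 0" using bc \<psi>(1) S_minus[of 0] by simp
    fix x :: real assume x: "x \<in> {0..1}"
    show "((\<lambda>x. S (\<psi> x)) has_real_derivative D (\<psi> x) * f x) (at x within {0..1})"
      using DERIV_chain2[OF DERIV_S \<psi>'[OF x]] has_field_derivative_at_within by blast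
    show "((\<lambda>t. signed_powr (D (\<psi> t)) (p - 1)) has_real_derivative
        - (p - 1) * signed_powr (S (\<psi> x)) (p - 1) * f x) (at x within {0..1})"
      using DERIV_chain2[OF DERIV_C \<psi>'[OF x]] has_field_derivative_at_within by blast
    show "S (\<psi> x) \<noteq> 0 \<or> D (\<psi> x) \<noteq> 0" using pyth[of "\<psi> x"] by auto
    have "dy x * signed_powr (v x) (p - 1) = a * \<bar>v x\<bar> powr p"
    proof -
      have "dy x = a * v x" using a by (simp add: v_def)
      then show ?thesis using signed_powr_mult_self[of "v x" "p - 1"] by (simp add: mult_ac)
    qed
    moreover have "y x * (a powr (1 - p) * dw x) / (p - 1) = - (a powr (1 - p)) * (\<mu> - q x) * \<bar>y x\<bar> powr p"
    proof -
      have "y x * (a powr (1 - p) * dw x) / (p - 1)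
          = - (a powr (1 - p)) * (\<mu> - q x) * (signed_powr (y x) (p - 1) * y x)"
        using p_gt_1 by (simp add: dw[OF x] divide_simps) (simp add: algebra_simps)
      then show ?thesis by (simp add: signed_powr_mult_self)
    qed
    moreover have "f x = (a * \<bar>v x\<bar> powr p + a powr (1 - p) * (\<mu> - q x) * \<bar>y x\<bar> powr p) / r x"
    proof -
      have "1 - k x = \<bar>v x\<bar> powr p / r x" using r[OF x] by (simp add: k_def r_def field_simps)
      then show ?thesis by (simp add: f_def k_def add_divide_distrib)
    qed
    ultimately have "(dy x * signed_powr (v x) (p - 1) - y x * (a powr (1 - p) * dw x) / (p - 1)) /
        (\<bar>y x\<bar> powr p + \<bar>v x\<bar> powr p) = f x"
      by (simp add: r_def)
    moreover have "D (\<psi> x) * f x * signed_powr (D (\<psi> x)) (p - 1) -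
        S (\<psi> x) * (- (p - 1) * signed_powr (S (\<psi> x)) (p - 1) * f x) / (p - 1) = f x"
    proof -
      have "D (\<psi> x) * f x * signed_powr (D (\<psi> x)) (p - 1) = (1 - K (\<psi> x)) * f x"
        using C_powr_D[of "\<psi> x"] by (simp add: mult_ac)
      moreover have "S (\<psi> x) * (- (p - 1) * signed_powr (S (\<psi> x)) (p - 1) * f x) / (p - 1) = - K (\<psi> x) * f x"
      proof -
        have "S (\<psi> x) * signed_powr (S (\<psi> x)) (p - 1) = K (\<psi> x)"
          using signed_powr_mult_self[of "S (\<psi> x)" "p - 1"] by (simp add: K_def mult.commute)
        moreover have "s * (- r * t * u) / r = - (s * t) * u" if "r \<noteq> 0" for s r t u :: real
          using that by simp
        ultimately show ?thesis using p_gt_1 by (simp only: diff_gt_0_iff_gt)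
      qed
      ultimately show ?thesis by (simp add: algebra_simps)
    qed
    ultimately show "(dy x * signed_powr (v x) (p - 1) - y x * (a powr (1 - p) * dw x) / (p - 1)) /
        (\<bar>y x\<bar> powr p + \<bar>v x\<bar> powr p) =
      (D (\<psi> x) * f x * signed_powr (D (\<psi> x)) (p - 1) -
        S (\<psi> x) * (- (p - 1) * signed_powr (S (\<psi> x)) (p - 1) * f x) / (p - 1)) /
        (\<bar>S (\<psi> x)\<bar> powr p + \<bar>D (\<psi> x)\<bar> powr p)"
      using pyth[of "\<psi> x"] by simp
  qed
  have Kk: "K (\<psi> x) = k x" if x: "x \<in> {0..1}" for x
  proof -
    have "\<bar>y x * D (\<psi> x)\<bar> powr p = \<bar>S (\<psi> x) * v x\<bar> powr p" using par[OF x] by simp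
    then have "\<bar>y x\<bar> powr p * (1 - K (\<psi> x)) = K (\<psi> x) * \<bar>v x\<bar> powr p"
      by (simp add: abs_mult powr_mult D_powr_eq K_def[symmetric])
    then have "K (\<psi> x) * r x = \<bar>y x\<bar> powr p" by (simp add: r_def algebra_simps)
    then show ?thesis using r[OF x] by (simp add: k_def field_simps)
  qed
  have \<psi>_phase: "phase_on 1 a b \<psi>"
    unfolding phase_on_def using \<psi>(1) \<psi>' b Kk by (simp add: f_def)
  have "compact (b ` {0..1})"
  proof (rule compact_continuous_image)
    have "continuous_on {0..1} (\<lambda>x. a powr (1 - p) * (\<mu> - q x))" by (intro continuous_intros q)
    then show "continuous_on {0..1} b"
      by (rule continuous_on_eq) (simp add: b)
  qed simp
  then obtain B where B: "\<And>x. x \<in> {0..1} \<Longrightarrow> \<bar>b x\<bar> \<le> B"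
    using compact_imp_bounded bounded_iff by (metis image_eqI real_norm_def)
  have "\<phi> 1 = \<psi> 1"
    by (rule phase_unique[OF \<phi> \<psi>_phase B]) auto
  then have "K (\<phi> 1) = 0" using Kk[of 1] bc by (simp add: k_def)
  moreover have "\<phi> 1 \<ge> 0" using phase_pos[OF \<phi> a _ B] by simp
  ultimately show ?thesis using K_eq_0_imp_mult by metis
qed

text \<open>The amplitude lost in passing to the phase is restored by an exponential factor, which
  turns (S, D) along the phase into (y, y').\<close>

lemma phase_eigenvalue:
  assumes q: "continuous_on {0..1} q"
    and \<phi>: "\<phi> 0 = 0" "\<And>x. (\<phi> has_real_derivative (1 - K (\<phi> x)) + (\<mu> - g x) * K (\<phi> x)) (at x)"
    and g: "continuous_on UNIV g" "\<And>x. x \<in> {0..1} \<Longrightarrow> g x = q x"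
    and end1: "K (\<phi> 1) = 0"
  shows "dirichlet_eigenvalue p q \<mu>"
proof -
  \<comment> \<open>This derivative of \<rho> solves \<rho>' S = D (1 - \<phi>'), the condition for
    \<open>dy\<close> to be the derivative of \<open>y\<close>: the phase equation makes 1 - \<phi>'
    equal to \<open>K (\<phi> x) * (1 - (\<mu> - g x))\<close>, and \<open>K\<close> contains a
    factor \<open>S\<close>.\<close>
  define f where "f x = D (\<phi> x) * signed_powr (S (\<phi> x)) (p - 1) * (1 - (\<mu> - g x))" for x
  have cont: "continuous_on UNIV S" "continuous_on UNIV D"
  proof -
    show "continuous_on UNIV S" by (rule DERIV_continuous_on[OF DERIV_S])
    show "continuous_on UNIV D"
      by (rule continuous_on_via_signed_powr[OF _ DERIV_continuous_on[OF DERIV_C]])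
        (use p_gt_1 in simp)
  qed
  have "continuous_on UNIV \<phi>"
    using \<phi>(2) by (meson DERIV_isCont continuous_at_imp_continuous_on)
  then have "continuous_on UNIV f"
    unfolding f_def using p_gt_1
    by (intro continuous_intros g continuous_on_compose2[OF cont(1)] continuous_on_compose2[OF cont(2)]) auto
  then obtain \<rho> where \<rho>: "\<And>x. (\<rho> has_real_derivative f x) (at x)"
    using real_antiderivative by blast
  define y where "y x = exp (\<rho> x) * S (\<phi> x)" for x
  define dy where "dy x = exp (\<rho> x) * D (\<phi> x)" for x
  have SS: "signed_powr (S u) (p - 1) * S u = K u" for u
    by (simp add: signed_powr_mult_self K_def)
  have y: "(y has_real_derivative dy x) (at x)" for x
  proof -
    have "(y has_real_derivative exp (\<rho> x) * f x * S (\<phi> x) +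
        D (\<phi> x) * ((1 - K (\<phi> x)) + (\<mu> - g x) * K (\<phi> x)) * exp (\<rho> x)) (at x)"
      unfolding y_def
      by (intro DERIV_mult DERIV_chain2[OF DERIV_S \<phi>(2)] DERIV_chain2[OF DERIV_exp \<rho>])
    moreover have "f x * S (\<phi> x) = D (\<phi> x) * K (\<phi> x) * (1 - (\<mu> - g x))"
      unfolding f_def SS[symmetric] by simp
    then have "f x * S (\<phi> x) + D (\<phi> x) * ((1 - K (\<phi> x)) + (\<mu> - g x) * K (\<phi> x)) = D (\<phi> x)"
      by (simp add: algebra_simps)
    then have "exp (\<rho> x) * (f x * S (\<phi> x) + D (\<phi> x) * ((1 - K (\<phi> x)) + (\<mu> - g x) * K (\<phi> x))) = dy x"
      by (simp add: dy_def)
    then have "exp (\<rho> x) * f x * S (\<phi> x) +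
        D (\<phi> x) * ((1 - K (\<phi> x)) + (\<mu> - g x) * K (\<phi> x)) * exp (\<rho> x) = dy x"
      by (simp add: distrib_left mult_ac)
    ultimately show ?thesis by simp
  qed
  have sp_exp: "signed_powr (exp (\<rho> x)) (p - 1) = exp ((p - 1) * \<rho> x)" for x
    by (simp add: signed_powr_pos powr_def)
  have w: "((\<lambda>t. signed_powr (dy t) (p - 1)) has_real_derivative
      - (p - 1) * (\<mu> - g x) * signed_powr (y x) (p - 1)) (at x)" for x
  proof -
    define C where "C u = signed_powr (D u) (p - 1)" for u
    define \<sigma> where "\<sigma> = signed_powr (S (\<phi> x)) (p - 1)"
    let ?e = "exp ((p - 1) * \<rho> x)" and ?F = "(1 - K (\<phi> x)) + (\<mu> - g x) * K (\<phi> x)"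
    have "((\<lambda>t. exp ((p - 1) * \<rho> t) * C (\<phi> t)) has_real_derivative
        ?e * ((p - 1) * f x) * C (\<phi> x) + - (p - 1) * \<sigma> * ?F * ?e) (at x)"
      unfolding C_def \<sigma>_def
      by (intro DERIV_mult DERIV_chain2[OF DERIV_C \<phi>(2)] DERIV_chain2[OF DERIV_exp DERIV_cmult[OF \<rho>]])
    moreover {
    have "f x * C (\<phi> x) = \<sigma> * (1 - K (\<phi> x)) * (1 - (\<mu> - g x))"
      unfolding f_def \<sigma>_def using C_powr_D[of "\<phi> x"] by (simp add: C_def mult_ac)
    then have "f x * C (\<phi> x) - \<sigma> * ?F = - (\<mu> - g x) * \<sigma>"
      by (simp add: algebra_simps)
    then have "?e * (p - 1) * (f x * C (\<phi> x) - \<sigma> * ?F) = - (p - 1) * (\<mu> - g x) * (?e * \<sigma>)"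
      by (simp only:) (simp add: algebra_simps)
    moreover have "e * ((p - 1) * u) * v + - (p - 1) * s * F * e = e * (p - 1) * (u * v - s * F)"
      for e u v s F by (simp add: algebra_simps)
    ultimately have "?e * ((p - 1) * f x) * C (\<phi> x) + - (p - 1) * \<sigma> * ?F * ?e = - (p - 1) * (\<mu> - g x) * (?e * \<sigma>)"
      by (simp only:)
    }
    ultimately show ?thesis
      by (simp add: dy_def y_def signed_powr_mult sp_exp C_def \<sigma>_def)
  qed
  have "y x = 0 \<longleftrightarrow> K (\<phi> x) = 0" for x by (simp add: y_def S_eq_0_iff)
  then have bc: "y 0 = 0" "y 1 = 0" using end1 \<phi>(1) K_zero_mult[of 0] by auto
  have "\<exists>x\<in>{0..1}. y x \<noteq> 0"
  proof (rule ccontr)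
    assume "\<not> ?thesis"
    then have zero: "\<And>x. x \<in> {0..1} \<Longrightarrow> y x = 0" by auto
    have "(y has_real_derivative 0) (at (1/2))"
    proof (rule DERIV_cong_ev[THEN iffD1, OF refl _ refl DERIV_const])
      show "\<forall>\<^sub>F x in nhds (1/2). 0 = y x"
        by (rule eventually_mono[OF eventually_nhds_in_open[of "{0<..<1}"]]) (auto simp: zero)
    qed
    then have "dy (1/2) = 0" using y DERIV_unique by blast
    moreover have "S (\<phi> (1/2)) = 0" using zero[of "1/2"] by (simp add: y_def)
    ultimately show False using pyth[of "\<phi> (1/2)"] by (simp add: dy_def)
  qed
  moreover have "dirichlet_solution p q \<mu> y"
    unfolding dirichlet_solution_def
  proof (intro conjI exI ballI)
    fix x :: real assume x: "x \<in> {0..1}"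
    show "(y has_real_derivative dy x) (at x within {0..1})"
      using y has_field_derivative_at_within by blast
    show "((\<lambda>t. signed_powr (dy t) (p - 1)) has_real_derivative
        - (p - 1) * (\<mu> - g x) * signed_powr (y x) (p - 1)) (at x within {0..1})"
      using w has_field_derivative_at_within by blast
    show "- (- (p - 1) * (\<mu> - g x) * signed_powr (y x) (p - 1)) = (p - 1) * (\<mu> - q x) * signed_powr (y x) (p - 1)"
      using g(2)[OF x] by (simp add: algebra_simps)
  qed (use bc in auto)
  ultimately show ?thesis by (auto simp: dirichlet_eigenvalue_def)
qed

end

section \<open>Pairing points symmetric about a zero of the sine\<close>

lemma has_real_derivative_alt:
  "(f has_real_derivative D) (at x) \<longleftrightarrow>
    (\<forall>e>0. \<forall>\<^sub>F y in nhds x. \<bar>f y - f x - D * (y - x)\<bar> \<le> e * \<bar>y - x\<bar>)"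
  unfolding has_field_derivative_def has_derivative_at_alt eventually_nhds_metric
  by (simp add: dist_real_def bounded_linear_mult_right)

lemma DERIV_shift_reflect:
  fixes f :: "real \<Rightarrow> real"
  shows "(f has_real_derivative y) (at (c + s)) \<Longrightarrow> ((\<lambda>s. f (c + s)) has_real_derivative y) (at s)"
    and "(f has_real_derivative y) (at (c - s)) \<Longrightarrow> ((\<lambda>s. f (c - s)) has_real_derivative - y) (at s)"
proof -
  assume *: "(f has_real_derivative y) (at (c + s))"
  have "((\<lambda>s. f (c + s)) has_real_derivative y * 1) (at s)"
    by (rule DERIV_chain2[where f = f and g = "\<lambda>s. c + s", OF *]) (auto intro!: derivative_eq_intros)
  then show "((\<lambda>s. f (c + s)) has_real_derivative y) (at s)" by simp
next
  assume *: "(f has_real_derivative y) (at (c - s))"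
  have "((\<lambda>s. f (c - s)) has_real_derivative y * - 1) (at s)"
    by (rule DERIV_chain2[where f = f and g = "\<lambda>s. c - s", OF *]) (auto intro!: derivative_eq_intros)
  then show "((\<lambda>s. f (c - s)) has_real_derivative - y) (at s)" by simp
qed

context p_trig
begin

text \<open>For fixed \<open>\<theta>\<close>, the function \<open>z \<mapsto> K (z * \<theta>) / z powr p\<close> has derivative
  \<open>- G (z * \<theta>) / z powr (p + 1)\<close>.\<close>

definition G :: "real \<Rightarrow> real" where "G u = p * K u - u * K' u"

lemma K'_minus: "K' (- u) = - K' u"
  by (simp add: K'_def S_minus D_minus signed_powr_minus)

lemma K'_shift: "K' (u + real k * P) = K' u"
proof (induction k)
  case (Suc k)
  have "u + real (Suc k) * P = (u + real k * P) + P" by (simp add: algebra_simps)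
  then have "K' (u + real (Suc k) * P) = K' ((u + real k * P) + P)" by (simp only:)
  also have "\<dots> = K' (u + real k * P)"
    by (simp add: K'_def S_shift D_shift signed_powr_minus)
  finally show ?case using Suc by simp
qed simp

lemma K'_reflect: "K' (real k * P - u) = - K' u"
  using K'_shift[of "- u" k] by (simp add: K'_minus)

lemma continuous_on_K': "continuous_on UNIV K'"
proof -
  have "continuous_on UNIV S" by (rule DERIV_continuous_on[OF DERIV_S])
  moreover have "continuous_on UNIV D"
    by (rule continuous_on_via_signed_powr[OF _ DERIV_continuous_on[OF DERIV_C]])
      (use p_gt_1 in simp)
  ultimately show ?thesis
    unfolding K'_def[abs_def] using p_gt_1 by (intro continuous_intros) auto
qed

text \<open>By strict concavity the tangent to \<open>S\<close> at \<open>u\<close> meets the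
  vertical axis above the origin. That \<open>D\<close> decreases is read off from its signed power,
  because \<open>D\<close> itself may fail to be differentiable.\<close>

lemma S_greater:
  assumes "0 < u" "u \<le> P"
  shows "u * D u < S u"
proof -
  have "\<exists>c>0. c < u \<and> S u - S 0 = (u - 0) * D c"
    using MVT2[OF assms(1), of S D] DERIV_S by blast
  then obtain c where c: "0 < c" "c < u" "S u = u * D c"
    using S_minus[of 0] by auto
  have "signed_powr (D u) (p - 1) < signed_powr (D c) (p - 1)"
  proof (rule DERIV_neg_imp_decreasing_open[OF c(2)])
    fix x assume x: "c < x" "x < u"
    have "signed_powr (S x) (p - 1) > 0"
      using S_pos[of x] x c assms by (simp add: signed_powr_pos)
    then show "\<exists>y. ((\<lambda>u. signed_powr (D u) (p - 1)) has_real_derivative y) (at x) \<and> y < 0"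
      using DERIV_C[of x] p_gt_1
      by (intro exI[of _ "- (p - 1) * signed_powr (S x) (p - 1)"]) (auto intro: mult_neg_pos)
  next
    show "continuous_on {c..u} (\<lambda>u. signed_powr (D u) (p - 1))"
      by (rule DERIV_continuous_on[OF has_field_derivative_at_within[OF DERIV_C]])
  qed
  have "D u < D c"
  proof (rule ccontr)
    assume "\<not> D u < D c"
    moreover have "signed_powr a (p - 1) \<le> signed_powr b (p - 1)" if "a \<le> b" for a b
    proof -
      consider "0 \<le> a" | "b \<le> 0" | "a < 0" "0 < b" by linarith
      then show ?thesis
      proof cases
        case 1
        then show ?thesis
          using that p_gt_1 by (cases "a = 0") (auto simp: signed_powr_nonneg signed_powr_pos powr_mono2)
      next
        case 2
        then have "signed_powr (- b) (p - 1) \<le> signed_powr (- a) (p - 1)"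
          using that p_gt_1 by (cases "b = 0") (auto simp: signed_powr_nonneg signed_powr_pos powr_mono2)
        then show ?thesis by (simp add: signed_powr_minus)
      next
        case 3
        then show ?thesis
          using signed_powr_nonneg[of b "p - 1"] signed_powr_nonneg[of "- a" "p - 1"]
          by (simp add: signed_powr_minus)
      qed
    qed
    ultimately show False
      using \<open>signed_powr (D u) (p - 1) < signed_powr (D c) (p - 1)\<close> by (meson leD not_less)
  qed
  then show ?thesis using c assms by simp
qed

lemma G_pos:
  assumes "0 < u" "u < P"
  shows "0 < G u"
proof -
  have "G u = p * signed_powr (S u) (p - 1) * (S u - u * D u)"
    using signed_powr_mult_self[of "S u" "p - 1"] by (simp add: G_def K_def K'_def algebra_simps)
  moreover have "signed_powr (S u) (p - 1) > 0"
    using S_pos[OF assms] by (simp add: signed_powr_pos)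
  ultimately show ?thesis
    using S_greater[of u] assms p_gt_1 by simp
qed

lemma K'_nonneg:
  assumes "0 \<le> u" "u \<le> P / 2"
  shows "0 \<le> K' u"
proof -
  have "D (P / 2) = 0" using D_shift[of "- (P / 2)"] D_minus[of "P / 2"] by simp
  then have "0 \<le> D u" using D_pos[of u] assms by (cases "u = P / 2") auto
  moreover have "0 \<le> S u"
    using S_pos[of u] assms P_pos S_minus[of 0] by (cases "u = 0") auto
  ultimately show ?thesis using p_gt_1 by (simp add: K'_def signed_powr_nonneg)
qed

text \<open>\<open>G\<close> is nonnegative on \<open>[kP - P / 2, kP]\<close> but may be negative just after \<open>kP\<close>. Pairing the
  points \<open>kP - t\<close> and \<open>kP + t\<close>, the larger weight sits on the point where \<open>G\<close> is nonnegative.\<close>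

context
  fixes \<epsilon> r M :: "real \<Rightarrow> real"
  assumes anti: "\<And>u v. u \<le> v \<Longrightarrow> \<epsilon> v \<le> \<epsilon> u"
    and \<epsilon>_nonneg: "\<And>u. 0 \<le> \<epsilon> u" and \<epsilon>_le_1: "\<And>u. \<epsilon> u \<le> 1"
    and DERIV_r: "\<And>u. (r has_real_derivative - \<epsilon> u * K' u / (1 + \<epsilon> u * K u)) (at u)"
    and DERIV_M: "\<And>u. (M has_real_derivative exp (r u) * \<epsilon> u / (1 + \<epsilon> u * K u) * G u) (at u)"
    and M0: "M 0 = 0"
begin

lemma one_plus_pos: "0 \<le> e \<Longrightarrow> 1 + e * K u > 0"
  using K_nonneg[of u] by (simp add: add_pos_nonneg)

text \<open>In the application \<open>\<epsilon>\<close> is Q / z^p as a function of the phase,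
  \<open>exp (r u)\<close> the integrating factor and \<open>M\<close> the integral whose sign
  decides. For constant \<open>\<epsilon>\<close> the weight is
  \<open>\<epsilon> / (1 + \<epsilon> * K u)\<^sup>2\<close>, symmetric about
  \<open>real k * P\<close>.\<close>

lemma weight_pair:
  fixes k :: nat
  assumes t: "0 \<le> t" "t \<le> P / 2"
  defines "u \<equiv> real k * P + t" and "v \<equiv> real k * P - t"
  shows "exp (r u) * \<epsilon> u / (1 + \<epsilon> u * K u) \<le> exp (r v) * \<epsilon> v / (1 + \<epsilon> v * K v)"
proof -
  have KK: "K (real k * P + s) = K s" "K (real k * P - s) = K s"
      "K' (real k * P + s) = K' s" "K' (real k * P - s) = - K' s" for s
    using K_shift[of s k] K'_shift[of s k] by (simp_all add: K_reflect K'_reflect add.commute)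
  have e: "0 \<le> \<epsilon> u" "\<epsilon> u \<le> \<epsilon> v" "\<epsilon> v \<le> 1"
    using anti[of v u] t \<epsilon>_nonneg \<epsilon>_le_1 by (auto simp: u_def v_def)
  have mono: "a * d / (1 + a * K s) \<le> b * d / (1 + b * K s)" if "0 \<le> a" "a \<le> b" "0 \<le> d" for a b d s
  proof -
    have "a / (1 + a * K s) \<le> b / (1 + b * K s)"
      using that one_plus_pos[of a s] one_plus_pos[of b s] by (simp add: frac_le_eq divide_nonpos_pos field_simps)
    from mult_right_mono[OF this that(3)] show ?thesis by simp
  qed
  \<comment> \<open>For a constant \<open>e\<close>, the function \<open>r\<close> would be
    \<open>- ln (1 + e * K s)\<close>. Between the paired points the values of \<epsilon> lie
    between \<open>\<epsilon> u\<close> and \<open>\<epsilon> v\<close>, so the change of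
    \<open>r\<close> is compared with that for these two constants.\<close>
  define f where "f s = r (real k * P + s) - r (real k * P - s)
      - ln (1 + \<epsilon> v * K s) + ln (1 + \<epsilon> u * K s)" for s
  have "f t \<le> f 0"
  proof (rule DERIV_nonpos_imp_nonincreasing[OF t(1)])
    fix s assume s: "0 \<le> s" "s \<le> t"
    define a b where "a = \<epsilon> (real k * P + s)" and "b = \<epsilon> (real k * P - s)"
    have ab: "\<epsilon> u \<le> a" "b \<le> \<epsilon> v" "0 \<le> b" "0 \<le> a"
      using s \<epsilon>_nonneg by (auto simp: a_def b_def u_def v_def intro!: anti)
    have r1: "((\<lambda>s. r (real k * P + s)) has_real_derivative - a * K' s / (1 + a * K s)) (at s)"
      using DERIV_shift_reflect(1)[OF DERIV_r, of "real k * P" s] by (simp add: KK a_def)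
    have r2: "((\<lambda>s. r (real k * P - s)) has_real_derivative - (b * K' s / (1 + b * K s))) (at s)"
      using DERIV_shift_reflect(2)[OF DERIV_r, of "real k * P" s] by (simp add: KK b_def)
    have l: "((\<lambda>s. ln (1 + e * K s)) has_real_derivative e * K' s / (1 + e * K s)) (at s)"
      if "0 \<le> e" for e
      using one_plus_pos[OF that, of s]
      by (auto intro!: derivative_eq_intros DERIV_K)
    have "(f has_real_derivative - a * K' s / (1 + a * K s) - - (b * K' s / (1 + b * K s))
        - \<epsilon> v * K' s / (1 + \<epsilon> v * K s) + \<epsilon> u * K' s / (1 + \<epsilon> u * K s)) (at s)"
      unfolding f_def using e by (intro DERIV_add DERIV_diff r1 r2 l) auto
    moreover have "\<epsilon> u * K' s / (1 + \<epsilon> u * K s) \<le> a * K' s / (1 + a * K s)"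
      using ab e s t K'_nonneg[of s] by (intro mono) auto
    moreover have "b * K' s / (1 + b * K s) \<le> \<epsilon> v * K' s / (1 + \<epsilon> v * K s)"
      using ab e s t K'_nonneg[of s] by (intro mono) auto
    ultimately show "\<exists>y. (f has_real_derivative y) (at s) \<and> y \<le> 0"
      by (intro exI conjI) auto
  qed
  also have "f 0 = 0" using K_zero_mult[of 0] by (simp add: f_def)
  finally have "r u + ln (1 + \<epsilon> u * K t) \<le> r v + ln (1 + \<epsilon> v * K t)"
    by (simp add: f_def u_def v_def)
  then have "exp (r u + ln (1 + \<epsilon> u * K t)) \<le> exp (r v + ln (1 + \<epsilon> v * K t))" by simp
  then have R: "exp (r u) * (1 + \<epsilon> u * K t) \<le> exp (r v) * (1 + \<epsilon> v * K t)"
    using one_plus_pos[of "\<epsilon> u" t] one_plus_pos[of "\<epsilon> v" t] e by (simp add: exp_add)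
  have pu: "1 + \<epsilon> u * K t > 0" and pv: "1 + \<epsilon> v * K t > 0"
    using one_plus_pos e by auto
  \<comment> \<open>After clearing denominators the difference factors, and its second factor is
    nonnegative since \<epsilon> and \<open>K\<close> are at most 1.\<close>
  have E: "\<epsilon> u / (1 + \<epsilon> u * K t)\<^sup>2 \<le> \<epsilon> v / (1 + \<epsilon> v * K t)\<^sup>2"
  proof -
    have "\<epsilon> u * K t * (\<epsilon> v * K t) \<le> 1 * 1"
      using e K_nonneg[of t] K_le_1[of t] by (intro mult_mono mult_le_one) auto
    then have "0 \<le> (\<epsilon> v - \<epsilon> u) * (1 - \<epsilon> u * \<epsilon> v * (K t)\<^sup>2)"
      using e by (intro mult_nonneg_nonneg) (auto simp: power2_eq_square mult_ac)
    also have "\<dots> = \<epsilon> v * (1 + \<epsilon> u * K t)\<^sup>2 - \<epsilon> u * (1 + \<epsilon> v * K t)\<^sup>2"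
      by (simp add: power2_eq_square algebra_simps)
    finally show ?thesis using pu pv by (simp add: divide_simps)
  qed
  have "exp (r u) * \<epsilon> u / (1 + \<epsilon> u * K t)
      = exp (r u) * (1 + \<epsilon> u * K t) * (\<epsilon> u / (1 + \<epsilon> u * K t)\<^sup>2)"
    using pu by (simp add: power2_eq_square)
  also have "\<dots> \<le> exp (r v) * (1 + \<epsilon> v * K t) * (\<epsilon> v / (1 + \<epsilon> v * K t)\<^sup>2)"
    using pv e by (intro mult_mono[OF R E]) auto
  also have "\<dots> = exp (r v) * \<epsilon> v / (1 + \<epsilon> v * K t)"
    using pv by (simp add: power2_eq_square)
  finally show ?thesis by (simp add: u_def v_def KK)
qed

lemma weight_nonneg: "0 \<le> exp (r u) * \<epsilon> u / (1 + \<epsilon> u * K u)"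
  using \<epsilon>_nonneg[of u] one_plus_pos[OF \<epsilon>_nonneg, of u u] by simp

text \<open>As \<open>G\<close> is nonnegative at the left point, which carries the larger weight,
  replacing that weight by the smaller one only lowers the paired integrand. What remains is one
  weight times the sum of the two values of \<open>G\<close>.\<close>

lemma M_pair:
  assumes k: "k \<ge> 1" and t: "0 \<le> t" "t \<le> P / 2"
  shows "M (real k * P - t) \<le> M (real k * P + t)"
proof -
  define W where "W u = exp (r u) * \<epsilon> u / (1 + \<epsilon> u * K u)" for u
  define J where "J s = M (real k * P + s) - M (real k * P - s)" for s
  have "J 0 \<le> J t"
  proof (rule DERIV_nonneg_imp_nondecreasing[OF t(1)])
    fix s assume s: "0 \<le> s" "s \<le> t"
    let ?u = "real k * P + s" and ?v = "real k * P - s"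
    have m1: "((\<lambda>s. M (real k * P + s)) has_real_derivative W ?u * G ?u) (at s)"
      unfolding W_def by (rule DERIV_shift_reflect(1)[OF DERIV_M])
    have m2: "((\<lambda>s. M (real k * P - s)) has_real_derivative - (W ?v * G ?v)) (at s)"
      unfolding W_def by (rule DERIV_shift_reflect(2)[OF DERIV_M])
    have "(J has_real_derivative W ?u * G ?u - - (W ?v * G ?v)) (at s)"
      unfolding J_def by (intro DERIV_diff m1 m2)
    moreover have "0 \<le> W ?u * G ?u + W ?v * G ?v"
    proof -
      have kP: "P \<le> real k * P" using k P_pos by simp
      have W: "0 \<le> W ?u" "W ?u \<le> W ?v"
        using weight_nonneg[of ?u] weight_pair[of s k] s t by (auto simp: W_def)
      have gu: "G ?u = p * K s - (real k * P + s) * K' s"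
        using K_shift[of s k] K'_shift[of s k] by (simp add: G_def add.commute)
      have gv: "G ?v = p * K s + (real k * P - s) * K' s"
        by (simp add: G_def K_reflect K'_reflect)
      have "0 \<le> G s" using G_pos[of s] s t P_pos K_zero_mult[of 0] by (cases "s = 0") (auto simp: G_def)
      \<comment> \<open>The terms \<open>real k * P * K' s\<close> from the two reflected points
        cancel.\<close>
      moreover have "G ?u + G ?v = 2 * G s" unfolding gu gv by (simp add: G_def algebra_simps)
      ultimately have sum: "0 \<le> G ?u + G ?v" by simp
      have "0 \<le> G ?v"
      proof -
        have "0 \<le> (real k * P - s) * K' s"
          using K'_nonneg[of s] s t kP P_pos by (intro mult_nonneg_nonneg) linarith+
        then show ?thesis unfolding gv using K_nonneg[of s] p_gt_1 by (simp add: add_nonneg_nonneg)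
      qed
      then have "W ?u * G ?v \<le> W ?v * G ?v" using W by (intro mult_right_mono)
      moreover have "0 \<le> W ?u * (G ?u + G ?v)" using W sum by simp
      ultimately show ?thesis by (simp add: distrib_left)
    qed
    ultimately show "\<exists>y. (J has_real_derivative y) (at s) \<and> 0 \<le> y"
      by (intro exI conjI) auto
  qed
  then show ?thesis by (simp add: J_def)
qed

text \<open>On this stretch \<open>K\<close> decreases to its zero at \<open>real k * P\<close>, so
  \<open>- u * K' u\<close> is nonnegative and so is \<open>G\<close>.\<close>

lemma M_mono_before_multiple:
  assumes "k \<ge> 1" "real k * P - P / 2 \<le> u" "u \<le> v" "v \<le> real k * P"
  shows "M u \<le> M v"
proof (rule DERIV_nonneg_imp_nondecreasing[OF assms(3)])
  fix x assume x: "u \<le> x" "x \<le> v"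
  define t where "t = real k * P - x"
  have t: "0 \<le> t" "t \<le> P / 2" "x = real k * P - t" using x assms by (auto simp: t_def)
  have "P \<le> real k * P" using assms(1) P_pos by simp
  then have "0 \<le> x" using t P_pos by linarith
  then have "0 \<le> x * K' t" using t K'_nonneg[of t] by (intro mult_nonneg_nonneg) auto
  moreover have "G x = p * K t + x * K' t"
    using K_reflect[of k t] K'_reflect[of k t] t(3) by (simp add: G_def)
  ultimately have "0 \<le> G x" using K_nonneg[of t] p_gt_1 by simp
  then show "\<exists>y. (M has_real_derivative y) (at x) \<and> 0 \<le> y"
    using DERIV_M[of x] weight_nonneg[of x] by (blast intro: mult_nonneg_nonneg)
qed

text \<open>\<open>M\<close> need not be monotone beyond \<open>P\<close>. On an interval of length
  \<open>P\<close> centred at a multiple of \<open>P\<close> it increases up to the centre, and of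
  two reflected points the right one has the larger value. Hence it never falls below its value at
  the left end, and induction leads back to \<open>P / 2\<close>.\<close>

lemma M_ge_half: "P / 2 \<le> u \<Longrightarrow> M (P / 2) \<le> M u"
proof -
  assume u: "P / 2 \<le> u"
  have step: "\<forall>u. real k * P + P / 2 \<le> u \<and> u \<le> real (Suc k) * P + P / 2 \<longrightarrow> M (P / 2) \<le> M u" for k
  proof (induction k)
    case 0
    show ?case
    proof (intro allI impI)
      fix u assume u: "real 0 * P + P / 2 \<le> u \<and> u \<le> real (Suc 0) * P + P / 2"
      show "M (P / 2) \<le> M u"
      proof (cases "u \<le> P")
        case True
        then show ?thesis using M_mono_before_multiple[of 1 "P / 2" u] u by simp
      next
        case False
        then have "M (P - (u - P)) \<le> M u" using M_pair[of 1 "u - P"] u by simp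
        moreover have "M (P / 2) \<le> M (P - (u - P))"
          using M_mono_before_multiple[of 1 "P / 2" "P - (u - P)"] u False by simp
        ultimately show ?thesis by simp
      qed
    qed
  next
    case (Suc k)
    \<comment> \<open>The interval for \<open>Suc k\<close> is centred at \<open>real l * P\<close>;
      its left end \<open>real l * P - P / 2\<close> is the right end of the interval for
      \<open>k\<close>.\<close>
    define l where "l = Suc (Suc k)"
    have l: "real l * P = real (Suc k) * P + P" by (simp add: l_def algebra_simps)
    have base: "M (P / 2) \<le> M (real l * P - P / 2)"
      using Suc[rule_format, of "real (Suc k) * P + P / 2"] P_pos l by (simp add: algebra_simps)
    show ?case
    proof (intro allI impI)
      fix u assume u: "real (Suc k) * P + P / 2 \<le> u \<and> u \<le> real (Suc (Suc k)) * P + P / 2"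
      then have u': "real l * P - P / 2 \<le> u" "u \<le> real l * P + P / 2"
        using l by (simp_all add: l_def[symmetric])
      show "M (P / 2) \<le> M u"
      proof (cases "u \<le> real l * P")
        case True
        then show ?thesis
          using M_mono_before_multiple[of l "real l * P - P / 2" u] u' base by (simp add: l_def)
      next
        case False
        define t where "t = u - real l * P"
        have t: "0 \<le> t" "t \<le> P / 2" and ut: "u = real l * P + t"
          using u' False by (simp_all add: t_def)
        have "l \<ge> 1" by (simp add: l_def)
        then have "M (real l * P - t) \<le> M u" "M (real l * P - P / 2) \<le> M (real l * P - t)"
          unfolding ut using t by (auto intro!: M_pair M_mono_before_multiple[of l])
        then show ?thesis using base by simp
      qed
    qed
  qed
  define k where "k = nat \<lfloor>(u - P / 2) / P\<rfloor>"
  have "real k = of_int \<lfloor>(u - P / 2) / P\<rfloor>" using u P_pos by (simp add: k_def)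
  then have "real k \<le> (u - P / 2) / P" "(u - P / 2) / P < real k + 1" by linarith+
  then have "real k * P + P / 2 \<le> u" "u \<le> real (Suc k) * P + P / 2"
    using P_pos by (simp_all add: field_simps)
  then show ?thesis using step by blast
qed

lemma M_mono_initial:
  assumes "0 \<le> u" "u \<le> v" "v \<le> P / 2"
  shows "M u \<le> M v"
proof (rule DERIV_nonneg_imp_nondecreasing[OF assms(2)])
  fix x assume "u \<le> x" "x \<le> v"
  then have "0 \<le> G x"
    using G_pos[of x] assms P_pos K_zero_mult[of 0] by (cases "x = 0") (auto simp: G_def)
  then show "\<exists>y. (M has_real_derivative y) (at x) \<and> 0 \<le> y"
    using DERIV_M[of x] weight_nonneg[of x] by (blast intro: mult_nonneg_nonneg)
qed

lemma M_nonneg: "0 \<le> u \<Longrightarrow> 0 \<le> M u"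
  using M_mono_initial[of 0 u] M_mono_initial[of 0 "P / 2"] M_ge_half[of u] M0 P_pos
  by (cases "u \<le> P / 2") auto

text \<open>Strictness is collected just after 0, where weight and \<open>G\<close> are both
  positive. It is not lost later, since \<open>M\<close> never falls below a value it takes on the
  initial stretch up to \<open>P / 2\<close>.\<close>

lemma M_pos:
  assumes "0 < u" "isCont \<epsilon> 0" "0 < \<epsilon> 0"
  shows "0 < M u"
proof -
  have "\<forall>\<^sub>F x in at 0. 0 < \<epsilon> x"
    using assms(2,3) by (simp add: isCont_def order_tendstoD(1))
  then obtain d where d: "d > 0" "\<And>x. x \<noteq> 0 \<Longrightarrow> \<bar>x\<bar> < d \<Longrightarrow> 0 < \<epsilon> x"
    unfolding eventually_at by (auto simp: dist_real_def)
  define v where "v = min u (min d (P / 2))"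
  have v: "0 < v" "v \<le> u" "v \<le> d" "v \<le> P / 2" using assms d P_pos by (auto simp: v_def)
  have "M 0 < M v"
  proof (rule DERIV_pos_imp_increasing_open[OF v(1)])
    fix x assume x: "0 < x" "x < v"
    have "0 < exp (r x) * \<epsilon> x / (1 + \<epsilon> x * K x) * G x"
      using d(2)[of x] x v G_pos[of x] one_plus_pos[OF \<epsilon>_nonneg, of x x] P_pos
      by (intro mult_pos_pos divide_pos_pos) auto
    then show "\<exists>y. (M has_real_derivative y) (at x) \<and> 0 < y" using DERIV_M[of x] by blast
  next
    show "continuous_on {0..v} M"
      by (rule DERIV_continuous_on[OF has_field_derivative_at_within[OF DERIV_M]])
  qed
  also have "M v \<le> M u"
    using M_mono_initial[of v u] M_mono_initial[of v "P / 2"] M_ge_half[of u] v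
    by (cases "u \<le> P / 2") auto
  finally show ?thesis by (simp add: M0)
qed

end

end

section \<open>Differentiation in the eigenvalue parameter\<close>

context p_trig
begin

text \<open>The Taylor remainder has to be small along a whole trajectory at once; uniform
  continuity of \<open>K'\<close> on bounded sets gives this.\<close>

lemma K_uniformly_differentiable:
  assumes "\<eta> > 0"
  obtains \<delta> where "\<delta> > 0"
    "\<And>u v. \<bar>u\<bar> \<le> B \<Longrightarrow> \<bar>v - u\<bar> < \<delta> \<Longrightarrow> \<bar>K v - K u - K' u * (v - u)\<bar> \<le> \<eta> * \<bar>v - u\<bar>"
proof -
  \<comment> \<open>The margin 1 leaves room for \<open>v\<close>, which is why \<delta> is capped
    by 1 below.\<close>
  have "uniformly_continuous_on {-(B+1)..B+1} K'"
    by (rule compact_uniformly_continuous[OF continuous_on_subset[OF continuous_on_K']]) auto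
  then obtain \<delta> where \<delta>: "\<delta> > 0"
    "\<And>u v. u \<in> {-(B+1)..B+1} \<Longrightarrow> v \<in> {-(B+1)..B+1} \<Longrightarrow> dist v u < \<delta> \<Longrightarrow> dist (K' v) (K' u) < \<eta>"
    using assms unfolding uniformly_continuous_on_def by meson
  show ?thesis
  proof (rule that[of "min \<delta> 1"])
    show "0 < min \<delta> 1" using \<delta> by simp
    fix u v assume u: "\<bar>u\<bar> \<le> B" and v: "\<bar>v - u\<bar> < min \<delta> 1"
    let ?s = "cball u \<bar>v - u\<bar>"
    have "norm ((\<lambda>x. K x - K' u * x) v - (\<lambda>x. K x - K' u * x) u) \<le> \<eta> * norm (v - u)"
    proof (rule field_differentiable_bound[where S = ?s and f' = "\<lambda>x. K' x - K' u"])
      show "convex ?s" by simp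
      show "((\<lambda>x. K x - K' u * x) has_field_derivative K' x - K' u) (at x within ?s)" for x
        by (auto intro!: derivative_eq_intros has_field_derivative_at_within[OF DERIV_K])
      show "norm (K' x - K' u) \<le> \<eta>" if "x \<in> ?s" for x
      proof -
        have "\<bar>x - u\<bar> \<le> \<bar>v - u\<bar>" using that by (simp add: dist_real_def abs_minus_commute)
        then have "dist (K' x) (K' u) < \<eta>" using u v by (intro \<delta>(2)) (auto simp: dist_real_def)
        then show ?thesis by (simp add: dist_real_def)
      qed
    qed (auto simp: dist_real_def abs_minus_commute)
    then show "\<bar>K v - K u - K' u * (v - u)\<bar> \<le> \<eta> * \<bar>v - u\<bar>" by (simp add: algebra_simps)
  qed
qed

text \<open>\<open>Q\<close> stands for \<open>-q\<close>; \<open>\<phi> z\<close> is the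
  phase for the eigenvalue parameter \<open>z powr p\<close>, so that \<open>\<phi> z x = z * x\<close> for \<open>Q = 0\<close>.\<close>

context
  fixes Q :: "real \<Rightarrow> real" and \<phi> :: "real \<Rightarrow> real \<Rightarrow> real" and B :: real
  assumes Q_cont: "continuous_on UNIV Q" and Q_nonneg: "\<And>x. 0 \<le> Q x" and Q_le: "\<And>x. Q x \<le> B"
    and \<phi>0: "\<And>z. 0 < z \<Longrightarrow> \<phi> z 0 = 0"
    and \<phi>: "\<And>z x. 0 < z \<Longrightarrow>
      (\<phi> z has_real_derivative z + z powr (1 - p) * Q x * K (\<phi> z x)) (at x)"
begin

lemma phase_on_scaled: "0 < z \<Longrightarrow> phase_on c z (\<lambda>x. z + z powr (1 - p) * Q x) (\<phi> z)"
  using \<phi>0 \<phi> by (auto simp: phase_on_def algebra_simps)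

text \<open>An a priori bound, which makes products of two increments quadratically small in
  \<open>phase_parameter_derivative\<close>.\<close>

lemma phase_parameter_lipschitz:
  assumes z: "0 < z" and c: "0 \<le> c"
  obtains C where "C \<ge> 0" "\<forall>\<^sub>F s in nhds z. \<forall>x\<in>{0..c}. \<bar>\<phi> s x - \<phi> z x\<bar> \<le> C * \<bar>s - z\<bar>"
proof -
  define D0 where "D0 = (1 - p) * z powr (1 - p - 1)"
  have "((\<lambda>s. s powr (1 - p)) has_real_derivative D0) (at z)"
    using z unfolding D0_def by (rule has_real_derivative_powr)
  then have ev: "\<forall>\<^sub>F s in nhds z. \<bar>s powr (1 - p) - z powr (1 - p) - D0 * (s - z)\<bar> \<le> 1 * \<bar>s - z\<bar>"
    unfolding has_real_derivative_alt using zero_less_one by blast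
  \<comment> \<open>\<open>A\<close> collects 1 for the change of \<open>z\<close> and
    \<open>(1 + \<bar>D0\<bar>) * B\<close> for that of \<open>z powr (1 - p) * Q x\<close>.\<close>
  define A where "A = 1 + (1 + \<bar>D0\<bar>) * B"
  define L where "L = (\<bar>z\<bar> + (z + z powr (1 - p) * B)) * p"
  have B: "0 \<le> B" using Q_nonneg[of 0] Q_le[of 0] by linarith
  have L: "0 \<le> L" using z B p_gt_1 by (simp add: L_def)
  have A: "0 \<le> A" using B by (simp add: A_def)
  show ?thesis
  proof (rule that[of "A * c * exp (L * c)"])
    show "0 \<le> A * c * exp (L * c)" using A c by simp
    have "\<forall>\<^sub>F s in nhds z. s > 0"
      using z eventually_nhds_in_open[of "{0<..}" z] by auto
    with ev show "\<forall>\<^sub>F s in nhds z. \<forall>x\<in>{0..c}. \<bar>\<phi> s x - \<phi> z x\<bar> \<le> A * c * exp (L * c) * \<bar>s - z\<bar>"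
    proof eventually_elim
      case (elim s)
      have "\<bar>s powr (1 - p) - z powr (1 - p)\<bar> \<le> \<bar>D0 * (s - z)\<bar> + 1 * \<bar>s - z\<bar>"
        using elim(1) by linarith
      then have pw: "\<bar>s powr (1 - p) - z powr (1 - p)\<bar> \<le> (1 + \<bar>D0\<bar>) * \<bar>s - z\<bar>"
        unfolding abs_mult by (simp add: distrib_right)
      show ?case
      proof
        fix x assume x: "x \<in> {0..c}"
        have "\<bar>\<phi> z x - \<phi> s x\<bar> \<le> (A * \<bar>s - z\<bar>) * x * exp (L * x)"
          unfolding L_def
        proof (rule phase_distance[OF phase_on_scaled[OF z] phase_on_scaled[OF elim(2)] _ _ _ x])
          show "\<bar>z + z powr (1 - p) * Q t\<bar> \<le> z + z powr (1 - p) * B" for t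
            using z Q_nonneg[of t] Q_le[of t] by (simp add: mult_left_mono)
          show "\<bar>z - s\<bar> \<le> A * \<bar>s - z\<bar>"
            using B by (simp add: A_def abs_minus_commute distrib_right)
          fix t
          have "\<bar>(z powr (1 - p) - s powr (1 - p)) * Q t\<bar> \<le> (1 + \<bar>D0\<bar>) * \<bar>s - z\<bar> * B"
            unfolding abs_mult using pw Q_nonneg[of t] Q_le[of t]
            by (intro mult_mono) (auto simp: abs_minus_commute)
          moreover have "(z + z powr (1 - p) * Q t) - (s + s powr (1 - p) * Q t)
              = (z - s) + (z powr (1 - p) - s powr (1 - p)) * Q t"
            by (simp add: algebra_simps)
          ultimately show "\<bar>(z + z powr (1 - p) * Q t) - (s + s powr (1 - p) * Q t)\<bar> \<le> A * \<bar>s - z\<bar>"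
            by (simp add: A_def algebra_simps abs_minus_commute)
        qed
        also have "\<dots> \<le> (A * \<bar>s - z\<bar>) * c * exp (L * c)"
          using x A L by (intro mult_mono) (auto intro: mult_left_mono)
        finally show "\<bar>\<phi> s x - \<phi> z x\<bar> \<le> A * c * exp (L * c) * \<bar>s - z\<bar>"
          by (simp add: mult_ac abs_minus_commute)
      qed
    qed
  qed
qed

text \<open>\<open>\<zeta>\<close> solves the formal linearization in \<open>z\<close>. The error of
  the linear approximation obeys the inequality of \<open>gronwall_abs_le\<close> with an
  inhomogeneity of order \<eta> times the increment of \<open>z\<close>.\<close>

lemma phase_parameter_derivative:
  assumes z: "0 < z" and c: "0 \<le> c" and \<zeta>0: "\<zeta> 0 = 0"
    and \<zeta>: "\<And>x. (\<zeta> has_real_derivative 1 + (1 - p) * z powr (- p) * Q x * K (\<phi> z x) +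
        z powr (1 - p) * Q x * K' (\<phi> z x) * \<zeta> x) (at x)"
  shows "((\<lambda>s. \<phi> s c) has_real_derivative \<zeta> c) (at z)"
  unfolding has_real_derivative_alt
proof (intro allI impI)
  fix e :: real assume e: "0 < e"
  have B: "0 \<le> B" using Q_nonneg[of 0] Q_le[of 0] by linarith
  obtain C where C: "C \<ge> 0" "\<forall>\<^sub>F s in nhds z. \<forall>x\<in>{0..c}. \<bar>\<phi> s x - \<phi> z x\<bar> \<le> C * \<bar>s - z\<bar>"
    using phase_parameter_lipschitz[OF z c] by blast
  define a where "a = z powr (1 - p)"
  define a' where "a' = (1 - p) * z powr (- p)"
  define L where "L = B * a * p"
  define C1 where "C1 = B * (1 + \<bar>a'\<bar> * p * C + a * C)"
  \<comment> \<open>The final estimate carries the factor \<open>C1 * c * exp (L * c)\<close>;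
    adding 1 to \<open>C1\<close> and to \<open>c\<close> keeps the denominator positive.\<close>
  define \<eta> where "\<eta> = e / ((C1 + 1) * (c + 1) * exp (L * c))"
  have a: "0 < a" using z by (simp add: a_def)
  have L: "0 \<le> L" using a B p_gt_1 by (simp add: L_def)
  have C1: "0 \<le> C1" using B a C p_gt_1 by (simp add: C1_def)
  have \<eta>: "0 < \<eta>" using e C1 c by (simp add: \<eta>_def)
  have "compact (\<phi> z ` {0..c})"
    by (intro compact_continuous_image DERIV_continuous_on[OF has_field_derivative_at_within[OF \<phi>[OF z]]]) auto
  then obtain b where b: "\<And>x. x \<in> {0..c} \<Longrightarrow> \<bar>\<phi> z x\<bar> \<le> b"
    using compact_imp_bounded bounded_iff by (metis image_eqI real_norm_def)
  obtain \<delta> where \<delta>: "\<delta> > 0"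
    "\<And>u v. \<bar>u\<bar> \<le> b \<Longrightarrow> \<bar>v - u\<bar> < \<delta> \<Longrightarrow> \<bar>K v - K u - K' u * (v - u)\<bar> \<le> \<eta> * \<bar>v - u\<bar>"
    using K_uniformly_differentiable[OF \<eta>, of b] by metis
  have "((\<lambda>s. s powr (1 - p)) has_real_derivative a') (at z)"
    using has_real_derivative_powr[OF z, of "1 - p"] by (simp add: a'_def)
  then have ev1: "\<forall>\<^sub>F s in nhds z. \<bar>s powr (1 - p) - a - a' * (s - z)\<bar> \<le> \<eta> * \<bar>s - z\<bar>"
    using \<eta> unfolding has_real_derivative_alt a_def by simp
  have ev2: "\<forall>\<^sub>F s in nhds z. dist s z < min \<eta> (min z (\<delta> / (C + 1)))"
    unfolding eventually_nhds_metric
    using \<eta> z \<delta>(1) C(1) by (intro exI[of _ "min \<eta> (min z (\<delta> / (C + 1)))"]) auto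
  from ev1 ev2 C(2) show "\<forall>\<^sub>F s in nhds z. \<bar>\<phi> s c - \<phi> z c - \<zeta> c * (s - z)\<bar> \<le> e * \<bar>s - z\<bar>"
  proof eventually_elim
    case (elim s)
    define h where "h = s - z"
    have s: "0 < s" "\<bar>h\<bar> \<le> \<eta>" "\<bar>h\<bar> < \<delta> / (C + 1)"
      using elim(2) by (auto simp: dist_real_def h_def)
    have near: "\<bar>\<phi> s x - \<phi> z x\<bar> \<le> C * \<bar>h\<bar>" if "x \<in> {0..c}" for x
      using elim(3) that by (simp add: h_def)
    have "C * \<bar>h\<bar> < \<delta>"
    proof -
      have "C * \<bar>h\<bar> \<le> (C + 1) * \<bar>h\<bar>" by (simp add: mult_right_mono)
      also have "\<dots> < \<delta>" using s(3) C(1) by (simp add: pos_less_divide_eq mult.commute)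
      finally show ?thesis .
    qed
    define f' where "f' x = (s + s powr (1 - p) * Q x * K (\<phi> s x)) - (z + a * Q x * K (\<phi> z x))
        - (1 + a' * Q x * K (\<phi> z x) + a * Q x * K' (\<phi> z x) * \<zeta> x) * h" for x
    have "\<bar>\<phi> s c - \<phi> z c - \<zeta> c * h\<bar> \<le> (\<eta> * \<bar>h\<bar> * C1) * c * exp (L * c)"
    proof (rule gronwall_abs_le[where f = "\<lambda>x. \<phi> s x - \<phi> z x - \<zeta> x * h" and f' = f'])
      show "\<phi> s 0 - \<phi> z 0 - \<zeta> 0 * h = 0" using \<phi>0 z s(1) \<zeta>0 by simp
      show "0 \<le> c" "0 \<le> L" "0 \<le> \<eta> * \<bar>h\<bar> * C1" using c L \<eta> C1 by auto
      fix x assume "0 \<le> x" "x \<le> c"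
      then have x: "x \<in> {0..c}" by simp
      show "((\<lambda>x. \<phi> s x - \<phi> z x - \<zeta> x * h) has_real_derivative f' x) (at x)"
        unfolding f'_def a_def a'_def
        by (intro DERIV_diff DERIV_cmult_right \<phi> \<zeta> z s(1))
      define d where "d = \<phi> s x - \<phi> z x"
      \<comment> \<open>The four terms are the remainder of the power of \<open>s\<close>, a product
        of two increments, the Taylor remainder of \<open>K\<close>, and the linear term that
        Gronwall's inequality absorbs.\<close>
      define T1 where "T1 = (s powr (1 - p) - a - a' * h) * K (\<phi> s x)"
      define T2 where "T2 = h * a' * (K (\<phi> s x) - K (\<phi> z x))"
      define T3 where "T3 = a * (K (\<phi> s x) - K (\<phi> z x) - K' (\<phi> z x) * d)"
      define T4 where "T4 = a * K' (\<phi> z x) * (\<phi> s x - \<phi> z x - \<zeta> x * h)"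
      have f'_eq: "f' x = Q x * (T1 + T2 + T3 + T4)"
      proof -
        have "s = z + h" by (simp add: h_def)
        then show ?thesis
          unfolding f'_def T1_def T2_def T3_def T4_def d_def by (simp add: algebra_simps)
      qed
      have d: "\<bar>d\<bar> \<le> C * \<bar>h\<bar>" using near[OF x] by (simp add: d_def)
      have "\<bar>T1\<bar> \<le> (\<eta> * \<bar>h\<bar>) * 1"
        unfolding T1_def abs_mult using elim(1) K_nonneg[of "\<phi> s x"] K_le_1[of "\<phi> s x"]
        by (intro mult_mono) (auto simp: h_def)
      moreover have "\<bar>T2\<bar> \<le> (\<eta> * \<bar>h\<bar>) * (\<bar>a'\<bar> * p * C)"
      proof -
        have "\<bar>K (\<phi> s x) - K (\<phi> z x)\<bar> \<le> p * (C * \<bar>h\<bar>)"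
          using K_lipschitz[of "\<phi> s x" "\<phi> z x"] d p_gt_1
          by (rule_tac order_trans) (auto simp: d_def intro!: mult_left_mono)
        then have "\<bar>T2\<bar> \<le> \<bar>h\<bar> * \<bar>a'\<bar> * (p * (C * \<bar>h\<bar>))"
          unfolding T2_def abs_mult by (intro mult_left_mono) auto
        also have "\<dots> = \<bar>h\<bar> * (\<bar>h\<bar> * (\<bar>a'\<bar> * p * C))" by (simp add: mult_ac)
        also have "\<dots> \<le> \<eta> * (\<bar>h\<bar> * (\<bar>a'\<bar> * p * C))"
          using s(2) C(1) p_gt_1 by (intro mult_right_mono) auto
        finally show ?thesis by (simp add: mult_ac)
      qed
      moreover have "\<bar>T3\<bar> \<le> (\<eta> * \<bar>h\<bar>) * (a * C)"
      proof -
        have "\<bar>K (\<phi> s x) - K (\<phi> z x) - K' (\<phi> z x) * d\<bar> \<le> \<eta> * \<bar>d\<bar>"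
          unfolding d_def using near[OF x] \<open>C * \<bar>h\<bar> < \<delta>\<close> by (intro \<delta>(2) b x) auto
        also have "\<dots> \<le> \<eta> * (C * \<bar>h\<bar>)" using d \<eta> by (intro mult_left_mono) auto
        finally have "\<bar>T3\<bar> \<le> a * (\<eta> * (C * \<bar>h\<bar>))"
          unfolding T3_def abs_mult using a by (simp add: mult_left_mono)
        then show ?thesis by (simp add: mult_ac)
      qed
      moreover have "\<bar>T4\<bar> \<le> a * p * \<bar>\<phi> s x - \<phi> z x - \<zeta> x * h\<bar>"
        unfolding T4_def abs_mult using a K'_bound[of "\<phi> z x"] by (intro mult_mono) auto
      ultimately have "\<bar>T1 + T2 + T3 + T4\<bar> \<le> (\<eta> * \<bar>h\<bar>) * (1 + \<bar>a'\<bar> * p * C + a * C)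
          + a * p * \<bar>\<phi> s x - \<phi> z x - \<zeta> x * h\<bar>"
        unfolding distrib_left by linarith
      then have "\<bar>f' x\<bar> \<le> B * ((\<eta> * \<bar>h\<bar>) * (1 + \<bar>a'\<bar> * p * C + a * C)
          + a * p * \<bar>\<phi> s x - \<phi> z x - \<zeta> x * h\<bar>)"
        unfolding f'_eq abs_mult using Q_nonneg[of x] Q_le[of x] by (intro mult_mono) auto
      then show "\<bar>f' x\<bar> \<le> L * \<bar>\<phi> s x - \<phi> z x - \<zeta> x * h\<bar> + \<eta> * \<bar>h\<bar> * C1"
        by (simp add: L_def C1_def algebra_simps)
    qed
    also have "\<dots> = \<eta> * (C1 * c * exp (L * c)) * \<bar>h\<bar>" by (simp add: mult_ac)
    also have "\<dots> \<le> \<eta> * ((C1 + 1) * (c + 1) * exp (L * c)) * \<bar>h\<bar>"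
      using \<eta> C1 c by (intro mult_right_mono mult_left_mono mult_mono) auto
    also have "\<eta> * ((C1 + 1) * (c + 1) * exp (L * c)) = e"
      using C1 c by (simp add: \<eta>_def)
    finally show ?case by (simp add: h_def)
  qed
qed

end

end

section \<open>Counting eigenvalues\<close>

lemma isCont_if_dominated:
  fixes f h :: "real \<Rightarrow> real"
  assumes "\<forall>\<^sub>F y in at x. \<bar>f y - f x\<bar> \<le> h y" "(h \<longlongrightarrow> 0) (at x)"
  shows "isCont f x"
proof -
  have "((\<lambda>y. f y - f x) \<longlongrightarrow> 0) (at x)"
    by (rule Lim_null_comparison[OF _ assms(2)]) (use assms(1) in simp)
  then show ?thesis by (simp add: isCont_def LIM_zero_iff)
qed

lemma bounded_on_unit_interval:
  fixes q :: "real \<Rightarrow> real"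
  assumes "continuous_on {0..1} q"
  obtains B where "\<And>x. x \<in> {0..1} \<Longrightarrow> \<bar>q x\<bar> \<le> B"
proof -
  have "compact (q ` {0..1})" by (intro compact_continuous_image assms) simp
  then show ?thesis
    using that compact_imp_bounded bounded_iff by (metis image_eqI real_norm_def)
qed

lemma continuous_clamp:
  fixes q :: "real \<Rightarrow> real"
  assumes "continuous_on {a..b} q" "a \<le> b"
  shows "continuous_on UNIV (\<lambda>x. q (max a (min b x)))"
  by (rule continuous_on_compose2[OF assms(1)]) (use assms(2) in \<open>auto intro!: continuous_intros\<close>)

text \<open>It yields the exact index once the multiples of \<open>P\<close> belonging to the
  eigenvalues are known to increase strictly and to exhaust the positive ones.\<close>

lemma strict_mono_surj_index:
  fixes kk :: "nat \<Rightarrow> nat"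
  assumes "strict_mono_on {1..} kk" and "kk ` {1..} = {1..}" and "i \<ge> 1"
  shows "kk i = i"
  using assms(3)
proof (induction i rule: less_induct)
  case (less i)
  have less_iff: "kk a < kk b \<longleftrightarrow> a < b" if "a \<ge> 1" "b \<ge> 1" for a b
    using assms(1) that by (simp add: strict_mono_on_less)
  have "i \<in> kk ` {1..}" using assms(2) less.prems by simp
  then obtain j where j: "j \<ge> 1" "kk j = i" by auto
  have "kk i \<ge> 1" using assms(2) less.prems by auto
  consider "j < i" | "j = i" | "i < j" by linarith
  then show ?case
  proof cases
    case 1
    then have "kk j = j" using less.IH j by simp
    then show ?thesis using 1 j by simp
  next
    case 3
    then have "kk i < i" using less_iff[of i j] j less.prems by simp
    moreover have "kk (kk i) = kk i" using less.IH[OF \<open>kk i < i\<close>] \<open>kk i \<ge> 1\<close> by simp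
    ultimately show ?thesis using less_iff[of "kk i" i] \<open>kk i \<ge> 1\<close> less.prems by simp
  qed (use j in simp)
qed

context p_trig
begin

text \<open>The derivative comes out as a negative factor times \<open>N c\<close>. Taking the phase
  instead of \<open>x\<close> as independent variable turns \<open>N\<close> into the function
  \<open>M\<close> of the pairing argument.\<close>

lemma phase_over_parameter_derivative:
  assumes Q_cont: "continuous_on UNIV Q" and Q_nonneg: "\<And>x. 0 \<le> Q x"
    and anti: "\<And>x y. x \<le> y \<Longrightarrow> Q y \<le> Q x" and Q_le: "\<And>x. Q x \<le> z powr p"
    and \<phi>0: "\<And>z. 0 < z \<Longrightarrow> \<phi> z 0 = 0"
    and \<phi>: "\<And>z x. 0 < z \<Longrightarrow>
      (\<phi> z has_real_derivative z + z powr (1 - p) * Q x * K (\<phi> z x)) (at x)"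
    and z: "0 < z" and c: "0 \<le> c"
  shows "\<exists>d. ((\<lambda>s. \<phi> s c / s) has_real_derivative d) (at z) \<and> d \<le> 0 \<and> (0 < c \<and> 0 < Q 0 \<longrightarrow> d < 0)"
proof -
  define a where "a = z powr (1 - p)"
  have a: "0 < a" "a = z * z powr (- p)" using z by (simp_all add: a_def powr_diff powr_minus_divide)
  have \<phi>_cont: "continuous_on UNIV (\<phi> z)"
    by (rule DERIV_continuous_on[OF has_field_derivative_at_within[OF \<phi>[OF z]]])
  define \<alpha> where "\<alpha> x = a * Q x * K' (\<phi> z x)" for x
  have \<alpha>_cont: "continuous_on UNIV (\<lambda>x. - \<alpha> x)"
    unfolding \<alpha>_def
    by (intro continuous_intros Q_cont continuous_on_compose2[OF continuous_on_K' \<phi>_cont]) auto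
  then obtain \<rho> where \<rho>: "\<rho> 0 = 0" "\<And>x. (\<rho> has_real_derivative - \<alpha> x) (at x)"
    using real_antiderivative by blast
  have \<rho>_cont: "continuous_on UNIV \<rho>"
    by (rule DERIV_continuous_on[OF has_field_derivative_at_within[OF \<rho>(2)]])
  have "continuous_on UNIV (\<lambda>x. exp (\<rho> x) * (a * Q x) * G (\<phi> z x))"
    unfolding G_def
    by (intro continuous_intros Q_cont \<phi>_cont \<rho>_cont continuous_K
        continuous_on_compose2[OF continuous_on_K' \<phi>_cont]) auto
  then obtain N where N: "N 0 = 0"
    "\<And>x. (N has_real_derivative exp (\<rho> x) * (a * Q x) * G (\<phi> z x)) (at x)"
    using real_antiderivative by blast
  \<comment> \<open>Variation of constants: w = z \<zeta> - \<phi>, the numerator of the derivative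
    of \<phi> / z, must satisfy w' = \<alpha> w - a Q G(\<phi>). With the integrating factor
    \<open>exp (\<rho> x)\<close> this integrates to
    \<open>- exp (- \<rho> x) * N x\<close>.\<close>
  define \<zeta> where "\<zeta> x = (\<phi> z x - exp (- \<rho> x) * N x) / z" for x
  have \<zeta>: "(\<zeta> has_real_derivative 1 + (1 - p) * z powr (- p) * Q x * K (\<phi> z x) +
        z powr (1 - p) * Q x * K' (\<phi> z x) * \<zeta> x) (at x)" for x
  proof -
    have "(\<zeta> has_real_derivative ((z + a * Q x * K (\<phi> z x)) -
        (exp (- \<rho> x) * - (- \<alpha> x) * N x + exp (\<rho> x) * (a * Q x) * G (\<phi> z x) * exp (- \<rho> x))) / z) (at x)"
      unfolding \<zeta>_def a_def
      by (intro DERIV_cdivide DERIV_diff DERIV_mult \<phi>[OF z] DERIV_chain2[OF DERIV_exp DERIV_minus[OF \<rho>(2)]]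
          N(2)[unfolded a_def])
    moreover have "exp (\<rho> x) * (a * Q x) * G (\<phi> z x) * exp (- \<rho> x) = a * Q x * G (\<phi> z x)"
      by (simp add: exp_minus)
    moreover have "((z + a * Q x * K (\<phi> z x)) - (exp (- \<rho> x) * - (- \<alpha> x) * N x + a * Q x * G (\<phi> z x))) / z
        = 1 + (1 - p) * z powr (- p) * Q x * K (\<phi> z x) + z powr (1 - p) * Q x * K' (\<phi> z x) * \<zeta> x"
      using z unfolding \<zeta>_def \<alpha>_def G_def a_def[symmetric] by (simp add: a(2) field_simps)
    ultimately show ?thesis by simp
  qed
  have "\<zeta> 0 = 0" using \<phi>0[OF z] N(1) by (simp add: \<zeta>_def)
  from phase_parameter_derivative[OF Q_cont Q_nonneg Q_le \<phi>0 \<phi> z c this \<zeta>]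
  have "((\<lambda>s. \<phi> s c) has_real_derivative \<zeta> c) (at z)" .
  then have "((\<lambda>s. \<phi> s c / s) has_real_derivative (\<zeta> c * z - \<phi> z c * 1) / (z * z)) (at z)"
    using z by (intro DERIV_divide) auto
  moreover have "\<zeta> c * z - \<phi> z c * 1 = - (exp (- \<rho> c) * N c)" using z by (simp add: \<zeta>_def)
  ultimately have main: "((\<lambda>s. \<phi> s c / s) has_real_derivative - (exp (- \<rho> c) * N c) / (z * z)) (at z)"
    by simp
  \<comment> \<open>A speed of at least \<open>z\<close> on the whole line makes the phase a
    bijection of the line, so its inverse has no boundary cases.\<close>
  have speed: "z + a * Q x * K u \<ge> z" for x u
    using a Q_nonneg[of x] K_nonneg[of u] by simp
  have mono: "\<phi> z x + z * (y - x) \<le> \<phi> z y" if "x \<le> y" for x y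
  proof -
    have "\<phi> z x - z * x \<le> \<phi> z y - z * y"
    proof (rule DERIV_nonneg_imp_nondecreasing[OF that])
      fix t
      have "((\<lambda>x. \<phi> z x - z * x) has_real_derivative (z + a * Q t * K (\<phi> z t)) - z * 1) (at t)"
        unfolding a_def by (intro DERIV_diff \<phi>[OF z] DERIV_cmult DERIV_ident)
      then show "\<exists>y. ((\<lambda>x. \<phi> z x - z * x) has_real_derivative y) (at t) \<and> 0 \<le> y"
        using speed[of t "\<phi> z t"] by (intro exI conjI) auto
    qed
    then show ?thesis by (simp add: algebra_simps)
  qed
  have smono: "\<phi> z x < \<phi> z y" if "x < y" for x y
    using mono[of x y] that z by (smt (verit) mult_pos_pos)
  have inj: "inj (\<phi> z)" by (rule linorder_injI) (use smono in force)
  have surj: "\<exists>x. \<phi> z x = u" for u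
  proof -
    have "\<phi> z (- \<bar>u\<bar> / z) \<le> - \<bar>u\<bar>" "\<bar>u\<bar> \<le> \<phi> z (\<bar>u\<bar> / z)"
      using mono[of "- \<bar>u\<bar> / z" 0] mono[of 0 "\<bar>u\<bar> / z"] \<phi>0[OF z] z by simp_all
    then have "\<exists>x\<ge>- \<bar>u\<bar> / z. x \<le> \<bar>u\<bar> / z \<and> \<phi> z x = u"
    proof (intro IVT)
      show "- \<bar>u\<bar> / z \<le> \<bar>u\<bar> / z" using z by (simp add: divide_right_mono)
      show "\<forall>x. - \<bar>u\<bar> / z \<le> x \<and> x \<le> \<bar>u\<bar> / z \<longrightarrow> isCont (\<phi> z) x"
        using \<phi>[OF z] DERIV_isCont by blast
    qed auto
    then show ?thesis by blast
  qed
  define \<xi> where "\<xi> = inv (\<phi> z)"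
  have \<phi>\<xi>: "\<phi> z (\<xi> u) = u" for u using surj[of u] by (auto simp: \<xi>_def f_inv_into_f)
  have \<xi>\<phi>: "\<xi> (\<phi> z x) = x" for x using inj by (simp add: \<xi>_def)
  have \<xi>0: "\<xi> 0 = 0" using \<xi>\<phi>[of 0] \<phi>0[OF z] by simp
  have \<xi>_mono: "\<xi> u \<le> \<xi> v" if "u \<le> v" for u v
  proof (rule ccontr)
    assume "\<not> \<xi> u \<le> \<xi> v"
    then show False using smono[of "\<xi> v" "\<xi> u"] that by (simp add: \<phi>\<xi>)
  qed
  \<comment> \<open>In these terms the speed is \<open>z * (1 + \<epsilon> u * K u)\<close>, and the
    bound on \<open>Q\<close> becomes \<open>\<epsilon> u \<le> 1\<close>.\<close>
  define \<epsilon> where "\<epsilon> u = z powr (- p) * Q (\<xi> u)" for u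
  have aQ: "a * Q (\<xi> u) = z * \<epsilon> u" for u by (simp add: \<epsilon>_def a(2))
  have DERIV_\<xi>: "(\<xi> has_real_derivative 1 / (z * (1 + \<epsilon> u * K u))) (at u)" for u
  proof -
    have "isCont \<xi> (\<phi> z (\<xi> u))"
      by (rule isCont_inverse_function[where d = 1 and f = "\<phi> z"])
        (simp_all add: \<xi>\<phi> DERIV_isCont[OF \<phi>[OF z]])
    then have cont: "isCont \<xi> u" by (simp add: \<phi>\<xi>)
    have der: "(\<phi> z has_real_derivative z * (1 + \<epsilon> u * K u)) (at (\<xi> u))"
    proof -
      have "z + a * Q (\<xi> u) * K u = z * (1 + \<epsilon> u * K u)" unfolding aQ by (simp add: algebra_simps)
      then show ?thesis using \<phi>[OF z, of "\<xi> u"] by (simp add: \<phi>\<xi> a_def)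
    qed
    have "z * (1 + \<epsilon> u * K u) \<noteq> 0"
      using speed[of "\<xi> u" u] z by (simp add: aQ algebra_simps)
    then have "(\<xi> has_real_derivative inverse (z * (1 + \<epsilon> u * K u))) (at u)"
      by (intro DERIV_inverse_function[where f = "\<phi> z" and a = "u - 1" and b = "u + 1"] der cont)
        (auto simp: \<phi>\<xi>)
    then show ?thesis by (simp add: inverse_eq_divide)
  qed
  have \<xi>_cont: "isCont \<xi> u" for u using DERIV_\<xi> DERIV_isCont by blast
  have \<epsilon>_anti: "\<epsilon> v \<le> \<epsilon> u" if "u \<le> v" for u v
    unfolding \<epsilon>_def using anti[OF \<xi>_mono[OF that]] by (intro mult_left_mono) auto
  have \<epsilon>_nonneg: "0 \<le> \<epsilon> u" for u by (simp add: \<epsilon>_def Q_nonneg)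
  have \<epsilon>_le: "\<epsilon> u \<le> 1" for u
  proof -
    have "\<epsilon> u \<le> z powr (- p) * z powr p" unfolding \<epsilon>_def by (intro mult_left_mono Q_le) auto
    then show ?thesis using z by (simp flip: powr_add)
  qed
  have DERIV_r: "((\<lambda>u. \<rho> (\<xi> u)) has_real_derivative - \<epsilon> u * K' u / (1 + \<epsilon> u * K u)) (at u)" for u
  proof -
    have "((\<lambda>u. \<rho> (\<xi> u)) has_real_derivative - \<alpha> (\<xi> u) * (1 / (z * (1 + \<epsilon> u * K u)))) (at u)"
      by (rule DERIV_chain2[OF \<rho>(2) DERIV_\<xi>])
    then show ?thesis using z by (simp add: \<alpha>_def \<phi>\<xi> aQ)
  qed
  have DERIV_M: "((\<lambda>u. N (\<xi> u)) has_real_derivative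
      exp (\<rho> (\<xi> u)) * \<epsilon> u / (1 + \<epsilon> u * K u) * G u) (at u)" for u
  proof -
    have "((\<lambda>u. N (\<xi> u)) has_real_derivative
        exp (\<rho> (\<xi> u)) * (a * Q (\<xi> u)) * G (\<phi> z (\<xi> u)) * (1 / (z * (1 + \<epsilon> u * K u)))) (at u)"
      by (rule DERIV_chain2[OF N(2) DERIV_\<xi>])
    then show ?thesis using z by (simp add: \<phi>\<xi> aQ mult.assoc)
  qed
  have M0: "N (\<xi> 0) = 0" by (simp add: \<xi>0 N)
  have "0 \<le> \<phi> z c" using mono[OF c] \<phi>0[OF z] z c by (smt (verit) mult_nonneg_nonneg)
  from M_nonneg[where \<epsilon> = \<epsilon> and r = "\<lambda>u. \<rho> (\<xi> u)" and M = "\<lambda>u. N (\<xi> u)",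
      OF \<epsilon>_anti \<epsilon>_nonneg \<epsilon>_le DERIV_r DERIV_M M0 this]
  have N_nonneg: "0 \<le> N c" by (simp add: \<xi>\<phi>)
  have N_pos: "0 < N c" if "0 < c" "0 < Q 0"
  proof -
    have "0 < \<phi> z c" using smono[OF that(1)] \<phi>0[OF z] by simp
    moreover have "isCont \<epsilon> 0"
    proof -
      have "isCont Q (\<xi> 0)" using Q_cont by (simp add: continuous_on_eq_continuous_at)
      from isCont_o2[OF \<xi>_cont this] show ?thesis
        unfolding \<epsilon>_def[abs_def] by (intro continuous_intros)
    qed
    moreover have "0 < \<epsilon> 0" using that(2) z by (simp add: \<epsilon>_def \<xi>0)
    ultimately have "0 < N (\<xi> (\<phi> z c))"
      using M_pos[where \<epsilon> = \<epsilon> and r = "\<lambda>u. \<rho> (\<xi> u)" and M = "\<lambda>u. N (\<xi> u)",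
        OF \<epsilon>_anti \<epsilon>_nonneg \<epsilon>_le DERIV_r DERIV_M M0] by blast
    then show ?thesis by (simp add: \<xi>\<phi>)
  qed
  show ?thesis
    using main N_nonneg N_pos z
    by (intro exI[of _ "- (exp (- \<rho> c) * N c) / (z * z)"]) (auto simp: divide_nonpos_pos divide_neg_pos)
qed

lemma phase_over_parameter_decreasing:
  assumes Q_cont: "continuous_on UNIV Q" and Q_nonneg: "\<And>x. 0 \<le> Q x"
    and anti: "\<And>x y. x \<le> y \<Longrightarrow> Q y \<le> Q x" and Q_le: "\<And>x. Q x \<le> z1 powr p"
    and \<phi>0: "\<And>z. 0 < z \<Longrightarrow> \<phi> z 0 = 0"
    and \<phi>: "\<And>z x. 0 < z \<Longrightarrow>
      (\<phi> z has_real_derivative z + z powr (1 - p) * Q x * K (\<phi> z x)) (at x)"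
    and z: "0 < z1" "z1 < z2" and c: "0 \<le> c"
  shows "\<phi> z2 c / z2 \<le> \<phi> z1 c / z1"
    and "0 < c \<Longrightarrow> 0 < Q 0 \<Longrightarrow> \<phi> z2 c / z2 < \<phi> z1 c / z1"
proof -
  have D: "\<exists>d. ((\<lambda>s. \<phi> s c / s) has_real_derivative d) (at t) \<and> d \<le> 0 \<and> (0 < c \<and> 0 < Q 0 \<longrightarrow> d < 0)"
    if "z1 \<le> t" for t
  proof (rule phase_over_parameter_derivative[OF Q_cont Q_nonneg anti _ \<phi>0 \<phi> _ c])
    show "0 < t" using that z by simp
    have "z1 powr p \<le> t powr p" using that z p_gt_1 by (intro powr_mono2) auto
    then show "Q x \<le> t powr p" for x using Q_le[of x] by linarith
  qed
  show "\<phi> z2 c / z2 \<le> \<phi> z1 c / z1"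
    by (rule DERIV_nonpos_imp_nonincreasing[where f = "\<lambda>s. \<phi> s c / s"]) (use z D in auto)
  assume "0 < c" "0 < Q 0"
  then show "\<phi> z2 c / z2 < \<phi> z1 c / z1"
    by (intro DERIV_neg_imp_decreasing[where f = "\<lambda>s. \<phi> s c / s"]) (use z D in auto)
qed

text \<open>The difference of the phases is driven by \<open>(l2 - l1) * K (\<phi> x)\<close>, which
  is nonnegative, and positive just after 0, where \<phi> lies strictly between 0 and
  \<open>P\<close>. The weight \<open>exp (L * x)\<close> absorbs the Lipschitz term, so the early
  gain persists.\<close>

lemma unscaled_phase_strict_mono:
  assumes \<phi>: "phase_on 1 1 (\<lambda>x. l1 - q x) \<phi>" and \<psi>: "phase_on 1 1 (\<lambda>x. l2 - q x) \<psi>"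
    and q: "\<And>x. x \<in> {0..1} \<Longrightarrow> \<bar>q x\<bar> \<le> B" and less: "l1 < l2"
  shows "\<phi> 1 < \<psi> 1"
proof -
  define L where "L = (\<bar>l2\<bar> + B + 1) * p"
  define f' where "f' x = (1 * (1 - K (\<psi> x)) + (l2 - q x) * K (\<psi> x)) -
      (1 * (1 - K (\<phi> x)) + (l1 - q x) * K (\<phi> x))" for x
  have der: "((\<lambda>x. \<psi> x - \<phi> x) has_real_derivative f' x) (at x)" if "x \<in> {0..1}" for x
    unfolding f'_def using \<phi> \<psi> that by (intro DERIV_diff) (auto simp: phase_on_def)
  have ge: "f' x \<ge> (l2 - l1) * K (\<phi> x) - L * \<bar>\<psi> x - \<phi> x\<bar>" if "x \<in> {0..1}" for x
  proof -
    have "f' x = (l2 - q x - 1) * (K (\<psi> x) - K (\<phi> x)) + (l2 - l1) * K (\<phi> x)"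
      by (simp add: f'_def algebra_simps)
    moreover have "\<bar>(l2 - q x - 1) * (K (\<psi> x) - K (\<phi> x))\<bar> \<le> (\<bar>l2\<bar> + B + 1) * (p * \<bar>\<psi> x - \<phi> x\<bar>)"
      unfolding abs_mult using q[OF that] K_lipschitz by (intro mult_mono) auto
    ultimately show ?thesis by (simp add: L_def abs_le_iff mult.assoc)
  qed
  have init: "\<phi> 0 = 0" "\<psi> 0 = 0" using \<phi> \<psi> by (simp_all add: phase_on_def)
  have nonneg: "0 \<le> \<psi> x - \<phi> x" if x: "x \<in> {0..1}" for x
  proof (rule gronwall_nonneg[where f = "\<lambda>x. \<psi> x - \<phi> x" and f' = f' and L = L])
    fix t assume "0 \<le> t" "t \<le> x"
    then have t: "t \<in> {0..1}" using x by auto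
    show "((\<lambda>x. \<psi> x - \<phi> x) has_real_derivative f' t) (at t)" by (rule der[OF t])
    show "- L * \<bar>\<psi> t - \<phi> t\<bar> \<le> f' t"
      using ge[OF t] less K_nonneg[of "\<phi> t"] by (smt (verit) mult_nonneg_nonneg mult_minus_left)
  qed (use x init in auto)
  define E where "E x = (\<psi> x - \<phi> x) * exp (L * x)" for x
  define E' where "E' x = (f' x + L * (\<psi> x - \<phi> x)) * exp (L * x)" for x
  have DERIV_E: "(E has_real_derivative E' x) (at x)" if "x \<in> {0..1}" for x
    unfolding E_def E'_def
    by (rule derivative_eq_intros der[OF that] refl)+ (simp add: algebra_simps)
  have E'_ge: "E' x \<ge> (l2 - l1) * K (\<phi> x) * exp (L * x)" if "x \<in> {0..1}" for x
    unfolding E'_def using ge[OF that] nonneg[OF that] by (intro mult_right_mono) auto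
  have "isCont \<phi> 0" using \<phi> DERIV_isCont by (fastforce simp: phase_on_def)
  then have "\<forall>\<^sub>F x in at 0. \<phi> x < P"
    using init P_pos by (simp add: isCont_def order_tendstoD(2))
  then obtain d where d: "d > 0" "\<And>x. x \<noteq> 0 \<Longrightarrow> \<bar>x\<bar> < d \<Longrightarrow> \<phi> x < P"
    unfolding eventually_at by (auto simp: dist_real_def)
  define v where "v = min d 1"
  have v: "0 < v" "v \<le> 1" "v \<le> d" using d by (auto simp: v_def)
  have "E 0 < E v"
  proof (rule DERIV_pos_imp_increasing_open[OF v(1)])
    fix x assume x: "0 < x" "x < v"
    have "0 < \<phi> x"
    proof (rule phase_pos[where \<phi> = \<phi>])
      show "phase_on x 1 (\<lambda>x. l1 - q x) \<phi>" using \<phi> x v by (auto simp: phase_on_def)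
      show "\<bar>l1 - q t\<bar> \<le> \<bar>l1\<bar> + B" if "t \<in> {0..x}" for t
      proof -
        have "\<bar>q t\<bar> \<le> B" using q[of t] that x v by auto
        then show ?thesis by linarith
      qed
    qed (use x in auto)
    then have "0 < K (\<phi> x)" using K_pos d x v by simp
    then have "0 < (l2 - l1) * K (\<phi> x) * exp (L * x)" using less by simp
    then have "0 < E' x" using E'_ge[of x] x v by simp
    then show "\<exists>y. (E has_real_derivative y) (at x) \<and> 0 < y" using DERIV_E[of x] x v by auto
  next
    show "continuous_on {0..v} E"
      by (rule DERIV_continuous_on[OF has_field_derivative_at_within[OF DERIV_E]]) (use v in auto)
  qed
  also have "E v \<le> E 1"
  proof (rule DERIV_nonneg_imp_nondecreasing[OF v(2)])
    fix x assume "v \<le> x" "x \<le> 1"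
    then have x: "x \<in> {0..1}" using v by auto
    have "0 \<le> (l2 - l1) * K (\<phi> x) * exp (L * x)" using less K_nonneg[of "\<phi> x"] by simp
    then have "0 \<le> E' x" using E'_ge[OF x] by simp
    then show "\<exists>y. (E has_real_derivative y) (at x) \<and> 0 \<le> y" using DERIV_E[OF x] by blast
  qed
  finally show ?thesis by (simp add: E_def init zero_less_mult_iff)
qed

text \<open>The angle \<open>P / 2\<close> cannot be crossed: there \<open>K\<close> is 1 and the
  speed reduces to the coefficient \<open>b\<close>.\<close>

lemma phase_below_quarter:
  assumes \<phi>: "phase_on 1 1 b \<phi>" and b: "\<And>x. x \<in> {0..1} \<Longrightarrow> b x \<le> 0"
  shows "\<phi> 1 \<le> P / 2"
proof -
  have "D (P / 2) = 0" using D_shift[of "- (P / 2)"] D_minus[of "P / 2"] by simp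
  then have half: "K (P / 2) = 1" using D_powr_eq[of "P / 2"] by simp
  have "0 \<le> P / 2 - \<phi> 1"
  proof (rule gronwall_nonneg[where f = "\<lambda>x. P / 2 - \<phi> x" and L = p])
    show "0 \<le> P / 2 - \<phi> 0" using \<phi> P_pos by (simp add: phase_on_def)
    fix x :: real assume "0 \<le> x" "x \<le> 1"
    then have x: "x \<in> {0..1}" by simp
    show "((\<lambda>x. P / 2 - \<phi> x) has_real_derivative 0 - (1 * (1 - K (\<phi> x)) + b x * K (\<phi> x))) (at x)"
      using \<phi> x by (intro DERIV_diff DERIV_const) (auto simp: phase_on_def)
    have "b x * K (\<phi> x) \<le> 0" using b[OF x] K_nonneg by (simp add: mult_nonpos_nonneg)
    moreover have "1 - K (\<phi> x) \<le> p * \<bar>P / 2 - \<phi> x\<bar>"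
      using K_lipschitz[of "P / 2" "\<phi> x"] by (simp add: half abs_le_iff)
    ultimately show "- p * \<bar>P / 2 - \<phi> x\<bar> \<le> 0 - (1 * (1 - K (\<phi> x)) + b x * K (\<phi> x))" by simp
  qed simp
  then show ?thesis by simp
qed

text \<open>Otherwise the phase would end at or below \<open>P / 2\<close>, whereas at an eigenvalue
  it ends at a positive multiple of \<open>P\<close>. This serves to show that the eigenvalues in
  the ratio are positive.\<close>

lemma eigenvalue_exceeds:
  assumes "dirichlet_eigenvalue p q \<mu>" "continuous_on {0..1} q"
  shows "\<exists>x\<in>{0..1}. q x < \<mu>"
proof (rule ccontr)
  assume "\<not> ?thesis"
  then have le: "\<And>x. x \<in> {0..1} \<Longrightarrow> \<mu> - q x \<le> 0" by force
  define qc where "qc x = q (max 0 (min 1 x))" for x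
  have qc: "continuous_on UNIV qc" unfolding qc_def by (rule continuous_clamp[OF assms(2)]) simp
  obtain B where B: "\<And>x. x \<in> {0..1} \<Longrightarrow> \<bar>q x\<bar> \<le> B" using bounded_on_unit_interval[OF assms(2)] by blast
  have "\<bar>\<mu> - qc x\<bar> \<le> \<bar>\<mu>\<bar> + B" for x
    using B[of "max 0 (min 1 x)"] by (simp add: qc_def)
  moreover have "continuous_on UNIV (\<lambda>x. \<mu> - qc x)" by (intro continuous_intros qc)
  ultimately obtain \<phi> where \<phi>: "\<phi> 0 = 0"
    "\<And>x. (\<phi> has_real_derivative 1 * (1 - K (\<phi> x)) + (\<mu> - qc x) * K (\<phi> x)) (at x)"
    using phase_exists[of "\<lambda>x. \<mu> - qc x" "\<bar>\<mu>\<bar> + B" 1] by blast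
  have ph: "phase_on 1 1 (\<lambda>x. \<mu> - qc x) \<phi>" using \<phi> by (simp add: phase_on_def)
  have "\<phi> 1 \<le> P / 2" by (rule phase_below_quarter[OF ph]) (use le in \<open>simp add: qc_def\<close>)
  moreover have "0 < \<phi> 1"
    by (rule phase_pos[OF ph, where B = "\<bar>\<mu>\<bar> + B"]) (use \<open>\<And>x. \<bar>\<mu> - qc x\<bar> \<le> \<bar>\<mu>\<bar> + B\<close> in auto)
  moreover obtain k where k: "\<phi> 1 = real k * P"
    using eigenvalue_phase[OF assms _ ph] by (auto simp: qc_def)
  ultimately have "k \<ge> 1" by (cases k) auto
  then have "1 * P \<le> real k * P" using P_pos by (intro mult_right_mono) auto
  then show False using \<open>\<phi> 1 \<le> P / 2\<close> k P_pos by simp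
qed

text \<open>At scale 1 the final phase is continuous and strictly increasing in \<mu>, so
  eigenvalues are ordered by their multiples of \<open>P\<close>. By the intermediate value theorem
  no multiple is skipped, which fixes the index.\<close>

lemma unscaled_phase_index:
  assumes q: "continuous_on {0..1} q"
    and lam: "strict_mono_on {1..} lam" "lam ` {1..} = {\<mu>. dirichlet_eigenvalue p q \<mu>}"
    and k: "k \<ge> (1::nat)" and \<phi>: "phase_on 1 1 (\<lambda>x. lam k - q x) \<phi>"
  shows "\<phi> 1 = real k * P"
proof -
  define qc where "qc x = q (max 0 (min 1 x))" for x
  have qc: "continuous_on UNIV qc" unfolding qc_def by (rule continuous_clamp[OF q]) simp
  have qc_eq: "qc x = q x" if "x \<in> {0..1}" for x using that by (simp add: qc_def)
  obtain B where B: "\<And>x. x \<in> {0..1} \<Longrightarrow> \<bar>q x\<bar> \<le> B" using bounded_on_unit_interval[OF q] by blast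
  have qcB: "\<bar>qc x\<bar> \<le> B" for x using B[of "max 0 (min 1 x)"] by (simp add: qc_def)
  have bd: "\<bar>\<mu> - qc x\<bar> \<le> \<bar>\<mu>\<bar> + B" for \<mu> x using qcB[of x] by linarith
  have "\<exists>\<phi>. \<phi> 0 = 0 \<and> (\<forall>x. (\<phi> has_real_derivative 1 * (1 - K (\<phi> x)) + (\<mu> - qc x) * K (\<phi> x)) (at x))" for \<mu>
    by (rule phase_exists[where B = "\<bar>\<mu>\<bar> + B"]) (intro continuous_intros qc bd)+
  then obtain \<Phi> where \<Phi>: "\<And>\<mu>. \<Phi> \<mu> 0 = 0"
    "\<And>\<mu> x. (\<Phi> \<mu> has_real_derivative 1 * (1 - K (\<Phi> \<mu> x)) + (\<mu> - qc x) * K (\<Phi> \<mu> x)) (at x)"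
    by metis
  have ph: "phase_on 1 1 (\<lambda>x. \<mu> - qc x) (\<Phi> \<mu>)" for \<mu> using \<Phi> by (simp add: phase_on_def)
  have pos: "0 < \<Phi> \<mu> 1" for \<mu> by (rule phase_pos[OF ph _ _ bd]) auto
  have mono: "\<Phi> l1 1 < \<Phi> l2 1" if "l1 < l2" for l1 l2
    by (rule unscaled_phase_strict_mono[OF ph ph qcB that])
  have eig: "dirichlet_eigenvalue p q \<mu> \<longleftrightarrow> (\<exists>k\<ge>1. \<Phi> \<mu> 1 = real k * P)" for \<mu>
  proof
    assume "dirichlet_eigenvalue p q \<mu>"
    then obtain k where k: "\<Phi> \<mu> 1 = real k * P"
      using eigenvalue_phase[OF _ q _ ph] by (auto simp: qc_eq)
    then have "k \<ge> 1" using pos[of \<mu>] P_pos by (cases k) auto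
    with k show "\<exists>k\<ge>1. \<Phi> \<mu> 1 = real k * P" by blast
  next
    assume "\<exists>k\<ge>1. \<Phi> \<mu> 1 = real k * P"
    then show "dirichlet_eigenvalue p q \<mu>"
      using phase_eigenvalue[OF q, of "\<Phi> \<mu>" \<mu> qc] \<Phi> qc qc_eq K_zero_mult by auto
  qed
  have cont: "isCont (\<lambda>\<mu>. \<Phi> \<mu> 1) \<mu>" for \<mu>
  proof (rule isCont_if_dominated[OF always_eventually])
    show "\<forall>\<nu>. \<bar>\<Phi> \<nu> 1 - \<Phi> \<mu> 1\<bar> \<le> \<bar>\<mu> - \<nu>\<bar> * 1 * exp ((\<bar>1\<bar> + (\<bar>\<mu>\<bar> + B)) * p * 1)"
    proof
      fix \<nu>
      have "\<bar>\<Phi> \<mu> 1 - \<Phi> \<nu> 1\<bar> \<le> \<bar>\<mu> - \<nu>\<bar> * 1 * exp ((\<bar>1\<bar> + (\<bar>\<mu>\<bar> + B)) * p * 1)"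
        by (rule phase_distance[OF ph ph bd]) auto
      then show "\<bar>\<Phi> \<nu> 1 - \<Phi> \<mu> 1\<bar> \<le> \<bar>\<mu> - \<nu>\<bar> * 1 * exp ((\<bar>1\<bar> + (\<bar>\<mu>\<bar> + B)) * p * 1)"
        by (simp add: abs_minus_commute)
    qed
    show "((\<lambda>\<nu>. \<bar>\<mu> - \<nu>\<bar> * 1 * exp ((\<bar>1\<bar> + (\<bar>\<mu>\<bar> + B)) * p * 1)) \<longlongrightarrow> 0) (at \<mu>)"
      by (auto intro!: tendsto_eq_intros)
  qed
  have "\<exists>j\<ge>1. \<Phi> (lam i) 1 = real j * P" if "i \<ge> 1" for i
    using that lam(2) eig by blast
  then obtain kk where kk: "\<And>i. i \<ge> 1 \<Longrightarrow> kk i \<ge> 1 \<and> \<Phi> (lam i) 1 = real (kk i) * P"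
    by metis
  have kk_mono: "strict_mono_on {1..} kk"
  proof (rule strict_mono_onI)
    fix i j :: nat assume ij: "i \<in> {1..}" "j \<in> {1..}" "i < j"
    then have "lam i < lam j" using lam(1) by (simp add: strict_mono_onD)
    from mono[OF this] show "kk i < kk j" using kk ij P_pos by simp
  qed
  \<comment> \<open>This supplies the upper end of the bracket for the intermediate value theorem
    below.\<close>
  have kk_ge: "i \<ge> 1 \<Longrightarrow> kk i \<ge> i" for i
  proof (induction i)
    case (Suc i)
    show ?case
    proof (cases "i = 0")
      case True then show ?thesis using kk[of 1] by simp
    next
      case False
      then have "kk i < kk (Suc i)" using strict_mono_onD[OF kk_mono, of i "Suc i"] by simp
      then show ?thesis using Suc False by simp
    qed
  qed simp
  have "kk ` {1..} = {1..}"
  proof (intro equalityI subsetI)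
    fix j :: nat assume "j \<in> {1..}"
    then have j: "j \<ge> 1" by simp
    \<comment> \<open>\<open>- B\<close> exceeds no value of \<open>q\<close>, so the phase at
      \<open>low\<close> ends at or below \<open>P / 2\<close>; the minimum with
      \<open>lam j\<close> orders the bracket.\<close>
    define low where "low = min (- B) (lam j)"
    have "\<Phi> low 1 \<le> P / 2"
    proof (rule phase_below_quarter[OF ph])
      show "low - qc x \<le> 0" for x using qcB[of x] by (simp add: low_def abs_le_iff min_def)
    qed
    also have "\<dots> \<le> real j * P" using j P_pos by (simp add: field_simps)
    finally have 1: "\<Phi> low 1 \<le> real j * P" .
    have 2: "real j * P \<le> \<Phi> (lam j) 1" using kk[OF j] kk_ge[OF j] P_pos by simp
    have "\<exists>\<mu>\<ge>low. \<mu> \<le> lam j \<and> \<Phi> \<mu> 1 = real j * P"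
      by (rule IVT[of "\<lambda>\<mu>. \<Phi> \<mu> 1", OF 1 2]) (use cont in \<open>auto simp: low_def\<close>)
    then obtain \<mu> where \<mu>: "\<Phi> \<mu> 1 = real j * P" by blast
    then have "dirichlet_eigenvalue p q \<mu>" using eig j by blast
    then obtain i where "i \<in> {1..}" "lam i = \<mu>" using lam(2) by (metis (mono_tags) imageE mem_Collect_eq)
    then have "kk i = j" using kk[of i] \<mu> P_pos by simp
    then show "j \<in> kk ` {1..}" using \<open>i \<in> {1..}\<close> by blast
  qed (use kk in auto)
  from strict_mono_surj_index[OF kk_mono this k] have "kk k = k" .
  moreover have "\<phi> 1 = \<Phi> (lam k) 1"
    by (rule phase_unique[OF \<phi> ph, where B = "\<bar>lam k\<bar> + B"]) (use bd qc_eq in \<open>auto, metis\<close>)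
  ultimately show ?thesis using kk[OF k] by simp
qed

text \<open>Rescaling the phase does not move the multiples of \<open>P\<close>: at an eigenvalue the final phase
  depends continuously on the scale and takes values in \<open>P\<nat>\<close>.\<close>

lemma scaled_phase_index:
  assumes q: "continuous_on {0..1} q"
    and lam: "strict_mono_on {1..} lam" "lam ` {1..} = {\<mu>. dirichlet_eigenvalue p q \<mu>}"
    and k: "k \<ge> (1::nat)" and a: "0 < a" and \<phi>: "phase_on 1 a (\<lambda>x. a powr (1 - p) * (lam k - q x)) \<phi>"
  shows "\<phi> 1 = real k * P"
proof -
  define qc where "qc x = lam k - q (max 0 (min 1 x))" for x
  have "continuous_on UNIV (\<lambda>x. q (max 0 (min 1 x)))" by (rule continuous_clamp[OF q]) simp
  then have qc: "continuous_on UNIV qc" unfolding qc_def by (intro continuous_intros)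
  have qc_eq: "qc x = lam k - q x" if "x \<in> {0..1}" for x using that by (simp add: qc_def)
  obtain B' where "\<And>x. x \<in> {0..1} \<Longrightarrow> \<bar>q x\<bar> \<le> B'" using bounded_on_unit_interval[OF q] by blast
  then have B': "\<bar>q (max 0 (min 1 x))\<bar> \<le> B'" for x by simp
  define B where "B = \<bar>lam k\<bar> + B'"
  have B: "\<bar>qc x\<bar> \<le> B" for x using B'[of x] by (simp add: qc_def B_def)
  have bd: "\<bar>s powr (1 - p) * qc x\<bar> \<le> s powr (1 - p) * B" for s x
    using B[of x] by (simp add: abs_mult mult_left_mono)
  have "\<exists>\<phi>. \<phi> 0 = 0 \<and> (\<forall>x. (\<phi> has_real_derivative s * (1 - K (\<phi> x)) + s powr (1 - p) * qc x * K (\<phi> x)) (at x))" for s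
    by (rule phase_exists[where B = "s powr (1 - p) * B"]) (intro continuous_intros qc bd)+
  then obtain \<Phi> where "\<And>s. \<Phi> s 0 = 0"
    "\<And>s x. (\<Phi> s has_real_derivative s * (1 - K (\<Phi> s x)) + s powr (1 - p) * qc x * K (\<Phi> s x)) (at x)"
    by metis
  then have ph: "phase_on 1 s (\<lambda>x. s powr (1 - p) * qc x) (\<Phi> s)" for s by (simp add: phase_on_def)
  have ev: "dirichlet_eigenvalue p q (lam k)" using lam(2) k by auto
  have mult: "\<exists>j. \<Phi> s 1 = real j * P" if "0 < s" for s
    by (rule eigenvalue_phase[OF ev q that ph]) (simp add: qc_eq)
  have cont: "isCont (\<lambda>s. \<Phi> s 1) s" if s: "0 < s" for s
  proof (rule isCont_if_dominated[OF always_eventually])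
    define h where "h t = (\<bar>s - t\<bar> + \<bar>s powr (1 - p) - t powr (1 - p)\<bar> * B) * 1 *
        exp ((\<bar>s\<bar> + s powr (1 - p) * B) * p * 1)" for t
    have "0 \<le> B" using B[of 0] by linarith
    show "\<forall>t. \<bar>\<Phi> t 1 - \<Phi> s 1\<bar> \<le> h t"
    proof
      fix t
      have "\<bar>\<Phi> s 1 - \<Phi> t 1\<bar> \<le> h t"
        unfolding h_def
      proof (rule phase_distance[OF ph ph bd])
        fix x
        have "\<bar>s powr (1 - p) * qc x - t powr (1 - p) * qc x\<bar> = \<bar>s powr (1 - p) - t powr (1 - p)\<bar> * \<bar>qc x\<bar>"
          by (simp flip: abs_mult left_diff_distrib)
        also have "\<dots> \<le> \<bar>s powr (1 - p) - t powr (1 - p)\<bar> * B" by (intro mult_left_mono B) auto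
        finally show "\<bar>s powr (1 - p) * qc x - t powr (1 - p) * qc x\<bar>
            \<le> \<bar>s - t\<bar> + \<bar>s powr (1 - p) - t powr (1 - p)\<bar> * B" by simp
      qed (use \<open>0 \<le> B\<close> in auto)
      then show "\<bar>\<Phi> t 1 - \<Phi> s 1\<bar> \<le> h t" by (simp add: abs_minus_commute)
    qed
    show "(h \<longlongrightarrow> 0) (at s)"
      unfolding h_def using s by (auto intro!: tendsto_eq_intros)
  qed
  have "(\<lambda>s. \<Phi> s 1) constant_on {0<..}"
  proof (rule continuous_discrete_range_constant)
    show "connected {0::real<..}" by simp
    show "continuous_on {0<..} (\<lambda>s. \<Phi> s 1)"
      using cont by (auto intro!: continuous_at_imp_continuous_on)
    fix s :: real assume s: "s \<in> {0<..}"
    have "P \<le> norm (\<Phi> t 1 - \<Phi> s 1)" if t: "t \<in> {0<..}" "\<Phi> t 1 \<noteq> \<Phi> s 1" for t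
    proof -
      obtain i j where ij: "\<Phi> s 1 = real i * P" "\<Phi> t 1 = real j * P" using mult s t by (metis greaterThan_iff)
      then have "i \<noteq> j" using t by auto
      then have "1 * P \<le> \<bar>real j - real i\<bar> * P" using P_pos by (intro mult_right_mono) auto
      then show ?thesis using P_pos by (simp add: ij abs_mult flip: left_diff_distrib)
    qed
    then show "\<exists>e>0. \<forall>t. t \<in> {0<..} \<and> \<Phi> t 1 \<noteq> \<Phi> s 1 \<longrightarrow> e \<le> norm (\<Phi> t 1 - \<Phi> s 1)"
      using P_pos by blast
  qed
  then have "\<Phi> a 1 = \<Phi> 1 1" using a unfolding constant_on_def by (metis greaterThan_iff zero_less_one)
  moreover have "\<Phi> 1 1 = real k * P"
  proof -
    have "phase_on 1 1 (\<lambda>x. lam k - q x) (\<Phi> 1)"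
      using ph[of 1] qc_eq by (simp add: phase_on_def)
    from unscaled_phase_index[OF q lam k this] show ?thesis .
  qed
  moreover have "\<phi> 1 = \<Phi> a 1"
    by (rule phase_unique[OF \<phi> ph, where B = "a powr (1 - p) * B"]) (use bd[of a] qc_eq in \<open>auto, metis\<close>)
  ultimately show ?thesis by simp
qed

end

section \<open>Gluing at the barrier\<close>

lemma antimono_clamped_left:
  fixes q :: "real \<Rightarrow> real"
  assumes "mono_on {0..c} q" "0 \<le> c" "x \<le> y"
  shows "- q (max 0 (min c y)) \<le> - q (max 0 (min c x))"
  using mono_onD[OF assms(1), of "max 0 (min c x)" "max 0 (min c y)"] assms(2,3) by auto

lemma antimono_clamped_right:
  fixes q :: "real \<Rightarrow> real"
  assumes "antimono_on {c..1} q" "c \<le> 1" "x \<le> y"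
  shows "- q (1 - max 0 (min (1 - c) y)) \<le> - q (1 - max 0 (min (1 - c) x))"
proof -
  have "q (1 - max 0 (min (1 - c) x)) \<le> q (1 - max 0 (min (1 - c) y))"
    by (rule monotone_onD[OF assms(1)]) (use assms(2,3) in auto)
  then show ?thesis by simp
qed

lemma Inf_pair: "Inf {a, b} = min a (b::real)"
  by (simp add: cInf_eq_Min)

context p_trig
begin

lemma phase_family_exists:
  assumes "continuous_on UNIV Q" "\<And>x. 0 \<le> Q x" "\<And>x. Q x \<le> B"
  obtains \<phi> where "\<And>z. \<phi> z 0 = 0"
    "\<And>z x. (\<phi> z has_real_derivative z + z powr (1 - p) * Q x * K (\<phi> z x)) (at x)"
proof -
  have bd: "\<bar>z + z powr (1 - p) * Q x\<bar> \<le> \<bar>z\<bar> + z powr (1 - p) * B" for z x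
  proof -
    have "\<bar>z + z powr (1 - p) * Q x\<bar> \<le> \<bar>z\<bar> + \<bar>z powr (1 - p) * Q x\<bar>" by (rule abs_triangle_ineq)
    also have "\<bar>z powr (1 - p) * Q x\<bar> \<le> z powr (1 - p) * B"
      using assms(2,3)[of x] by (simp add: abs_mult mult_left_mono)
    finally show ?thesis by simp
  qed
  have "\<exists>\<phi>. \<phi> 0 = 0 \<and> (\<forall>x. (\<phi> has_real_derivative
      z * (1 - K (\<phi> x)) + (z + z powr (1 - p) * Q x) * K (\<phi> x)) (at x))" for z
    by (rule phase_exists[where B = "\<bar>z\<bar> + z powr (1 - p) * B"]) (intro continuous_intros assms(1) bd)+
  then obtain \<phi> where "\<And>z. \<phi> z 0 = 0" "\<And>z x. (\<phi> z has_real_derivative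
      z * (1 - K (\<phi> z x)) + (z + z powr (1 - p) * Q x) * K (\<phi> z x)) (at x)"
    by metis
  moreover have "z * (1 - K u) + (z + z powr (1 - p) * Q x) * K u = z + z powr (1 - p) * Q x * K u"
    for z x u by (simp add: algebra_simps)
  ultimately show ?thesis using that[of \<phi>] by simp
qed

text \<open>On the right part the full phase is read backwards from 1. Since \<open>K\<close> is
  even and \<open>P\<close>-periodic, \<open>real k * P - \<Phi> (1 - x)\<close> obeys a phase
  equation again, and it starts at 0 because \<Phi> ends at \<open>real k * P\<close>.\<close>

lemma phases_meet:
  assumes q: "continuous_on {0..1} q" and q_le: "\<And>x. x \<in> {0..1} \<Longrightarrow> q x \<le> 0"
    and lam: "strict_mono_on {1..} lam" "lam ` {1..} = {\<mu>. dirichlet_eigenvalue p q \<mu>}"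
    and k: "k \<ge> (1::nat)" and z: "0 < z" "z powr p = lam k" and x0: "x0 \<in> {0..1}"
    and \<phi>: "phase_on x0 z (\<lambda>x. z + z powr (1 - p) * QL x) \<phi>"
    and \<psi>: "phase_on (1 - x0) z (\<lambda>x. z + z powr (1 - p) * QR x) \<psi>"
    and QL: "\<And>x. x \<in> {0..x0} \<Longrightarrow> QL x = - q x"
    and QR: "\<And>x. x \<in> {0..1 - x0} \<Longrightarrow> QR x = - q (1 - x)"
  shows "\<phi> x0 + \<psi> (1 - x0) = real k * P"
proof -
  define Q where "Q x = - q (max 0 (min 1 x))" for x
  have Q_cont: "continuous_on UNIV Q"
    unfolding Q_def by (intro continuous_on_minus continuous_clamp q) simp
  have Q_nonneg: "0 \<le> Q x" for x using q_le[of "max 0 (min 1 x)"] by (simp add: Q_def)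
  obtain B' where "\<And>x. x \<in> {0..1} \<Longrightarrow> \<bar>q x\<bar> \<le> B'" using bounded_on_unit_interval[OF q] by blast
  then have "\<bar>Q x\<bar> \<le> B'" for x by (simp add: Q_def)
  then have Q_le: "Q x \<le> B'" for x using abs_le_D1 by blast
  obtain \<Phi> where \<Phi>: "\<Phi> 0 = 0"
      "\<And>x. (\<Phi> has_real_derivative z + z powr (1 - p) * Q x * K (\<Phi> x)) (at x)"
    using phase_family_exists[OF Q_cont Q_nonneg Q_le] by metis
  define b where "b x = z + z powr (1 - p) * Q x" for x
  have \<Phi>': "(\<Phi> has_real_derivative z * (1 - K (\<Phi> x)) + b x * K (\<Phi> x)) (at x)" for x
    using \<Phi>(2)[of x] by (simp add: b_def algebra_simps)
  have bB: "\<bar>b x\<bar> \<le> z + z powr (1 - p) * B'" for x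
    using z Q_nonneg[of x] Q_le[of x] by (simp add: b_def mult_left_mono)
  have ph: "phase_on c z b \<Phi>" for c using \<Phi>(1) \<Phi>' by (simp add: phase_on_def)
  \<comment> \<open>Because \<open>lam k\<close> is \<open>z powr p\<close>, the coefficient of the
    scaled phase splits into \<open>z\<close> and a multiple of \<open>- q x\<close>.\<close>
  have "z powr (1 - p) * lam k = z" using z by (simp flip: z(2) powr_add)
  then have "phase_on 1 z (\<lambda>x. z powr (1 - p) * (lam k - q x)) \<Phi>"
    using ph[of 1] by (simp add: phase_on_def b_def Q_def right_diff_distrib)
  from scaled_phase_index[OF q lam k z(1) this] have end1: "\<Phi> 1 = real k * P" .
  have "\<Phi> x0 = \<phi> x0"
    by (rule phase_unique[OF ph \<phi> bB]) (use x0 QL in \<open>auto simp: b_def Q_def\<close>)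
  moreover have "real k * P - \<Phi> (1 - (1 - x0)) = \<psi> (1 - x0)"
  proof (rule phase_unique[where \<phi> = "\<lambda>x. real k * P - \<Phi> (1 - x)" and b = "\<lambda>x. b (1 - x)", OF _ \<psi> bB])
    show "phase_on (1 - x0) z (\<lambda>x. b (1 - x)) (\<lambda>x. real k * P - \<Phi> (1 - x))"
      unfolding phase_on_def
    proof (intro conjI ballI)
      show "real k * P - \<Phi> (1 - 0) = 0" using end1 by simp
      fix x
      have "((\<lambda>x. real k * P - \<Phi> (1 - x)) has_real_derivative
          0 - - (z * (1 - K (\<Phi> (1 - x))) + b (1 - x) * K (\<Phi> (1 - x)))) (at x)"
        by (intro DERIV_diff DERIV_const DERIV_shift_reflect(2) \<Phi>')
      then show "((\<lambda>x. real k * P - \<Phi> (1 - x)) has_real_derivative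
          z * (1 - K (real k * P - \<Phi> (1 - x))) + b (1 - x) * K (real k * P - \<Phi> (1 - x))) (at x)"
        by (simp add: K_reflect add.commute)
    qed
  qed (use x0 QR in \<open>auto simp: b_def Q_def\<close>)
  ultimately show ?thesis by simp
qed

text \<open>Dividing the identity of \<open>phases_meet\<close> by \<open>z\<close> writes k P / z
  as two summands, neither of which grows with \<open>z\<close>; this is the ratio estimate before
  raising to the power \<open>p\<close>. Under equality neither summand drops, so \<open>q\<close>
  vanishes at each endpoint that borders a part of positive length.\<close>

lemma eigenvalue_ratio:
  assumes q: "continuous_on {0..1} q" and q_le: "\<And>x. x \<in> {0..1} \<Longrightarrow> q x \<le> 0"
    and x0: "x0 \<in> {0..1}" and inc: "mono_on {0..x0} q" and dec: "antimono_on {x0..1} q"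
    and lam: "strict_mono_on {1..} lam" "lam ` {1..} = {\<mu>. dirichlet_eigenvalue p q \<mu>}"
    and m: "m \<ge> (1::nat)" and n: "n \<ge> (1::nat)" and less: "lam m < lam n"
    and pos: "0 < lam m" and large: "- q 0 \<le> lam m" "- q 1 \<le> lam m"
  shows "real n powr p / real m powr p \<le> lam n / lam m"
    and "lam n / lam m = real n powr p / real m powr p \<Longrightarrow> x \<in> {0<..<1} \<Longrightarrow> q x = 0"
proof -
  define z1 where "z1 = lam m powr (1 / p)"
  define z2 where "z2 = lam n powr (1 / p)"
  have z: "0 < z1" "z1 < z2" "0 < z2" "z1 powr p = lam m" "z2 powr p = lam n"
    using p_gt_1 pos less by (auto simp: z1_def z2_def powr_powr intro!: powr_less_mono2)
  \<comment> \<open>Each part of \<open>- q\<close>, measured from its endpoint and continued by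
    constants, is continuous and antitone on the whole line, as
    \<open>phase_over_parameter_decreasing\<close> requires.\<close>
  define QL where "QL x = - q (max 0 (min x0 x))" for x
  define QR where "QR x = - q (1 - max 0 (min (1 - x0) x))" for x
  have QL_cont: "continuous_on UNIV QL"
    unfolding QL_def using x0
    by (intro continuous_on_minus continuous_clamp continuous_on_subset[OF q]) auto
  have QR_cont: "continuous_on UNIV QR"
  proof -
    have "continuous_on {0..1 - x0} (\<lambda>x. q (1 - x))"
      by (rule continuous_on_compose2[OF q]) (use x0 in \<open>auto intro!: continuous_intros\<close>)
    from continuous_clamp[OF this] x0 show ?thesis
      unfolding QR_def by (intro continuous_on_minus) auto
  qed
  have QL_anti: "QL y \<le> QL x" and QR_anti: "QR y \<le> QR x" if "x \<le> y" for x y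
    using antimono_clamped_left[OF inc _ that] antimono_clamped_right[OF dec _ that] x0
    by (auto simp: QL_def QR_def)
  have QL_nonneg: "0 \<le> QL x" for x using q_le[of "max 0 (min x0 x)"] x0 by (auto simp: QL_def)
  have QR_nonneg: "0 \<le> QR x" for x
    using q_le[of "1 - max 0 (min (1 - x0) x)"] x0 by (auto simp: QR_def)
  have QL_le: "QL x \<le> lam m" for x
  proof -
    have "q 0 \<le> q (max 0 (min x0 x))" by (rule mono_onD[OF inc]) (use x0 in auto)
    then show ?thesis using large(1) by (simp add: QL_def)
  qed
  have QR_le: "QR x \<le> lam m" for x
  proof -
    have "q 1 \<le> q (1 - max 0 (min (1 - x0) x))" by (rule monotone_onD[OF dec]) (use x0 in auto)
    then show ?thesis using large(2) by (simp add: QR_def)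
  qed
  obtain \<phi> where \<phi>: "\<And>z. \<phi> z 0 = 0"
    "\<And>z x. (\<phi> z has_real_derivative z + z powr (1 - p) * QL x * K (\<phi> z x)) (at x)"
    using phase_family_exists[OF QL_cont QL_nonneg QL_le] by metis
  obtain \<psi> where \<psi>: "\<And>z. \<psi> z 0 = 0"
    "\<And>z x. (\<psi> z has_real_derivative z + z powr (1 - p) * QR x * K (\<psi> z x)) (at x)"
    using phase_family_exists[OF QR_cont QR_nonneg QR_le] by metis
  have meet: "\<phi> s x0 + \<psi> s (1 - x0) = real k * P" if "k \<ge> 1" "0 < s" "s powr p = lam k" for s k
  proof (rule phases_meet[OF q q_le lam that x0])
    show "phase_on x0 s (\<lambda>x. s + s powr (1 - p) * QL x) (\<phi> s)"
      using phase_on_scaled[OF QL_cont QL_nonneg QL_le \<phi> that(2)] .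
    show "phase_on (1 - x0) s (\<lambda>x. s + s powr (1 - p) * QR x) (\<psi> s)"
      using phase_on_scaled[OF QR_cont QR_nonneg QR_le \<psi> that(2)] .
  qed (auto simp: QL_def QR_def)
  have meet1: "real m * P / z1 = \<phi> z1 x0 / z1 + \<psi> z1 (1 - x0) / z1"
    using meet[OF m z(1,4)] by (simp flip: add_divide_distrib)
  have meet2: "real n * P / z2 = \<phi> z2 x0 / z2 + \<psi> z2 (1 - x0) / z2"
    using meet[OF n z(3,5)] by (simp flip: add_divide_distrib)
  have Qz: "QL x \<le> z1 powr p" "QR x \<le> z1 powr p" for x using QL_le QR_le z(4) by simp_all
  have c: "0 \<le> x0" "0 \<le> 1 - x0" using x0 by auto
  have L: "\<phi> z2 x0 / z2 \<le> \<phi> z1 x0 / z1"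
      "0 < x0 \<Longrightarrow> 0 < QL 0 \<Longrightarrow> \<phi> z2 x0 / z2 < \<phi> z1 x0 / z1"
    using phase_over_parameter_decreasing[OF QL_cont QL_nonneg QL_anti Qz(1) \<phi> z(1,2) c(1)]
    by blast+
  have R: "\<psi> z2 (1 - x0) / z2 \<le> \<psi> z1 (1 - x0) / z1"
      "0 < 1 - x0 \<Longrightarrow> 0 < QR 0 \<Longrightarrow> \<psi> z2 (1 - x0) / z2 < \<psi> z1 (1 - x0) / z1"
    using phase_over_parameter_decreasing[OF QR_cont QR_nonneg QR_anti Qz(2) \<psi> z(1,2) c(2)]
    by blast+
  have cross: "real n * P / z2 \<le> real m * P / z1"
    unfolding meet1 meet2 using L(1) R(1) by simp
  have ratio: "lam n / lam m = (z2 / z1) powr p"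
    using z by (simp add: powr_divide)
  have nm: "real n powr p / real m powr p = (real n / real m) powr p" by (simp add: powr_divide)
  have "real n * z1 \<le> real m * z2"
    using cross z P_pos by (simp add: field_simps)
  then have "real n / real m \<le> z2 / z1" using z m by (simp add: field_simps)
  then show "real n powr p / real m powr p \<le> lam n / lam m"
    unfolding ratio nm using p_gt_1 by (intro powr_mono2) auto
  assume eq: "lam n / lam m = real n powr p / real m powr p" and x: "x \<in> {0<..<1}"
  have "((z2 / z1) powr p) powr (1 / p) = ((real n / real m) powr p) powr (1 / p)"
    using eq unfolding ratio nm by simp
  then have "z2 / z1 = real n / real m" using p_gt_1 z by (simp add: powr_powr)
  then have "real n * P / z2 = real m * P / z1" using z m n by (simp add: field_simps)
  \<comment> \<open>Two inequalities in the same direction whose sums agree are both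
    equalities.\<close>
  then have "\<phi> z2 x0 / z2 = \<phi> z1 x0 / z1" "\<psi> z2 (1 - x0) / z2 = \<psi> z1 (1 - x0) / z1"
    unfolding meet1 meet2 using L(1) R(1) by linarith+
  then have zeroL: "QL 0 = 0" if "0 < x0"
    using L(2)[OF that] QL_nonneg[of 0] by force
  have zeroR: "QR 0 = 0" if "x0 < 1"
    using R(2) that QR_nonneg[of 0] \<open>\<psi> z2 (1 - x0) / z2 = \<psi> z1 (1 - x0) / z1\<close> by force
  show "q x = 0"
  \<comment> \<open>As \<open>x\<close> is interior, the part containing it has positive length even
    if \<open>x0\<close> is 0 or 1. On that part \<open>- q\<close> is nonnegative and at most its
    value at the endpoint, which is 0.\<close>
  proof (cases "x \<le> x0")
    case True
    then have "QL x = - q x" using x by (simp add: QL_def)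
    moreover have "QL x \<le> QL 0" using x by (intro QL_anti) simp
    ultimately show ?thesis using zeroL QL_nonneg[of x] True x by simp
  next
    case False
    then have "QR (1 - x) = - q x" using x by (simp add: QR_def)
    moreover have "QR (1 - x) \<le> QR 0" using x by (intro QR_anti) simp
    ultimately show ?thesis using zeroR QR_nonneg[of "1 - x"] False x by simp
  qed
qed

end

theorem theorem2p4:
  fixes p :: real and q :: "real \<Rightarrow> real" and lam :: "nat \<Rightarrow> real" and m n :: nat
  assumes "p > 1"
    and "continuous_on {0..1} q"
    and "single_barrier q"
    and "\<forall>x\<in>{0..1}. q x \<le> 0"
    and "strict_mono_on {1..} lam"
    and "lam ` {1..} = {\<mu>. dirichlet_eigenvalue p q \<mu>}"
    and "n \<ge> 1" and "m \<ge> 1"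
    and "lam n > lam m" and "lam m \<ge> - 2 * Inf {q 0, q 1}"
  shows "lam n / lam m \<ge> real n powr p / real m powr p \<and>
         (lam n / lam m = real n powr p / real m powr p \<longrightarrow> (\<forall>x\<in>{0<..<1}. q x = 0))"
proof -
  obtain P S D where "p_trig p P S D" using p_trig_exists[OF assms(1)] by blast
  then interpret p_trig p P S D .
  obtain x0 where x0: "x0 \<in> {0..1}" and inc: "mono_on {0..x0} q" and dec: "antimono_on {x0..1} q"
    using assms(3) by (auto simp: single_barrier_def)
  have q01: "q 0 \<le> 0" "q 1 \<le> 0" using assms(4) by auto
  have large: "lam m \<ge> - 2 * q 0" "lam m \<ge> - 2 * q 1"
    using assms(10) unfolding Inf_pair by linarith+
  have "dirichlet_eigenvalue p q (lam m)" using assms(6,8) by auto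
  then obtain x where x: "x \<in> {0..1}" "q x < lam m" using eigenvalue_exceeds assms(2) by blast
  \<comment> \<open>A single-barrier function takes its minimum at an endpoint.\<close>
  have "q 0 \<le> q x \<or> q 1 \<le> q x"
  proof (cases "x \<le> x0")
    case True
    then have "q 0 \<le> q x" by (intro mono_onD[OF inc]) (use x x0 in auto)
    then show ?thesis ..
  next
    case False
    then have "q 1 \<le> q x" by (intro monotone_onD[OF dec]) (use x x0 in auto)
    then show ?thesis ..
  qed
  \<comment> \<open>At the endpoint e just found, q e < lam m and lam m >= -2 q e; twice the first
    added to the second gives 3 lam m > 0.\<close>
  then have pos: "0 < lam m" using large q01 x(2) by linarith
  have "- q 0 \<le> lam m" "- q 1 \<le> lam m" using large q01 by linarith+
  note * = eigenvalue_ratio[OF assms(2) _ x0 inc dec assms(5,6,8,7,9) pos this]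
  show ?thesis using *[OF assms(4)[rule_format]] by blast
qed

end
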